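(* Let $(M,F)$ be an $n$-dimensional Finsler manifold and let $H(TM^0)$ be the horizontal bundle on $TM^0$. A connection $\nabla^2$ on $H(TM^0)$ is basic with respect to the vertical foliation $\mathcal{F}_V$ if and only if in the adapted local frames $\left\{\frac{\delta}{\delta x^i},\frac{\partial}{\partial y^i}\right\}$ of $T(TM^0)$ one has $$\nabla^2_{\frac{\partial}{\partial y^j}}\frac{\delta}{\delta x^i}=0\qquad\text{for all } i,j=1,\dots,n.$$
   Context: $(M,F)$ is a Finsler manifold of dimension $n$; $TM^0=TM\setminus\{\text{zero section}\}$, with induced local coordinates $(x^i,y^i)$, $i=1,\dots,n$, and summation over repeated indices. For a vector bundle $E$, $\Gamma(E)$ denotes its sections. Put $g_{ij}=\frac12\frac{\partial^2F^2}{\partial y^i\partial y^j}$, with inverse $(g^{ij})$. The vertical bundle $V(TM^0)$, locally spanned by $\{\partial/\partial y^i\}$, is tangent to the vertical foliation $\mathcal{F}_V$ (the fibers of $TM^0\to M$). Put $G^i=\frac14g^{ik}\left(\frac{\partial^2F^2}{\partial y^k\partial x^h}y^h-\frac{\partial F^2}{\partial x^k}\right)$, $G_i^j=\frac{\partial G^j}{\partial y^i}$, $\frac{\delta}{\delta x^i}=\frac{\partial}{\partial x^i}-G_i^j\frac{\partial}{\partial y^j}$; these span the horizontal distribution $H(TM^0)$, and $T(TM^0)=H(TM^0)\oplus V(TM^0)$. Let $\pi_1:T(TM^0)\to H(TM^0)$ be the projection along $V(TM^0)$ (so the normal bundle of $\mathcal{F}_V$ is identified with $H(TM^0)$). Definition.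 A connection $\nabla^2$ on $H(TM^0)$ is basic with respect to $\mathcal{F}_V$ if $\nabla^2_XY=\pi_1[X,\widetilde Y]$ for all $X\in\Gamma(V(TM^0))$, $Y\in\Gamma(H(TM^0))$ and all $\widetilde Y\in\Gamma(T(TM^0))$ with $\pi_1(\widetilde Y)=Y$. *)

theory Defs
  imports "HOL-Analysis.Analysis"
begin

subsection \<open>Smooth maps between Euclidean spaces\<close>

text \<open>The notion is meant for open \<open>S\<close>, where \<open>frechet_derivative\<close> at a point of \<open>S\<close> is the
  derivative of \<open>f\<close> and depends only on \<open>f\<close> near that point.\<close>

primrec Ck_on :: "nat \<Rightarrow> 'a::real_normed_vector set \<Rightarrow> ('a \<Rightarrow> 'b::real_normed_vector) \<Rightarrow> bool" where
  "Ck_on 0 S f \<longleftrightarrow> continuous_on S f"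
| "Ck_on (Suc k) S f \<longleftrightarrow>
     (\<forall>x\<in>S. f differentiable (at x)) \<and> (\<forall>v. Ck_on k S (\<lambda>x. frechet_derivative f (at x) v))"

definition smooth_on :: "'a::real_normed_vector set \<Rightarrow> ('a \<Rightarrow> 'b::real_normed_vector) \<Rightarrow> bool" where
  "smooth_on S f \<longleftrightarrow> (\<forall>k. Ck_on k S f)"


subsection \<open>Smooth manifolds\<close>

text \<open>A chart is a pair of a coordinate domain and a coordinate map; the values of the map off the
  domain carry no information.  A manifold is given by an atlas, not necessarily maximal; its
  underlying set is the union of the domains and its topology is the one for which all charts are
  homeomorphisms onto open sets.\<close>

type_synonym ('p, 'e) chart = "'p set \<times> ('p \<Rightarrow> 'e)"

definition chart_inv :: "('p, 'e) chart \<Rightarrow> 'e \<Rightarrow> 'p" where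
  "chart_inv c = inv_into (fst c) (snd c)"

definition carrier_of :: "('p, 'e) chart set \<Rightarrow> 'p set" where
  "carrier_of A = (\<Union>c\<in>A. fst c)"

definition atlas_topology :: "('p, 'e::euclidean_space) chart set \<Rightarrow> 'p topology" where
  "atlas_topology A = topology (\<lambda>W. W \<subseteq> carrier_of A \<and> (\<forall>c\<in>A. open (snd c ` (W \<inter> fst c))))"

definition smooth_manifold :: "('p, 'e::euclidean_space) chart set \<Rightarrow> bool" where
  "smooth_manifold A \<longleftrightarrow>
     (\<forall>c\<in>A. inj_on (snd c) (fst c) \<and> open (snd c ` fst c)) \<and>
     (\<forall>c\<in>A. \<forall>d\<in>A. open (snd c ` (fst c \<inter> fst d)) \<and>
        smooth_on (snd c ` (fst c \<inter> fst d)) (snd d \<circ> chart_inv c)) \<and>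
     Hausdorff_space (atlas_topology A) \<and> second_countable (atlas_topology A)"

definition smooth_fun :: "('p, 'e::euclidean_space) chart set \<Rightarrow> ('p \<Rightarrow> real) \<Rightarrow> bool" where
  "smooth_fun A f \<longleftrightarrow> (\<forall>c\<in>A. smooth_on (snd c ` fst c) (f \<circ> chart_inv c))"

text \<open>Derivative of \<open>f\<close> in the constant direction \<open>e\<close> of the coordinates \<open>c\<close>, as a function on
  \<open>fst c\<close>.  With \<open>e\<close> a basis vector this is the partial derivative by that coordinate.\<close>

definition coord_deriv :: "('p, 'e::euclidean_space) chart \<Rightarrow> 'e \<Rightarrow> ('p \<Rightarrow> real) \<Rightarrow> 'p \<Rightarrow> real" where
  "coord_deriv c e f p = frechet_derivative (f \<circ> chart_inv c) (at (snd c p)) e"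


subsection \<open>Tangent vectors and vector fields\<close>

text \<open>A tangent vector at \<open>p\<close> is the family of its components in the charts around \<open>p\<close>, which are
  related by the derivatives of the coordinate changes.  The value at every other argument is
  fixed to be \<open>0\<close>, so that equality of tangent vectors is equality of functions.\<close>

type_synonym ('p, 'e) tvec = "('p, 'e) chart \<Rightarrow> 'e"
type_synonym ('p, 'e) vfield = "'p \<Rightarrow> ('p, 'e) tvec"

definition tangent_space :: "('p, 'e::euclidean_space) chart set \<Rightarrow> 'p \<Rightarrow> ('p, 'e) tvec set" where
  "tangent_space A p =
     {v. (\<forall>c\<in>A. \<forall>d\<in>A. p \<in> fst c \<inter> fst d \<longrightarrow>
            v d = frechet_derivative (snd d \<circ> chart_inv c) (at (snd c p)) (v c)) \<and>
         (\<forall>c. \<not> (c \<in> A \<and> p \<in> fst c) \<longrightarrow> v c = 0)}"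

definition tv_zero :: "('p, 'e::euclidean_space) tvec" where
  "tv_zero = (\<lambda>c. 0)"

definition tv_add :: "('p, 'e::euclidean_space) tvec \<Rightarrow> ('p, 'e) tvec \<Rightarrow> ('p, 'e) tvec" where
  "tv_add v w = (\<lambda>c. v c + w c)"

definition tv_scale :: "real \<Rightarrow> ('p, 'e::euclidean_space) tvec \<Rightarrow> ('p, 'e) tvec" where
  "tv_scale r v = (\<lambda>c. r *\<^sub>R v c)"

definition vf_add :: "('p, 'e::euclidean_space) vfield \<Rightarrow> ('p, 'e) vfield \<Rightarrow> ('p, 'e) vfield" where
  "vf_add X Y = (\<lambda>p. tv_add (X p) (Y p))"

definition vf_scale :: "('p \<Rightarrow> real) \<Rightarrow> ('p, 'e::euclidean_space) vfield \<Rightarrow> ('p, 'e) vfield" where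
  "vf_scale f X = (\<lambda>p. tv_scale (f p) (X p))"

text \<open>A distribution is given by its fibres \<open>E p\<close>, subspaces of the tangent spaces.  Its global
  smooth sections are set to zero off the manifold, again to make equality of sections literal.\<close>

definition gsections ::
    "('p, 'e::euclidean_space) chart set \<Rightarrow> ('p \<Rightarrow> ('p, 'e) tvec set) \<Rightarrow> ('p, 'e) vfield set" where
  "gsections A E =
     {X. (\<forall>p\<in>carrier_of A. X p \<in> tangent_space A p \<and> X p \<in> E p) \<and>
         (\<forall>p. p \<notin> carrier_of A \<longrightarrow> X p = tv_zero) \<and>
         (\<forall>c\<in>A. smooth_on (snd c ` fst c) (\<lambda>z. X (chart_inv c z) c))}"

definition vfields :: "('p, 'e::euclidean_space) chart set \<Rightarrow> ('p, 'e) vfield set" where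
  "vfields A = gsections A (tangent_space A)"

text \<open>The coordinate field of the chart \<open>c\<close> in direction \<open>e\<close>, a local field on \<open>fst c\<close>: its
  component in \<open>c\<close> is constantly \<open>e\<close>.\<close>

definition coord_field ::
    "('p, 'e::euclidean_space) chart set \<Rightarrow> ('p, 'e) chart \<Rightarrow> 'e \<Rightarrow> ('p, 'e) vfield" where
  "coord_field A c e p =
     (\<lambda>d. if d \<in> A \<and> p \<in> fst d
          then frechet_derivative (snd d \<circ> chart_inv c) (at (snd c p)) e else 0)"

text \<open>The derivative \<open>v f\<close>; the chart used to compute it is immaterial.\<close>

definition tv_apply ::
    "('p, 'e::euclidean_space) chart set \<Rightarrow> 'p \<Rightarrow> ('p, 'e) tvec \<Rightarrow> ('p \<Rightarrow> real) \<Rightarrow> real" where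
  "tv_apply A p v f = (let c = (SOME c. c \<in> A \<and> p \<in> fst c) in coord_deriv c (v c) f p)"

text \<open>In coordinates, \<open>[X, Y]\<^sup>k = X\<^sup>i \<partial>\<^sub>i Y\<^sup>k - Y\<^sup>i \<partial>\<^sub>i X\<^sup>k\<close>.\<close>

definition lie_bracket ::
    "('p, 'e::euclidean_space) chart set \<Rightarrow> ('p, 'e) vfield \<Rightarrow> ('p, 'e) vfield \<Rightarrow> ('p, 'e) vfield" where
  "lie_bracket A X Y p =
     (\<lambda>c. if c \<in> A \<and> p \<in> fst c
          then frechet_derivative (\<lambda>z. Y (chart_inv c z) c) (at (snd c p)) (X p c)
             - frechet_derivative (\<lambda>z. X (chart_inv c z) c) (at (snd c p)) (Y p c)
          else 0)"


subsection \<open>Connections on a distribution\<close>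

definition connection_on ::
    "('p, 'e::euclidean_space) chart set \<Rightarrow> ('p \<Rightarrow> ('p, 'e) tvec set) \<Rightarrow>
     (('p, 'e) vfield \<Rightarrow> ('p, 'e) vfield \<Rightarrow> ('p, 'e) vfield) \<Rightarrow> bool" where
  "connection_on A E D \<longleftrightarrow>
     (\<forall>X\<in>vfields A. \<forall>Y\<in>gsections A E. D X Y \<in> gsections A E) \<and>
     (\<forall>X\<in>vfields A. \<forall>X'\<in>vfields A. \<forall>Y\<in>gsections A E.
        D (vf_add X X') Y = vf_add (D X Y) (D X' Y)) \<and>
     (\<forall>f. \<forall>X\<in>vfields A. \<forall>Y\<in>gsections A E. smooth_fun A f \<longrightarrow>
        D (vf_scale f X) Y = vf_scale f (D X Y)) \<and>
     (\<forall>X\<in>vfields A. \<forall>Y\<in>gsections A E. \<forall>Y'\<in>gsections A E.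
        D X (vf_add Y Y') = vf_add (D X Y) (D X Y')) \<and>
     (\<forall>f. \<forall>X\<in>vfields A. \<forall>Y\<in>gsections A E. smooth_fun A f \<longrightarrow>
        D X (vf_scale f Y) = vf_add (vf_scale f (D X Y)) (vf_scale (\<lambda>p. tv_apply A p (X p) f) Y))"

definition agree_near ::
    "('p, 'e::euclidean_space) chart set \<Rightarrow> 'p \<Rightarrow> ('p, 'e) vfield \<Rightarrow> ('p, 'e) vfield \<Rightarrow> bool" where
  "agree_near A p X Y \<longleftrightarrow> (\<exists>W. openin (atlas_topology A) W \<and> p \<in> W \<and> (\<forall>q\<in>W. X q = Y q))"

text \<open>A connection is a local operator, so it acts on fields \<open>X\<close> and \<open>Y\<close> that are defined only near
  \<open>p\<close>: the value at \<open>p\<close> is the one obtained from any global sections with the same germs at \<open>p\<close>.\<close>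

definition local_value ::
    "('p, 'e::euclidean_space) chart set \<Rightarrow> ('p \<Rightarrow> ('p, 'e) tvec set) \<Rightarrow>
     (('p, 'e) vfield \<Rightarrow> ('p, 'e) vfield \<Rightarrow> ('p, 'e) vfield) \<Rightarrow>
     ('p, 'e) vfield \<Rightarrow> ('p, 'e) vfield \<Rightarrow> 'p \<Rightarrow> ('p, 'e) tvec" where
  "local_value A E D X Y p =
     (THE w. \<forall>X'\<in>vfields A. \<forall>Y'\<in>gsections A E.
        agree_near A p X' X \<and> agree_near A p Y' Y \<longrightarrow> D X' Y' p = w)"


subsection \<open>The tangent bundle and its slit part\<close>

text \<open>Points of \<open>TM\<close> are pairs of a point and a tangent vector.  Every chart of \<open>M\<close> induces
  coordinates \<open>(x, y)\<close> on the part of \<open>TM\<^sup>0\<close> over its domain.\<close>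

type_synonym ('m, 'e) tpoint = "'m \<times> ('m, 'e) tvec"

definition tangent_bundle :: "('m, 'e::euclidean_space) chart set \<Rightarrow> ('m, 'e) tpoint set" where
  "tangent_bundle A = (SIGMA p:carrier_of A. tangent_space A p)"

definition slit_chart ::
    "('m, 'e::euclidean_space) chart set \<Rightarrow> ('m, 'e) chart \<Rightarrow> (('m, 'e) tpoint, 'e \<times> 'e) chart" where
  "slit_chart A c =
     ({(p, v). p \<in> fst c \<and> v \<in> tangent_space A p \<and> v \<noteq> tv_zero}, \<lambda>(p, v). (snd c p, v c))"

definition slit_atlas ::
    "('m, 'e::euclidean_space) chart set \<Rightarrow> (('m, 'e) tpoint, 'e \<times> 'e) chart set" where
  "slit_atlas A = slit_chart A ` A"


subsection \<open>Finsler manifolds\<close>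

type_synonym ('m, 'n) rchart = "('m, real ^ 'n) chart"
type_synonym ('m, 'n) tmpoint = "('m, real ^ 'n) tpoint"
type_synonym ('m, 'n) slitvec = "(('m, 'n) tmpoint, (real ^ 'n) \<times> (real ^ 'n)) tvec"
type_synonym ('m, 'n) slitfield = "(('m, 'n) tmpoint, (real ^ 'n) \<times> (real ^ 'n)) vfield"

definition pd_x :: "('m, 'n::finite) rchart set \<Rightarrow> ('m, 'n) rchart \<Rightarrow> 'n \<Rightarrow>
    (('m, 'n) tmpoint \<Rightarrow> real) \<Rightarrow> ('m, 'n) tmpoint \<Rightarrow> real" where
  "pd_x A c i f = coord_deriv (slit_chart A c) (axis i 1, 0) f"

definition pd_y :: "('m, 'n::finite) rchart set \<Rightarrow> ('m, 'n) rchart \<Rightarrow> 'n \<Rightarrow>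
    (('m, 'n) tmpoint \<Rightarrow> real) \<Rightarrow> ('m, 'n) tmpoint \<Rightarrow> real" where
  "pd_y A c i f = coord_deriv (slit_chart A c) (0, axis i 1) f"

definition fund_tensor :: "('m, 'n::finite) rchart set \<Rightarrow> (('m, 'n) tmpoint \<Rightarrow> real) \<Rightarrow>
    ('m, 'n) rchart \<Rightarrow> ('m, 'n) tmpoint \<Rightarrow> real ^ 'n ^ 'n" where
  "fund_tensor A F c u = (\<chi> i j. 1/2 * pd_y A c i (pd_y A c j (\<lambda>q. (F q)\<^sup>2)) u)"

text \<open>Continuity of \<open>F\<close> on all of \<open>TM\<close>, its vanishing on the zero section and its positivity
  elsewhere follow from the conditions below.\<close>

definition finsler_manifold ::
    "('m, 'n::finite) rchart set \<Rightarrow> (('m, 'n) tmpoint \<Rightarrow> real) \<Rightarrow> bool" where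
  "finsler_manifold A F \<longleftrightarrow>
     smooth_manifold A \<and>
     (\<forall>u\<in>tangent_bundle A. F u \<ge> 0) \<and>
     (\<forall>(p, v)\<in>tangent_bundle A. \<forall>r>0. F (p, tv_scale r v) = r * F (p, v)) \<and>
     smooth_fun (slit_atlas A) F \<and>
     (\<forall>c\<in>A. \<forall>u\<in>fst (slit_chart A c). \<forall>\<xi>. \<xi> \<noteq> 0 \<longrightarrow>
        (\<Sum>i\<in>UNIV. \<Sum>j\<in>UNIV. fund_tensor A F c u $ i $ j * \<xi> $ i * \<xi> $ j) > 0)"

text \<open>The functions \<open>G\<^sup>i\<close>; the coordinate \<open>y\<^sup>h\<close> of \<open>u\<close> is \<open>snd u c $ h\<close>.\<close>

definition spray_coeff :: "('m, 'n::finite) rchart set \<Rightarrow> (('m, 'n) tmpoint \<Rightarrow> real) \<Rightarrow>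
    ('m, 'n) rchart \<Rightarrow> 'n \<Rightarrow> ('m, 'n) tmpoint \<Rightarrow> real" where
  "spray_coeff A F c i u =
     1/4 * (\<Sum>k\<in>UNIV. matrix_inv (fund_tensor A F c u) $ i $ k *
       ((\<Sum>h\<in>UNIV. pd_y A c k (pd_x A c h (\<lambda>q. (F q)\<^sup>2)) u * snd u c $ h)
        - pd_x A c k (\<lambda>q. (F q)\<^sup>2) u))"

text \<open>\<open>nonlin_coeff A F c i j\<close> is \<open>G\<^sub>i\<^sup>j = \<partial>G\<^sup>j/\<partial>y\<^sup>i\<close>.\<close>

definition nonlin_coeff :: "('m, 'n::finite) rchart set \<Rightarrow> (('m, 'n) tmpoint \<Rightarrow> real) \<Rightarrow>
    ('m, 'n) rchart \<Rightarrow> 'n \<Rightarrow> 'n \<Rightarrow> ('m, 'n) tmpoint \<Rightarrow> real" where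
  "nonlin_coeff A F c i j = pd_y A c i (spray_coeff A F c j)"

text \<open>The adapted local frame: \<open>vframe A c j\<close> is \<open>\<partial>/\<partial>y\<^sup>j\<close> and \<open>hframe A F c i\<close> is
  \<open>\<delta>/\<delta>x\<^sup>i = \<partial>/\<partial>x\<^sup>i - G\<^sub>i\<^sup>j \<partial>/\<partial>y\<^sup>j\<close>.\<close>

definition vframe :: "('m, 'n::finite) rchart set \<Rightarrow> ('m, 'n) rchart \<Rightarrow> 'n \<Rightarrow> ('m, 'n) slitfield" where
  "vframe A c j = coord_field (slit_atlas A) (slit_chart A c) (0, axis j 1)"

definition hframe :: "('m, 'n::finite) rchart set \<Rightarrow> (('m, 'n) tmpoint \<Rightarrow> real) \<Rightarrow>
    ('m, 'n) rchart \<Rightarrow> 'n \<Rightarrow> ('m, 'n) slitfield" where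
  "hframe A F c i u =
     (\<lambda>d. coord_field (slit_atlas A) (slit_chart A c) (axis i 1, 0) u d
          - (\<Sum>j\<in>UNIV. nonlin_coeff A F c i j u *\<^sub>R vframe A c j u d))"

text \<open>The spans of the two halves of the adapted frame do not depend on the chart; the fibres are
  therefore described by all charts around the base point at once.\<close>

definition vertical :: "('m, 'n::finite) rchart set \<Rightarrow> ('m, 'n) tmpoint \<Rightarrow> ('m, 'n) slitvec set" where
  "vertical A u =
     {w. \<forall>c\<in>A. u \<in> fst (slit_chart A c) \<longrightarrow>
           (\<exists>a :: 'n \<Rightarrow> real. w = (\<lambda>d. \<Sum>j\<in>UNIV. a j *\<^sub>R vframe A c j u d))}"

definition horizontal :: "('m, 'n::finite) rchart set \<Rightarrow> (('m, 'n) tmpoint \<Rightarrow> real) \<Rightarrow>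
    ('m, 'n) tmpoint \<Rightarrow> ('m, 'n) slitvec set" where
  "horizontal A F u =
     {w. \<forall>c\<in>A. u \<in> fst (slit_chart A c) \<longrightarrow>
           (\<exists>a :: 'n \<Rightarrow> real. w = (\<lambda>d. \<Sum>i\<in>UNIV. a i *\<^sub>R hframe A F c i u d))}"

text \<open>The projection \<open>\<pi>\<^sub>1\<close> of \<open>T(TM\<^sup>0) = H(TM\<^sup>0) \<oplus> V(TM\<^sup>0)\<close> onto the first summand.\<close>

definition hproj :: "('m, 'n::finite) rchart set \<Rightarrow> (('m, 'n) tmpoint \<Rightarrow> real) \<Rightarrow>
    ('m, 'n) slitfield \<Rightarrow> ('m, 'n) slitfield" where
  "hproj A F X u =
     (if u \<in> carrier_of (slit_atlas A)
      then (THE h. h \<in> horizontal A F u \<and> (\<exists>w\<in>vertical A u. X u = tv_add h w))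
      else tv_zero)"

definition basic_connection :: "('m, 'n::finite) rchart set \<Rightarrow> (('m, 'n) tmpoint \<Rightarrow> real) \<Rightarrow>
    (('m, 'n) slitfield \<Rightarrow> ('m, 'n) slitfield \<Rightarrow> ('m, 'n) slitfield) \<Rightarrow> bool" where
  "basic_connection A F D \<longleftrightarrow>
     (\<forall>X\<in>gsections (slit_atlas A) (vertical A).
      \<forall>Y\<in>gsections (slit_atlas A) (horizontal A F).
      \<forall>Y'\<in>vfields (slit_atlas A).
        hproj A F Y' = Y \<longrightarrow> D X Y = hproj A F (lie_bracket (slit_atlas A) X Y'))"

end

theory Submission
  imports Defs
begin

text \<open>In a slit chart \<open>c\<close> with coordinates \<open>(x, y)\<close>, a tangent vector is vertical iff its \<open>x\<close>-part
  vanishes, and horizontal iff it has the form \<open>(a, - N a)\<close> with \<open>N\<close> the fibre derivative of the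
  spray coefficients \<open>G\<close>.  So \<open>\<pi>\<^sub>1\<close> is determined by the \<open>x\<close>-part, and since the \<open>x\<close>-part of a vertical
  \<open>X\<close> is identically zero, \<open>\<pi>\<^sub>1[X, Y']\<close> is the horizontal vector whose \<open>x\<close>-part is the derivative along
  \<open>X\<close> of the \<open>x\<close>-part of \<open>Y'\<close>, which is also that of \<open>Y = \<pi>\<^sub>1 Y'\<close>.  For \<open>Y = \<delta>/\<delta>x\<^sup>i\<close> this part is constant,
  which gives one direction; writing \<open>Y = b\<^sup>i \<delta>/\<delta>x\<^sup>i\<close> near a point, the Leibniz rule gives the other.

  Two facts are needed to speak of the frames by means of global sections.  The horizontal spaces must
  not depend on the chart: the equation defining \<open>G\<close> is the Euler--Lagrange equation of \<open>F\<^sup>2\<close>, whose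
  covariance under \<open>x' = \<psi> x\<close> yields \<open>G' = D\<psi> G - 1/2 D\<^sup>2\<psi>(y, y)\<close>, hence
  \<open>N' (D\<psi> a) = D\<psi> (N a) - D\<^sup>2\<psi>(y, a)\<close>.  And local fields must extend: this uses smooth bump functions and
  the Hausdorff property of the slit tangent bundle.\<close>

section \<open>Calculus of smooth maps\<close>

text \<open>A connection acts on global sections, but the frames live over one chart. So
  \<open>local_value\<close> is a definite description, and it carries information only if both
  frame fields have global extensions and all extensions give the same value. The second point is
  the locality of the connection, which follows from function linearity and the Leibniz rule on
  multiplying by a bump function. The fibres \<open>vertical\<close> and \<open>horizontal\<close>
  ask for a representation in every chart at once, so even the frame of a single chart is known to
  lie in them only after changes of coordinates are understood. The law for \<open>G\<close> is not
  read off from its formula, which contains an inverse matrix: both sides solve one linear equation,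
  whose solution is unique because the fibre Hessian of the squared \<open>F\<close> is positive
  definite. The same linear system gives smoothness of \<open>G\<close> by Cramer's rule. In the
  calculus, \<open>Ck_on\<close> differentiates in constant directions only, whereas coordinate
  changes of the tangent bundle differentiate in the moving direction \<open>y\<close>; expanding
  directions in a basis bridges the gap.\<close>

abbreviation FD :: "('a::real_normed_vector \<Rightarrow> 'b::real_normed_vector) \<Rightarrow> 'a \<Rightarrow> 'a \<Rightarrow> 'b" where
  "FD f x \<equiv> frechet_derivative f (at x)"

lemma has_derivative_FD: "f differentiable (at x) \<Longrightarrow> (f has_derivative FD f x) (at x)"
  by (simp add: frechet_derivative_works)

lemma FD_eqI: "(f has_derivative f') (at x) \<Longrightarrow> FD f x = f'"
  using frechet_derivative_at by metis

lemma differentiable_cong_open: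
  assumes "f differentiable (at x)" "open S" "x \<in> S" "\<And>y. y \<in> S \<Longrightarrow> f y = g y"
  shows "g differentiable (at x)"
  using assms has_derivative_transform_within_open unfolding differentiable_def by blast

lemma FD_cong_open:
  assumes "open S" "x \<in> S" "\<And>y. y \<in> S \<Longrightarrow> f y = g y"
  shows "FD f x = FD g x"
proof (cases "f differentiable (at x)")
  case True
  then show ?thesis
    using assms by (intro frechet_derivative_transform_within_open)
next
  case False
  have "(f has_derivative f') (at x) = (g has_derivative f') (at x)" for f'
    using assms has_derivative_transform_within_open[of f f' x UNIV S g]
      has_derivative_transform_within_open[of g f' x UNIV S f] by auto
  then show ?thesis unfolding frechet_derivative_def by simp
qed

lemma Ck_on_cong:
  assumes "open S" "Ck_on k S f" "\<And>x. x \<in> S \<Longrightarrow> f x = g x"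
  shows "Ck_on k S g"
  using assms(2,3)
proof (induction k arbitrary: f g)
  case 0
  then show ?case using continuous_on_cong[of S S f g] by simp
next
  case (Suc k)
  have d: "g differentiable (at x)" if "x \<in> S" for x
    using differentiable_cong_open[of f x S g] assms(1) Suc.prems that by auto
  moreover have "Ck_on k S (\<lambda>x. FD g x v)" for v
  proof (rule Suc.IH)
    show "Ck_on k S (\<lambda>x. FD f x v)" using Suc.prems by auto
    show "FD f x v = FD g x v" if "x \<in> S" for x
      using FD_cong_open[of S x f g] assms(1) Suc.prems(2) that by auto
  qed
  ultimately show ?case by auto
qed

lemma Ck_on_SucD: "Ck_on (Suc k) S f \<Longrightarrow> Ck_on k S f"
proof (induction k arbitrary: f)
  case 0
  then show ?case
    by (auto intro!: continuous_at_imp_continuous_on differentiable_imp_continuous_within)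
next
  case (Suc k)
  show ?case unfolding Ck_on.simps(2)[of k]
    using Suc.prems Suc.IH Ck_on.simps(2) by blast
qed

lemma Ck_on_subset: "Ck_on k S f \<Longrightarrow> T \<subseteq> S \<Longrightarrow> Ck_on k T f"
  by (induction k arbitrary: f) (auto intro: continuous_on_subset)

lemma Ck_on_local:
  assumes "\<And>x. x \<in> S \<Longrightarrow> \<exists>T. open T \<and> x \<in> T \<and> Ck_on k T f"
  shows "Ck_on k S f"
  using assms
proof (induction k arbitrary: f)
  case 0
  have "isCont f x" if "x \<in> S" for x
    using 0[OF that] continuous_on_interior[of _ f x] by (auto simp: interior_open)
  then show ?case by (simp add: continuous_at_imp_continuous_on)
next
  case (Suc k)
  show ?case unfolding Ck_on.simps
  proof (intro conjI ballI allI)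
    show "f differentiable (at x)" if "x \<in> S" for x
      using Suc.prems[OF that] by auto
    show "Ck_on k S (\<lambda>x. FD f x v)" for v
      by (rule Suc.IH) (use Suc.prems in fastforce)
  qed
qed

lemma Ck_on_const: "Ck_on k S (\<lambda>x. c)"
  by (induction k arbitrary: c) auto

lemma Ck_on_bounded_linear:
  assumes "bounded_linear h" shows "Ck_on k S h"
proof (cases k)
  case 0
  then show ?thesis using assms by (simp add: linear_continuous_on)
next
  case (Suc n)
  have "(h has_derivative h) (at x)" for x
    using assms bounded_linear_imp_has_derivative by blast
  then have "FD h x = h" "h differentiable (at x)" for x
    by (auto simp: FD_eqI differentiable_def)
  then show ?thesis by (simp add: Suc Ck_on_const)
qed

lemma Ck_on_add:
  assumes "open S" "Ck_on k S f" "Ck_on k S g"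
  shows "Ck_on k S (\<lambda>x. f x + g x)"
  using assms(2,3)
proof (induction k arbitrary: f g)
  case 0
  then show ?case by (auto intro: continuous_on_add)
next
  case (Suc k)
  have "((\<lambda>x. f x + g x) has_derivative (\<lambda>v. FD f x v + FD g x v)) (at x)" if "x \<in> S" for x
    using Suc.prems that by (auto intro!: has_derivative_add has_derivative_FD)
  note * = this
  have "Ck_on k S (\<lambda>x. FD (\<lambda>x. f x + g x) x v)" for v
    by (rule Ck_on_cong[OF assms(1), of _ "\<lambda>x. FD f x v + FD g x v"])
       (use Suc FD_eqI[OF *] in auto)
  with * show ?case by (auto simp: differentiable_def)
qed

text \<open>Induction by the product rule. Each of its two terms differentiates only one factor, so
  the other factor must be lowered to order \<open>k\<close> by \<open>Ck_on_SucD\<close>.\<close>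

lemma Ck_on_bilinear:
  assumes "bounded_bilinear p" "open S" "Ck_on k S f" "Ck_on k S g"
  shows "Ck_on k S (\<lambda>x. p (f x) (g x))"
  using assms(3,4)
proof (induction k arbitrary: f g)
  case 0
  then have "continuous_on S f" "continuous_on S g" by simp_all
  from bounded_bilinear.continuous_on[OF assms(1) this] show ?case by simp
next
  case (Suc k)
  have "((\<lambda>x. p (f x) (g x)) has_derivative (\<lambda>v. p (f x) (FD g x v) + p (FD f x v) (g x))) (at x)"
    if "x \<in> S" for x
    using Suc.prems that by (auto intro!: bounded_bilinear.FDERIV[OF assms(1)] has_derivative_FD)
  note * = this
  have "Ck_on k S (\<lambda>x. FD (\<lambda>x. p (f x) (g x)) x v)" for v
    by (rule Ck_on_cong[OF assms(2), of _ "\<lambda>x. p (f x) (FD g x v) + p (FD f x v) (g x)"])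
       (use Suc Ck_on_SucD[OF Suc.prems(1)] Ck_on_SucD[OF Suc.prems(2)] FD_eqI[OF *] in
         \<open>auto intro!: Ck_on_add assms(2)\<close>)
  with * show ?case by (auto simp: differentiable_def)
qed

lemma Ck_on_linear_compose:
  assumes "bounded_linear h" "open S" "Ck_on k S f"
  shows "Ck_on k S (\<lambda>x. h (f x))"
  using assms(3)
proof (induction k arbitrary: f)
  case 0
  then have "continuous_on S f" by simp
  then have "continuous_on S (\<lambda>x. h (f x))" by (rule bounded_linear.continuous_on[OF assms(1)])
  then show ?case by simp
next
  case (Suc k)
  have "((\<lambda>x. h (f x)) has_derivative (\<lambda>v. h (FD f x v))) (at x)" if "x \<in> S" for x
    by (rule bounded_linear.has_derivative[OF assms(1) has_derivative_FD]) (use Suc.prems that in simp)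
  note * = this
  have "Ck_on k S (\<lambda>x. FD (\<lambda>x. h (f x)) x v)" for v
    by (rule Ck_on_cong[OF assms(2), of _ "\<lambda>x. h (FD f x v)"]) (use Suc FD_eqI[OF *] in auto)
  with * show ?case by (auto simp: differentiable_def)
qed

lemma Ck_on_sum:
  assumes "open S" "\<And>i. i \<in> I \<Longrightarrow> Ck_on k S (f i)"
  shows "Ck_on k S (\<lambda>x. \<Sum>i\<in>I. f i x)"
proof (cases "finite I")
  case True
  then show ?thesis using assms(2)
  proof (induction I)
    case empty
    show ?case by (simp add: Ck_on_const)
  next
    case (insert i I)
    have "Ck_on k S (\<lambda>x. f i x + (\<Sum>i\<in>I. f i x))"
      by (rule Ck_on_add[OF assms(1)]) (use insert in blast)+
    then show ?case using insert by simp
  qed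
qed (simp add: Ck_on_const)

text \<open>Reduces a derivative in a varying direction to derivatives in the constant directions of
  \<open>Basis\<close>, the only ones that \<open>Ck_on\<close> controls.\<close>

lemma FD_linear_combination:
  fixes g :: "'b::euclidean_space \<Rightarrow> 'c::real_normed_vector"
  assumes "g differentiable (at y)"
  shows "FD g y w = (\<Sum>b\<in>Basis. (w \<bullet> b) *\<^sub>R FD g y b)"
proof -
  have l: "linear (FD g y)" using assms by (rule linear_frechet_derivative)
  have "FD g y (\<Sum>b\<in>Basis. (w \<bullet> b) *\<^sub>R b) = (\<Sum>b\<in>Basis. (w \<bullet> b) *\<^sub>R FD g y b)"
    by (simp add: linear_sum[OF l] linear_scale[OF l])
  then show ?thesis by (simp add: euclidean_representation)
qed

lemma has_derivative_compose_FD: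
  assumes "f differentiable (at x)" "g differentiable (at (f x))"
  shows "((\<lambda>x. g (f x)) has_derivative (\<lambda>v. FD g (f x) (FD f x v))) (at x)"
  using has_derivative_compose[OF has_derivative_FD[OF assms(1)] has_derivative_FD[OF assms(2)]] .

lemma Ck_on_compose:
  fixes f :: "'a::real_normed_vector \<Rightarrow> 'b::euclidean_space"
  assumes "open S" "Ck_on k S f" "Ck_on k T g" "f ` S \<subseteq> T"
  shows "Ck_on k S (\<lambda>x. g (f x))"
  using assms(2,3)
proof (induction k arbitrary: g)
  case 0
  then show ?case using continuous_on_compose2[of T g S f] assms(4) by simp
next
  case (Suc k)
  have *: "((\<lambda>x. g (f x)) has_derivative (\<lambda>v. FD g (f x) (FD f x v))) (at x)" if "x \<in> S" for x
    using Suc.prems that assms(4) by (intro has_derivative_compose_FD) auto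
  have "Ck_on k S (\<lambda>x. FD (\<lambda>x. g (f x)) x v)" for v
  proof (rule Ck_on_cong[OF assms(1)])
    \<comment> \<open>The chain rule applies \<open>FD g\<close> in the direction
      \<open>FD f x v\<close>, which varies with \<open>x\<close>. After expansion in the basis,
      only fixed-direction derivatives of \<open>g\<close> are composed with \<open>f\<close>, and
      the induction hypothesis covers these.\<close>
    show "Ck_on k S (\<lambda>x. \<Sum>b\<in>Basis. (FD f x v \<bullet> b) *\<^sub>R FD g (f x) b)"
      by (intro Ck_on_sum assms(1) Ck_on_bilinear[OF bounded_bilinear_scaleR] Suc.IH
          Ck_on_linear_compose[OF bounded_linear_inner_left] Ck_on_SucD[OF Suc.prems(1)])
        (use Suc.prems in auto)
    show "(\<Sum>b\<in>Basis. (FD f x v \<bullet> b) *\<^sub>R FD g (f x) b) = FD (\<lambda>x. g (f x)) x v" if "x \<in> S" for x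
      using FD_eqI[OF *[OF that]] FD_linear_combination[of g "f x" "FD f x v"] Suc.prems(2) that assms(4)
      by auto
  qed
  with * show ?case by (auto simp: differentiable_def)
qed

lemma smooth_on_cong: "open S \<Longrightarrow> smooth_on S f \<Longrightarrow> (\<And>x. x \<in> S \<Longrightarrow> f x = g x) \<Longrightarrow> smooth_on S g"
  unfolding smooth_on_def using Ck_on_cong by blast

lemma smooth_on_subset: "smooth_on S f \<Longrightarrow> T \<subseteq> S \<Longrightarrow> smooth_on T f"
  unfolding smooth_on_def using Ck_on_subset by blast

lemma smooth_on_local:
  assumes "\<And>x. x \<in> S \<Longrightarrow> \<exists>T. open T \<and> x \<in> T \<and> smooth_on T f"
  shows "smooth_on S f"
  unfolding smooth_on_def
proof
  show "Ck_on k S f" for k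
    by (rule Ck_on_local) (use assms smooth_on_def in blast)
qed

lemma smooth_on_const: "smooth_on S (\<lambda>x. c)"
  by (simp add: smooth_on_def Ck_on_const)

lemma smooth_on_bounded_linear: "bounded_linear h \<Longrightarrow> smooth_on S h"
  by (simp add: smooth_on_def Ck_on_bounded_linear)

lemma smooth_on_id: "smooth_on S (\<lambda>x. x)"
  by (rule smooth_on_bounded_linear[OF bounded_linear_ident])

lemma smooth_on_add: "open S \<Longrightarrow> smooth_on S f \<Longrightarrow> smooth_on S g \<Longrightarrow> smooth_on S (\<lambda>x. f x + g x)"
  by (simp add: smooth_on_def Ck_on_add)

lemma smooth_on_linear_compose:
  "bounded_linear h \<Longrightarrow> open S \<Longrightarrow> smooth_on S f \<Longrightarrow> smooth_on S (\<lambda>x. h (f x))"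
  by (simp add: smooth_on_def Ck_on_linear_compose)

lemma smooth_on_bilinear:
  "bounded_bilinear p \<Longrightarrow> open S \<Longrightarrow> smooth_on S f \<Longrightarrow> smooth_on S g \<Longrightarrow> smooth_on S (\<lambda>x. p (f x) (g x))"
  by (simp add: smooth_on_def Ck_on_bilinear)

lemmas smooth_on_scaleR = smooth_on_bilinear[OF bounded_bilinear_scaleR]
lemmas smooth_on_mult = smooth_on_bilinear[OF bounded_bilinear_mult]
lemmas smooth_on_inner = smooth_on_bilinear[OF bounded_bilinear_inner]

lemma smooth_on_diff: "open S \<Longrightarrow> smooth_on S f \<Longrightarrow> smooth_on S g \<Longrightarrow> smooth_on S (\<lambda>x. f x - g x)"
  using smooth_on_add[of S f "\<lambda>x. - g x"] smooth_on_linear_compose[OF bounded_linear_minus[OF bounded_linear_ident], of S g]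
  by simp

lemma smooth_on_sum:
  "open S \<Longrightarrow> (\<And>i. i \<in> I \<Longrightarrow> smooth_on S (f i)) \<Longrightarrow> smooth_on S (\<lambda>x. \<Sum>i\<in>I. f i x)"
  by (simp add: smooth_on_def Ck_on_sum)

lemma smooth_on_prod:
  fixes f :: "'i \<Rightarrow> 'a::real_normed_vector \<Rightarrow> real"
  assumes "open S" "\<And>i. i \<in> I \<Longrightarrow> smooth_on S (f i)"
  shows "smooth_on S (\<lambda>x. \<Prod>i\<in>I. f i x)"
proof (cases "finite I")
  case True
  then show ?thesis using assms(2)
  proof (induction I)
    case empty
    show ?case by (simp add: smooth_on_const)
  next
    case (insert i I)
    have "smooth_on S (\<lambda>x. f i x * (\<Prod>i\<in>I. f i x))"
      by (rule smooth_on_mult[OF assms(1)]) (use insert in blast)+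
    then show ?case using insert by simp
  qed
qed (simp add: smooth_on_const)

lemma smooth_on_compose:
  fixes f :: "'a::real_normed_vector \<Rightarrow> 'b::euclidean_space"
  shows "open S \<Longrightarrow> smooth_on S f \<Longrightarrow> smooth_on T g \<Longrightarrow> f ` S \<subseteq> T \<Longrightarrow> smooth_on S (\<lambda>x. g (f x))"
  unfolding smooth_on_def using Ck_on_compose by blast

lemma smooth_on_differentiable: "smooth_on S f \<Longrightarrow> x \<in> S \<Longrightarrow> f differentiable (at x)"
  unfolding smooth_on_def using Ck_on.simps(2)[of 0] by blast

lemma smooth_on_FD: "smooth_on S f \<Longrightarrow> smooth_on S (\<lambda>x. FD f x v)"
  unfolding smooth_on_def using Ck_on.simps(2) by blast

lemma smooth_on_continuous: "smooth_on S f \<Longrightarrow> continuous_on S f"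
  unfolding smooth_on_def using Ck_on.simps(1) by blast

lemma smooth_on_Pair:
  assumes "open S" "smooth_on S f" "smooth_on S g"
  shows "smooth_on S (\<lambda>x. (f x, g x))"
proof -
  have "smooth_on S (\<lambda>x. (f x, 0) + (0, g x))"
    by (intro smooth_on_add smooth_on_linear_compose[of "\<lambda>x. (x, 0)"]
        smooth_on_linear_compose[of "\<lambda>x. (0, x)"] assms
        bounded_linear_Pair bounded_linear_ident bounded_linear_zero)
  then show ?thesis by simp
qed

lemma smooth_on_fst: "open S \<Longrightarrow> smooth_on S f \<Longrightarrow> smooth_on S (\<lambda>x. fst (f x))"
  by (rule smooth_on_linear_compose[OF bounded_linear_fst])

lemma smooth_on_snd: "open S \<Longrightarrow> smooth_on S f \<Longrightarrow> smooth_on S (\<lambda>x. snd (f x))"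
  by (rule smooth_on_linear_compose[OF bounded_linear_snd])

text \<open>Serves for components of vector fields in another chart and for the coordinate changes
  of the tangent bundle, where point and direction vary together.\<close>

lemma smooth_on_FD_moving:
  fixes f :: "'b::euclidean_space \<Rightarrow> 'c::real_normed_vector"
  assumes "open S" "smooth_on T f" "smooth_on S g" "smooth_on S w" "g ` S \<subseteq> T"
  shows "smooth_on S (\<lambda>x. FD f (g x) (w x))"
proof (rule smooth_on_cong[OF assms(1)])
  show "smooth_on S (\<lambda>x. \<Sum>b\<in>Basis. (w x \<bullet> b) *\<^sub>R FD f (g x) b)"
    by (intro smooth_on_sum smooth_on_scaleR smooth_on_inner smooth_on_const assms
        smooth_on_compose[OF _ _ smooth_on_FD[OF assms(2)]])
  show "(\<Sum>b\<in>Basis. (w x \<bullet> b) *\<^sub>R FD f (g x) b) = FD f (g x) (w x)" if "x \<in> S" for x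
    using FD_linear_combination[of f "g x" "w x"] smooth_on_differentiable[OF assms(2)] assms(5) that
    by auto
qed

text \<open>A product rule for the pairing of a derivative with a vector: the first term moves the
  base point with the direction frozen at \<open>w x\<close>, the second moves the direction. The
  first term is the origin of every second derivative of a coordinate change below.\<close>

lemma has_derivative_FD_moving:
  fixes f :: "'b::euclidean_space \<Rightarrow> 'c::real_normed_vector"
  assumes "open T" "smooth_on T f" "g x \<in> T"
    and g: "(g has_derivative g') (at x)" and w: "(w has_derivative w') (at x)"
  shows "((\<lambda>x. FD f (g x) (w x)) has_derivative
          (\<lambda>v. FD (\<lambda>z. FD f z (w x)) (g x) (g' v) + FD f (g x) (w' v))) (at x)"
proof -
  have f: "f differentiable (at z)" if "z \<in> T" for z
    using smooth_on_differentiable[OF assms(2) that] .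
  have db: "(\<lambda>z. FD f z b) differentiable (at (g x))" for b
    using smooth_on_differentiable[OF smooth_on_FD[OF assms(2)] assms(3)] .
  define h where "h x = (\<Sum>b\<in>Basis. (w x \<bullet> b) *\<^sub>R FD f (g x) b)" for x
  have eq: "FD (\<lambda>z. FD f z (w x)) (g x) a = (\<Sum>b\<in>Basis. (w x \<bullet> b) *\<^sub>R FD (\<lambda>z. FD f z b) (g x) a)" for a
  proof -
    have "((\<lambda>z. \<Sum>b\<in>Basis. (w x \<bullet> b) *\<^sub>R FD f z b) has_derivative
        (\<lambda>a. \<Sum>b\<in>Basis. (w x \<bullet> b) *\<^sub>R FD (\<lambda>z. FD f z b) (g x) a)) (at (g x))"
      by (intro has_derivative_sum bounded_linear.has_derivative[OF bounded_linear_scaleR_right]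
          has_derivative_FD db)
    moreover have "FD (\<lambda>z. FD f z (w x)) (g x) = FD (\<lambda>z. \<Sum>b\<in>Basis. (w x \<bullet> b) *\<^sub>R FD f z b) (g x)"
      by (rule FD_cong_open[OF assms(1,3)]) (use FD_linear_combination f in blast)
    ultimately show ?thesis by (simp add: FD_eqI)
  qed
  have hd: "(h has_derivative (\<lambda>v. \<Sum>b\<in>Basis. (w x \<bullet> b) *\<^sub>R FD (\<lambda>z. FD f z b) (g x) (g' v)
              + (w' v \<bullet> b) *\<^sub>R FD f (g x) b)) (at x)"
    unfolding h_def
    by (intro has_derivative_sum bounded_bilinear.FDERIV[OF bounded_bilinear_scaleR]
        bounded_linear.has_derivative[OF bounded_linear_inner_left] w
        has_derivative_compose[OF g] has_derivative_FD db)
  \<comment> \<open>The basis expansion \<open>h\<close> is known to agree with the target only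
    where \<open>g\<close> takes values in \<open>T\<close>, so a neighbourhood with this property
    is needed.\<close>
  have "isCont g x" using g has_derivative_continuous by blast
  then obtain U where U: "open U" "x \<in> U" "\<And>y. y \<in> U \<Longrightarrow> g y \<in> T"
    using assms(1,3) continuous_at_open by metis
  have "((\<lambda>x. FD f (g x) (w x)) has_derivative (\<lambda>v. \<Sum>b\<in>Basis. (w x \<bullet> b) *\<^sub>R FD (\<lambda>z. FD f z b) (g x) (g' v)
              + (w' v \<bullet> b) *\<^sub>R FD f (g x) b)) (at x)"
    by (rule has_derivative_transform_within_open[OF hd U(1,2)])
       (simp add: h_def FD_linear_combination[OF f[OF U(3)], symmetric])
  moreover have "FD f (g x) (w' v) = (\<Sum>b\<in>Basis. (w' v \<bullet> b) *\<^sub>R FD f (g x) b)" for v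
    using FD_linear_combination[OF f[OF assms(3)]] .
  ultimately show ?thesis by (simp add: eq sum.distrib)
qed

section \<open>Symmetry of second derivatives\<close>

lemma has_real_derivative_line:
  fixes f :: "'a::real_normed_vector \<Rightarrow> real"
  assumes "f differentiable (at (a + s *\<^sub>R v))"
  shows "((\<lambda>t. f (a + t *\<^sub>R v)) has_real_derivative FD f (a + s *\<^sub>R v) v) (at s)"
proof -
  have "((\<lambda>t. a + t *\<^sub>R v) has_derivative (\<lambda>t. t *\<^sub>R v)) (at s)"
    by (auto intro!: derivative_eq_intros)
  from has_derivative_compose[OF this has_derivative_FD[OF assms]]
  show ?thesis
    unfolding has_field_derivative_def
    by (rule has_derivative_eq_rhs) (simp add: fun_eq_iff linear_scale[OF linear_frechet_derivative[OF assms]])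
qed

text \<open>The left side is the second difference over a parallelogram. It is symmetric in
  \<open>v\<close> and \<open>w\<close>, while two uses of the mean value theorem express it by a
  mixed derivative in one chosen order.\<close>

lemma FD_FD_mean_value:
  fixes f :: "'a::real_normed_vector \<Rightarrow> real"
  assumes d: "\<And>s t. 0 \<le> s \<Longrightarrow> s \<le> h \<Longrightarrow> 0 \<le> t \<Longrightarrow> t \<le> h \<Longrightarrow> x + s *\<^sub>R v + t *\<^sub>R w \<in> S"
    and f: "\<And>y. y \<in> S \<Longrightarrow> f differentiable (at y)"
    and fv: "\<And>y. y \<in> S \<Longrightarrow> (\<lambda>y. FD f y v) differentiable (at y)"
    and h: "0 < h"
  shows "\<exists>s t. 0 \<le> s \<and> s \<le> h \<and> 0 \<le> t \<and> t \<le> h \<and>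
    f (x + h *\<^sub>R v + h *\<^sub>R w) - f (x + h *\<^sub>R v) - f (x + h *\<^sub>R w) + f x
      = h * h * FD (\<lambda>y. FD f y v) (x + s *\<^sub>R v + t *\<^sub>R w) w"
proof -
  \<comment> \<open>The mean value theorem is applied to the function of \<open>s\<close> given by
    \<open>f (x + h w + s v) - f (x + s v)\<close>; the next use is along \<open>w\<close>.\<close>
  have "\<exists>s>0. s < h \<and> (f ((x + h *\<^sub>R w) + h *\<^sub>R v) - f (x + h *\<^sub>R v)) - (f ((x + h *\<^sub>R w) + 0 *\<^sub>R v) - f (x + 0 *\<^sub>R v))
     = (h - 0) * (FD f ((x + h *\<^sub>R w) + s *\<^sub>R v) v - FD f (x + s *\<^sub>R v) v)"
    by (rule MVT2[OF h]) 
       (intro DERIV_diff has_real_derivative_line f; use d[of _ h] d[of _ 0] h in \<open>force simp: algebra_simps\<close>)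
  then obtain s where s: "0 < s" "s < h" "f (x + h *\<^sub>R v + h *\<^sub>R w) - f (x + h *\<^sub>R v) - f (x + h *\<^sub>R w) + f x
     = h * (FD f (x + s *\<^sub>R v + h *\<^sub>R w) v - FD f (x + s *\<^sub>R v) v)"
    by (auto simp: algebra_simps)
  have "\<exists>t>0. t < h \<and> FD f ((x + s *\<^sub>R v) + h *\<^sub>R w) v - FD f ((x + s *\<^sub>R v) + 0 *\<^sub>R w) v
     = (h - 0) * FD (\<lambda>y. FD f y v) ((x + s *\<^sub>R v) + t *\<^sub>R w) w"
    by (rule MVT2[OF h]) (intro has_real_derivative_line fv; use d s in force)
  then obtain t where t: "0 < t" "t < h" "FD f (x + s *\<^sub>R v + h *\<^sub>R w) v - FD f (x + s *\<^sub>R v) v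
     = h * FD (\<lambda>y. FD f y v) (x + s *\<^sub>R v + t *\<^sub>R w) w" by auto
  show ?thesis
    using s t by (intro exI[of _ s] exI[of _ t]) auto
qed

text \<open>The second difference equals \<open>h * h\<close> times either mixed derivative, each
  taken at some point of a small parallelogram. Cancelling \<open>h * h\<close> and using continuity
  of both mixed derivatives at \<open>x\<close> brings their values at \<open>x\<close> within any
  \<open>e\<close>.\<close>

lemma FD_FD_commute_real:
  fixes f :: "'a::real_normed_vector \<Rightarrow> real"
  assumes S: "open S" "x \<in> S" and f: "Ck_on 2 S f"
  shows "FD (\<lambda>y. FD f y v) x w = FD (\<lambda>y. FD f y w) x v"
proof -
  have f1: "f differentiable (at y)" if "y \<in> S" for y using f that by (simp add: numeral_2_eq_2)
  have f2: "(\<lambda>y. FD f y a) differentiable (at y)" if "y \<in> S" for y a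
    using f that by (simp add: numeral_2_eq_2)
  have f3: "isCont (\<lambda>y. FD (\<lambda>y. FD f y a) y b) x" for a b
    using f S by (simp add: numeral_2_eq_2 continuous_on_eq_continuous_at)
  have "\<bar>FD (\<lambda>y. FD f y v) x w - FD (\<lambda>y. FD f y w) x v\<bar> \<le> e" if e: "e > 0" for e
  proof -
    obtain d1 where d1: "d1 > 0" "\<And>y. dist y x < d1 \<Longrightarrow> dist (FD (\<lambda>y. FD f y v) y w) (FD (\<lambda>y. FD f y v) x w) < e/2"
      using f3[of v w] e unfolding continuous_at_eps_delta by (metis half_gt_zero)
    obtain d2 where d2: "d2 > 0" "\<And>y. dist y x < d2 \<Longrightarrow> dist (FD (\<lambda>y. FD f y w) y v) (FD (\<lambda>y. FD f y w) x v) < e/2"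
      using f3[of w v] e unfolding continuous_at_eps_delta by (metis half_gt_zero)
    obtain d3 where d3: "d3 > 0" "ball x d3 \<subseteq> S" using S openE by blast
    define d where "d = min d1 (min d2 d3)"
    have d: "d > 0" using d1 d2 d3 by (simp add: d_def)
    \<comment> \<open>Chosen so that the parallelogram with sides \<open>h v\<close> and
      \<open>h w\<close> stays within distance \<open>d\<close> of \<open>x\<close>; the summand
      \<open>1\<close> keeps the denominator positive when both directions vanish.\<close>
    define h where "h = d / (2 * (norm v + norm w + 1))"
    have nn: "norm v + norm w + 1 > 0" by (smt (verit) norm_ge_zero)
    have h: "h > 0" using d nn by (simp add: h_def)
    have hd: "h * (norm v + norm w) < d"
    proof -
      have "h * (norm v + norm w) < h * (2 * (norm v + norm w + 1))"
        using h by (simp add: mult_less_cancel_left_pos) (smt (verit) norm_ge_zero)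
      also have "\<dots> = d" using nn by (simp add: h_def)
      finally show ?thesis .
    qed
    have near: "dist (x + s *\<^sub>R a + t *\<^sub>R b) x < d"
      if "0 \<le> s" "s \<le> h" "0 \<le> t" "t \<le> h" "a = v \<and> b = w \<or> a = w \<and> b = v" for s t a b
    proof -
      have "dist (x + s *\<^sub>R a + t *\<^sub>R b) x = norm (s *\<^sub>R a + t *\<^sub>R b)" by (simp add: dist_norm algebra_simps)
      also have "\<dots> \<le> s * norm a + t * norm b"
        using that by (smt (verit) norm_triangle_ineq norm_scaleR)
      also have "\<dots> \<le> h * norm a + h * norm b"
        using that by (intro add_mono mult_right_mono) auto
      finally show ?thesis using hd that(5) by (auto simp: algebra_simps)
    qed
    have inS: "y \<in> S" if "dist y x < d" for y
      using that d3 by (auto simp: d_def dist_commute subset_eq)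
    obtain s t where st: "0 \<le> s" "s \<le> h" "0 \<le> t" "t \<le> h"
      "f (x + h *\<^sub>R v + h *\<^sub>R w) - f (x + h *\<^sub>R v) - f (x + h *\<^sub>R w) + f x
      = h * h * FD (\<lambda>y. FD f y v) (x + s *\<^sub>R v + t *\<^sub>R w) w"
      using FD_FD_mean_value[of h x v w S f] near inS f1 f2 h by blast
    obtain s' t' where st': "0 \<le> s'" "s' \<le> h" "0 \<le> t'" "t' \<le> h"
      "f (x + h *\<^sub>R w + h *\<^sub>R v) - f (x + h *\<^sub>R w) - f (x + h *\<^sub>R v) + f x
      = h * h * FD (\<lambda>y. FD f y w) (x + s' *\<^sub>R w + t' *\<^sub>R v) v"
      using FD_FD_mean_value[of h x w v S f] near inS f1 f2 h by blast
    have "h * h * FD (\<lambda>y. FD f y v) (x + s *\<^sub>R v + t *\<^sub>R w) w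
        = h * h * FD (\<lambda>y. FD f y w) (x + s' *\<^sub>R w + t' *\<^sub>R v) v"
      using st(5) st'(5) by (simp add: algebra_simps)
    then have eq: "FD (\<lambda>y. FD f y v) (x + s *\<^sub>R v + t *\<^sub>R w) w
        = FD (\<lambda>y. FD f y w) (x + s' *\<^sub>R w + t' *\<^sub>R v) v" using h by simp
    have "\<bar>FD (\<lambda>y. FD f y v) (x + s *\<^sub>R v + t *\<^sub>R w) w - FD (\<lambda>y. FD f y v) x w\<bar> < e/2"
      using d1(2) near[OF st(1-4)] by (simp add: d_def dist_real_def)
    moreover have "\<bar>FD (\<lambda>y. FD f y w) (x + s' *\<^sub>R w + t' *\<^sub>R v) v - FD (\<lambda>y. FD f y w) x v\<bar> < e/2"
      using d2(2) near[OF st'(1-4)] by (simp add: d_def dist_real_def)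
    ultimately show ?thesis unfolding eq by linarith
  qed
  then show ?thesis by (metis abs_le_zero_iff eq_iff_diff_eq_0 dense_ge)
qed

lemma FD_inner_left:
  assumes "f differentiable (at x)"
  shows "FD (\<lambda>y. f y \<bullet> b) x v = FD f x v \<bullet> b"
  by (simp add: FD_eqI[OF bounded_linear.has_derivative[OF bounded_linear_inner_left has_derivative_FD[OF assms]]])

lemma FD_FD_commute:
  fixes f :: "'a::real_normed_vector \<Rightarrow> 'b::euclidean_space"
  assumes S: "open S" "x \<in> S" and f: "smooth_on S f"
  shows "FD (\<lambda>y. FD f y v) x w = FD (\<lambda>y. FD f y w) x v"
proof (rule euclidean_eqI)
  fix b :: 'b assume "b \<in> Basis"
  have "Ck_on 2 S (\<lambda>y. f y \<bullet> b)"
    using smooth_on_linear_compose[OF bounded_linear_inner_left S(1) f] by (auto simp: smooth_on_def)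
  note * = FD_FD_commute_real[OF S this]
  have "FD (\<lambda>y. FD (\<lambda>y. f y \<bullet> b) y a) x c = FD (\<lambda>y. FD f y a) x c \<bullet> b" for a c
  proof -
    have "FD (\<lambda>y. FD (\<lambda>y. f y \<bullet> b) y a) x = FD (\<lambda>y. FD f y a \<bullet> b) x"
      by (rule FD_cong_open[OF S]) (simp add: FD_inner_left smooth_on_differentiable[OF f])
    then show ?thesis
      by (simp add: FD_inner_left smooth_on_differentiable[OF smooth_on_FD[OF f] S(2)])
  qed
  then show "FD (\<lambda>y. FD f y v) x w \<bullet> b = FD (\<lambda>y. FD f y w) x v \<bullet> b" using * by metis
qed

section \<open>Bump functions\<close>

text \<open>The derivative is again built from \<open>inverse\<close> by products, so the induction
  hypothesis for \<open>inverse\<close> itself suffices.\<close>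

lemma Ck_on_inverse: "Ck_on k (- {0::real}) inverse"
proof (induction k)
  case 0
  show ?case by (simp add: continuous_on_inverse)
next
  case (Suc k)
  have *: "(inverse has_derivative (\<lambda>v. - (inverse x * v * inverse x))) (at x)" if "x \<noteq> 0" for x :: real
    using has_derivative_inverse'[OF that] .
  have "Ck_on k (- {0}) (\<lambda>x. FD inverse x v)" for v :: real
  proof (rule Ck_on_cong)
    show "Ck_on k (- {0}) (\<lambda>x::real. (- v) * (inverse x * inverse x))"
      by (intro Ck_on_linear_compose[OF bounded_linear_mult_right]
          Ck_on_bilinear[OF bounded_bilinear_mult] Suc.IH) auto
  qed (auto simp: FD_eqI[OF *])
  with * show ?case by (auto simp: differentiable_def)
qed

lemma smooth_on_divide:
  fixes f g :: "'a::real_normed_vector \<Rightarrow> real"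
  assumes "open S" "smooth_on S f" "smooth_on S g" "\<And>x. x \<in> S \<Longrightarrow> g x \<noteq> 0"
  shows "smooth_on S (\<lambda>x. f x / g x)"
proof -
  have "smooth_on (- {0::real}) inverse" by (simp add: smooth_on_def Ck_on_inverse)
  then have "smooth_on S (\<lambda>x. inverse (g x))"
    by (rule smooth_on_compose[OF assms(1,3)]) (use assms(4) in auto)
  from smooth_on_mult[OF assms(1,2) this] show ?thesis by (simp add: divide_inverse)
qed

text \<open>The classical flat function exp(-1/t) with a polynomial factor in 1/t. The factor is
  there because this family is closed under differentiation, which makes smoothness a plain
  induction.\<close>

definition exp_flat :: "real poly \<Rightarrow> real \<Rightarrow> real" where
  "exp_flat p t = (if t > 0 then poly p (inverse t) * exp (- inverse t) else 0)"

lemma tendsto_poly_exp_minus: "((\<lambda>x::real. poly p x * exp (- x)) \<longlongrightarrow> 0) at_top"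
proof -
  have "((\<lambda>x. \<Sum>i\<le>degree p. coeff p i * (x ^ i / exp x)) \<longlongrightarrow> (\<Sum>i\<le>degree p. coeff p i * 0)) at_top"
    by (intro tendsto_sum tendsto_mult tendsto_const tendsto_power_div_exp_0)
  moreover have "(\<lambda>x. \<Sum>i\<le>degree p. coeff p i * (x ^ i / exp x)) = (\<lambda>x. poly p x * exp (- x))"
    by (simp add: fun_eq_iff poly_altdef exp_minus divide_inverse sum_distrib_right mult.assoc)
  ultimately show ?thesis by simp
qed

text \<open>For positive \<open>t\<close> the chain rule contributes the factor 1/t^2, which is the
  polynomial \<open>[:0,0,1:]\<close> at 1/t, and the exponential contributes the undifferentiated
  \<open>p\<close>. The only delicate point is \<open>t = 0\<close>, where exponential decay beats
  every power.\<close>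

lemma exp_flat_derivative:
  "(exp_flat p has_real_derivative exp_flat ([:0,0,1:] * (p - pderiv p)) t) (at t)"
proof (cases "t = 0")
  case False
  show ?thesis
  proof (cases "t > 0")
    case True
    have "((\<lambda>t. poly p (inverse t) * exp (- inverse t)) has_real_derivative
        exp_flat ([:0,0,1:] * (p - pderiv p)) t) (at t)"
      using True by (auto intro!: derivative_eq_intros DERIV_chain2[OF poly_DERIV]
          simp: exp_flat_def algebra_simps power2_eq_square)
    then show ?thesis
      by (rule has_field_derivative_transform_within_open[of _ _ _ "{0<..}"])
        (use True in \<open>auto simp: exp_flat_def\<close>)
  next
    case ne: False
    have "((\<lambda>t. 0) has_real_derivative exp_flat ([:0,0,1:] * (p - pderiv p)) t) (at t)"
      using ne by (simp add: exp_flat_def)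
    then show ?thesis
      by (rule has_field_derivative_transform_within_open[of _ _ _ "{..<0}"])
        (use ne False in \<open>auto simp: exp_flat_def\<close>)
  qed
next
  case True
  have "((\<lambda>h. exp_flat p h / h) \<longlongrightarrow> 0) (at 0)"
  proof (rule filterlim_split_at)
    show "((\<lambda>h. exp_flat p h / h) \<longlongrightarrow> 0) (at_left 0)"
    proof (rule tendsto_eventually)
      show "\<forall>\<^sub>F h in at_left 0. exp_flat p h / h = 0"
        unfolding eventually_at_filter by (rule always_eventually) (auto simp: exp_flat_def)
    qed
    show "((\<lambda>h. exp_flat p h / h) \<longlongrightarrow> 0) (at_right 0)"
      unfolding filterlim_at_right_to_top
    proof (rule Lim_transform_eventually)
      \<comment> \<open>With \<open>h = 1/x\<close> the division by \<open>h\<close> in the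
        difference quotient becomes multiplication by \<open>x\<close>, hence the factor
        \<open>[:0,1:]\<close>.\<close>
      show "((\<lambda>x. poly ([:0,1:] * p) x * exp (- x)) \<longlongrightarrow> 0) at_top"
        by (rule tendsto_poly_exp_minus)
      show "\<forall>\<^sub>F x in at_top. poly ([:0, 1:] * p) x * exp (- x) = exp_flat p (inverse x) / inverse x"
        using eventually_gt_at_top[of "0::real"]
        by eventually_elim (simp add: exp_flat_def divide_inverse)
    qed
  qed
  then show ?thesis
    using True by (simp add: has_field_derivative_iff exp_flat_def)
qed

lemma smooth_on_exp_flat: "smooth_on UNIV (exp_flat p)"
proof -
  have d: "exp_flat p differentiable (at t)" for p t
    using exp_flat_derivative[of p t] unfolding has_field_derivative_def differentiable_def by blast
  have e: "FD (exp_flat p) t v = exp_flat ([:0,0,1:] * (p - pderiv p)) t * v" for p t v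
    by (simp only: FD_eqI[OF exp_flat_derivative[of p t, unfolded has_field_derivative_def]])
  have "Ck_on k UNIV (exp_flat p)" for k
  proof (induction k arbitrary: p)
    case 0
    show ?case
      by (simp add: continuous_at_imp_continuous_on differentiable_imp_continuous_within[OF d])
  next
    case (Suc k)
    show ?case
      unfolding Ck_on.simps e
      by (intro conjI ballI allI d Ck_on_linear_compose[OF bounded_linear_mult_left open_UNIV Suc.IH])
  qed
  then show ?thesis by (simp add: smooth_on_def)
qed

lemma smooth_bump:
  fixes z0 :: "'a::euclidean_space"
  assumes "e > 0"
  shows "\<exists>\<phi>. smooth_on UNIV (\<phi> :: 'a \<Rightarrow> real) \<and> (\<forall>z. dist z z0 \<ge> e \<longrightarrow> \<phi> z = 0)
    \<and> (\<forall>z. dist z z0 < e / 2 \<longrightarrow> \<phi> z = 1)"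
proof -
  define f where "f = exp_flat 1"
  define g where "g t = f t / (f t + f (1 - t))" for t
  \<comment> \<open>\<open>g\<close> is a smooth step, \<open>0\<close> for arguments at most
    \<open>0\<close> and \<open>1\<close> for arguments at least \<open>1\<close>. Its argument is
    affine in the squared distance, which unlike the distance is smooth at the centre; it equals
    \<open>1\<close> at distance \<open>e / 2\<close> and \<open>0\<close> at distance
    \<open>e\<close>.\<close>
  define \<phi> where "\<phi> z = g ((4 - 4 / e\<^sup>2 * ((z - z0) \<bullet> (z - z0))) / 3)" for z
  have f: "smooth_on UNIV f" "\<And>t. t > 0 \<Longrightarrow> f t > 0" "\<And>t. t \<le> 0 \<Longrightarrow> f t = 0" "\<And>t. f t \<ge> 0"
    by (auto simp: f_def smooth_on_exp_flat exp_flat_def)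
  have pos: "f t + f (1 - t) > 0" for t
    using f(2)[of t] f(2)[of "1 - t"] f(4)[of t] f(4)[of "1 - t"] by (cases "t > 0") auto
  have g: "smooth_on UNIV g"
    unfolding g_def
    by (intro smooth_on_divide smooth_on_add f(1) open_UNIV smooth_on_compose[OF open_UNIV _ f(1)]
        smooth_on_diff smooth_on_const smooth_on_id) (use pos in \<open>auto simp: less_le\<close>)
  have "smooth_on UNIV (\<lambda>z. (4 - 4 / e\<^sup>2 * ((z - z0) \<bullet> (z - z0))) / 3)"
    by (intro smooth_on_divide smooth_on_diff smooth_on_mult smooth_on_inner smooth_on_const smooth_on_id) auto
  then have \<phi>: "smooth_on UNIV \<phi>"
    unfolding \<phi>_def by (rule smooth_on_compose[OF open_UNIV _ g]) simp
  have "\<phi> z = 0" if "dist z z0 \<ge> e" for z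
  proof -
    have "e\<^sup>2 \<le> (dist z z0)\<^sup>2" using that assms by (simp add: power_mono)
    then have "e\<^sup>2 \<le> (z - z0) \<bullet> (z - z0)" by (simp add: dist_norm power2_norm_eq_inner)
    then have "(4 - 4 / e\<^sup>2 * ((z - z0) \<bullet> (z - z0))) / 3 \<le> 0" using assms by (simp add: field_simps)
    then show ?thesis by (simp add: \<phi>_def g_def f(3))
  qed
  moreover have "\<phi> z = 1" if "dist z z0 < e / 2" for z
  proof -
    have "(dist z z0)\<^sup>2 \<le> (e / 2)\<^sup>2" using that by (intro power_mono) auto
    then have "(z - z0) \<bullet> (z - z0) \<le> e\<^sup>2 / 4" by (simp add: dist_norm power2_norm_eq_inner power_divide)
    then have *: "(4 - 4 / e\<^sup>2 * ((z - z0) \<bullet> (z - z0))) / 3 \<ge> 1" using assms by (simp add: field_simps)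
    then have "f ((4 - 4 / e\<^sup>2 * ((z - z0) \<bullet> (z - z0))) / 3) > 0" by (intro f(2)) linarith
    with * show ?thesis by (simp add: \<phi>_def g_def f(3))
  qed
  ultimately show ?thesis using \<phi> by blast
qed

section \<open>Fields and connections on manifolds\<close>

abbreviation chart_trans :: "('p, 'e) chart \<Rightarrow> ('p, 'e) chart \<Rightarrow> 'e \<Rightarrow> 'e" where
  "chart_trans c d \<equiv> snd d \<circ> chart_inv c"

abbreviation chart_overlap :: "('p, 'e) chart \<Rightarrow> ('p, 'e) chart \<Rightarrow> 'e set" where
  "chart_overlap c d \<equiv> snd c ` (fst c \<inter> fst d)"

text \<open>Kept apart from the Hausdorff condition so that it can be instantiated with the slit
  atlas first; the Hausdorff property of the slit bundle is then proved with the topology lemmas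
  obtained here.\<close>

locale smooth_atlas =
  fixes A :: "('p, 'e::euclidean_space) chart set"
  assumes chart_inj: "c \<in> A \<Longrightarrow> inj_on (snd c) (fst c)"
    and open_chart_image: "c \<in> A \<Longrightarrow> open (snd c ` fst c)"
    and open_overlap: "c \<in> A \<Longrightarrow> d \<in> A \<Longrightarrow> open (chart_overlap c d)"
    and smooth_trans: "c \<in> A \<Longrightarrow> d \<in> A \<Longrightarrow> smooth_on (chart_overlap c d) (chart_trans c d)"
begin

lemma chart_inv_chart [simp]: "c \<in> A \<Longrightarrow> p \<in> fst c \<Longrightarrow> chart_inv c (snd c p) = p"
  by (simp add: chart_inv_def chart_inj)

lemma chart_chart_inv [simp]: "c \<in> A \<Longrightarrow> z \<in> snd c ` fst c \<Longrightarrow> snd c (chart_inv c z) = z"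
  by (simp add: chart_inv_def f_inv_into_f)

lemma chart_inv_mem: "c \<in> A \<Longrightarrow> z \<in> snd c ` fst c \<Longrightarrow> chart_inv c z \<in> fst c"
  by (simp add: chart_inv_def inv_into_into)

lemma chart_image_Int:
  "c \<in> A \<Longrightarrow> snd c ` (fst c \<inter> U \<inter> V) = snd c ` (fst c \<inter> U) \<inter> snd c ` (fst c \<inter> V)"
  using chart_inj[of c] by (auto simp: inj_on_def)

lemma trans_differentiable:
  "c \<in> A \<Longrightarrow> d \<in> A \<Longrightarrow> p \<in> fst c \<Longrightarrow> p \<in> fst d \<Longrightarrow> chart_trans c d differentiable (at (snd c p))"
  by (rule smooth_on_differentiable[OF smooth_trans]) auto

lemma trans_has_derivative:
  "c \<in> A \<Longrightarrow> d \<in> A \<Longrightarrow> p \<in> fst c \<Longrightarrow> p \<in> fst d \<Longrightarrow>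
    (chart_trans c d has_derivative FD (chart_trans c d) (snd c p)) (at (snd c p))"
  by (rule has_derivative_FD[OF trans_differentiable])

lemma linear_FD_trans:
  "c \<in> A \<Longrightarrow> d \<in> A \<Longrightarrow> p \<in> fst c \<Longrightarrow> p \<in> fst d \<Longrightarrow> linear (FD (chart_trans c d) (snd c p))"
  by (rule linear_frechet_derivative[OF trans_differentiable])

lemma FD_trans_self: "c \<in> A \<Longrightarrow> p \<in> fst c \<Longrightarrow> FD (chart_trans c c) (snd c p) v = v"
  using FD_cong_open[OF open_chart_image, of c "snd c p" "chart_trans c c" "\<lambda>x. x"] by auto

lemma FD_trans_trans:
  assumes "c \<in> A" "d \<in> A" "e \<in> A" "p \<in> fst c" "p \<in> fst d" "p \<in> fst e"
  shows "FD (chart_trans d e) (snd d p) (FD (chart_trans c d) (snd c p) v) = FD (chart_trans c e) (snd c p) v"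
proof -
  have eq: "chart_trans c d (snd c p) = snd d p" using assms by simp
  have "((\<lambda>z. chart_trans d e (chart_trans c d z)) has_derivative
      (\<lambda>v. FD (chart_trans d e) (snd d p) (FD (chart_trans c d) (snd c p) v))) (at (snd c p))"
    using has_derivative_compose[OF trans_has_derivative[of c d p]
        trans_has_derivative[of d e p, folded eq]] assms by simp
  moreover have "FD (\<lambda>z. chart_trans d e (chart_trans c d z)) (snd c p) = FD (chart_trans c e) (snd c p)"
  proof (rule FD_cong_open)
    show "open (chart_overlap c d \<inter> chart_overlap c e)" using assms by (intro open_Int open_overlap)
    show "snd c p \<in> chart_overlap c d \<inter> chart_overlap c e" using assms by auto
    fix z assume "z \<in> chart_overlap c d \<inter> chart_overlap c e"
    then obtain q where "q \<in> fst c" "q \<in> fst d" "z = snd c q" by auto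
    then show "chart_trans d e (chart_trans c d z) = chart_trans c e z" using assms by simp
  qed
  ultimately show ?thesis by (simp add: FD_eqI fun_eq_iff)
qed

lemma FD_trans_inverse:
  "c \<in> A \<Longrightarrow> d \<in> A \<Longrightarrow> p \<in> fst c \<Longrightarrow> p \<in> fst d \<Longrightarrow>
    FD (chart_trans d c) (snd d p) (FD (chart_trans c d) (snd c p) v) = v"
  by (simp add: FD_trans_trans FD_trans_self)

text \<open>The abstraction \<open>topology\<close> returns the given family only if this is closed
  under binary intersections and unions; for intersections this rests on the injectivity of the
  charts.\<close>

lemma openin_atlas_topology:
  "openin (atlas_topology A) W \<longleftrightarrow> W \<subseteq> carrier_of A \<and> (\<forall>c\<in>A. open (snd c ` (fst c \<inter> W)))"
proof -
  have "istopology (\<lambda>W. W \<subseteq> carrier_of A \<and> (\<forall>c\<in>A. open (snd c ` (W \<inter> fst c))))"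
    unfolding istopology_def
  proof (rule conjI; (rule allI | rule impI)+)
    fix S T assume S: "S \<subseteq> carrier_of A \<and> (\<forall>c\<in>A. open (snd c ` (S \<inter> fst c)))"
      and T: "T \<subseteq> carrier_of A \<and> (\<forall>c\<in>A. open (snd c ` (T \<inter> fst c)))"
    have "open (snd c ` (S \<inter> T \<inter> fst c))" if "c \<in> A" for c
    proof -
      have "snd c ` (S \<inter> T \<inter> fst c) = snd c ` (S \<inter> fst c) \<inter> snd c ` (T \<inter> fst c)"
        using chart_image_Int[OF that, of S T] by (simp add: Int_ac)
      then show ?thesis using S T that by auto
    qed
    with S show "S \<inter> T \<subseteq> carrier_of A \<and> (\<forall>c\<in>A. open (snd c ` (S \<inter> T \<inter> fst c)))" by blast
  next
    fix K assume K: "\<forall>W\<in>K. W \<subseteq> carrier_of A \<and> (\<forall>c\<in>A. open (snd c ` (W \<inter> fst c)))"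
    have "open (snd c ` (\<Union> K \<inter> fst c))" if "c \<in> A" for c
    proof -
      have "snd c ` (\<Union> K \<inter> fst c) = (\<Union>W\<in>K. snd c ` (W \<inter> fst c))" by auto
      moreover have "open \<dots>" by (intro open_UN ballI) (use K that in blast)
      ultimately show ?thesis by simp
    qed
    then show "\<Union> K \<subseteq> carrier_of A \<and> (\<forall>c\<in>A. open (snd c ` (\<Union> K \<inter> fst c)))"
      using K by blast
  qed
  then show ?thesis
    unfolding atlas_topology_def by (simp add: topology_inverse' Int_commute)
qed

lemma openin_chart_domain: "c \<in> A \<Longrightarrow> openin (atlas_topology A) (fst c)"
  by (auto simp: openin_atlas_topology carrier_of_def Int_commute intro!: open_overlap)

lemma topspace_atlas_topology: "topspace (atlas_topology A) = carrier_of A"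
proof -
  have "openin (atlas_topology A) (carrier_of A)"
  proof -
    have "snd c ` (fst c \<inter> carrier_of A) = snd c ` fst c" if "c \<in> A" for c
      using that by (auto simp: carrier_of_def)
    then show ?thesis by (simp add: openin_atlas_topology open_chart_image)
  qed
  then show ?thesis using openin_subset openin_topspace openin_atlas_topology by blast
qed

lemma vimage_trans_overlap:
  assumes "c \<in> A" "d \<in> A" "U \<subseteq> snd c ` fst c"
  shows "snd d ` (fst d \<inter> chart_inv c ` U) = chart_trans d c -` U \<inter> chart_overlap d c"
proof (intro set_eqI iffI)
  fix x assume "x \<in> snd d ` (fst d \<inter> chart_inv c ` U)"
  then obtain u where u: "u \<in> U" "chart_inv c u \<in> fst d" "x = snd d (chart_inv c u)" by blast
  then have "u \<in> snd c ` fst c" using assms(3) by blast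
  then show "x \<in> chart_trans d c -` U \<inter> chart_overlap d c"
    using u chart_inv_mem[OF assms(1), of u] assms(1,2) by simp
next
  fix x assume x: "x \<in> chart_trans d c -` U \<inter> chart_overlap d c"
  then obtain q where q: "q \<in> fst c" "q \<in> fst d" "x = snd d q" by blast
  then have "snd c q \<in> U" "q = chart_inv c (snd c q)" using x assms(1,2) by simp_all
  then show "x \<in> snd d ` (fst d \<inter> chart_inv c ` U)" using q by blast
qed

text \<open>Seen in a chart \<open>d\<close>, the image is the preimage of \<open>U\<close> under
  the transition map from \<open>d\<close> to \<open>c\<close>, which is continuous on an open
  set.\<close>

lemma openin_chart_inv_image:
  assumes "c \<in> A" "open U" "U \<subseteq> snd c ` fst c"
  shows "openin (atlas_topology A) (chart_inv c ` U)"
  unfolding openin_atlas_topology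
proof (intro conjI ballI)
  show "chart_inv c ` U \<subseteq> carrier_of A"
    using assms(1,3) chart_inv_mem[OF assms(1)] unfolding carrier_of_def by blast
  fix d assume d: "d \<in> A"
  have "open (chart_trans d c -` U \<inter> chart_overlap d c)"
    using continuous_on_open_vimage[OF open_overlap[OF d assms(1)]]
      smooth_on_continuous[OF smooth_trans[OF d assms(1)]] assms(2) by blast
  then show "open (snd d ` (fst d \<inter> chart_inv c ` U))"
    using vimage_trans_overlap[OF assms(1) d assms(3)] by simp
qed

lemma continuous_map_chart_inv:
  assumes "c \<in> A"
  shows "continuous_map (top_of_set (snd c ` fst c)) (atlas_topology A) (chart_inv c)"
  unfolding continuous_map
proof (intro conjI allI impI)
  show "chart_inv c ` topspace (top_of_set (snd c ` fst c)) \<subseteq> topspace (atlas_topology A)"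
    using assms chart_inv_mem by (auto simp: topspace_atlas_topology carrier_of_def)
  fix W assume W: "openin (atlas_topology A) W"
  have "{z \<in> topspace (top_of_set (snd c ` fst c)). chart_inv c z \<in> W} = snd c ` (fst c \<inter> W)"
    using assms by auto
  moreover have "open (snd c ` (fst c \<inter> W))" using W assms by (simp add: openin_atlas_topology)
  ultimately show "openin (top_of_set (snd c ` fst c)) {z \<in> topspace (top_of_set (snd c ` fst c)). chart_inv c z \<in> W}"
    by (metis (no_types, lifting) Int_lower1 image_mono open_openin_trans open_chart_image[OF assms])
qed

text \<open>Extension by zero. The domain of \<open>c\<close> and the complement of \<open>C\<close>
  are open and together cover the manifold; \<open>h\<close> is smooth over the first and zero over
  the second. It is essential that \<open>C\<close> be closed in the whole manifold, not merely in
  the domain of \<open>c\<close>.\<close>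

lemma smooth_on_by_cover:
  assumes A: "c \<in> A" "d \<in> A" and C: "openin (atlas_topology A) (carrier_of A - C)" "C \<subseteq> fst c"
    and h: "smooth_on (chart_overlap d c) h"
    and 0: "\<And>p. p \<in> fst d \<Longrightarrow> p \<notin> C \<Longrightarrow> h (snd d p) = 0"
  shows "smooth_on (snd d ` fst d) h"
proof (rule smooth_on_local)
  fix z assume "z \<in> snd d ` fst d"
  then obtain p where p: "p \<in> fst d" "z = snd d p" by auto
  show "\<exists>T. open T \<and> z \<in> T \<and> smooth_on T h"
  proof (cases "p \<in> C")
    case True
    then show ?thesis using p A C(2) h by (intro exI[of _ "chart_overlap d c"]) (auto simp: open_overlap)
  next
    case False
    let ?T = "snd d ` (fst d \<inter> (carrier_of A - C))"
    have o: "open ?T" using C A by (simp add: openin_atlas_topology)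
    have "0 = h w" if "w \<in> ?T" for w using that 0 by auto
    from smooth_on_cong[OF o smooth_on_const this] have "smooth_on ?T h" .
    moreover have "p \<in> fst d \<inter> (carrier_of A - C)" using p(1) False A(2) unfolding carrier_of_def by blast
    then have "z \<in> ?T" unfolding p(2) by (rule imageI)
    ultimately show ?thesis using o by blast
  qed
qed

lemma smooth_fun_overlap:
  "smooth_fun A f \<Longrightarrow> d \<in> A \<Longrightarrow> smooth_on (chart_overlap d c) (\<lambda>z. f (chart_inv d z))"
  unfolding smooth_fun_def comp_def by (rule smooth_on_subset) auto

section \<open>Tangent vectors, smooth sections and the Lie bracket\<close>

lemma tangent_spaceD:
  "v \<in> tangent_space A p \<Longrightarrow> c \<in> A \<Longrightarrow> d \<in> A \<Longrightarrow> p \<in> fst c \<Longrightarrow> p \<in> fst d \<Longrightarrow>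
    v d = FD (chart_trans c d) (snd c p) (v c)"
  unfolding tangent_space_def mem_Collect_eq by blast

lemma tangent_space_eq_0: "v \<in> tangent_space A p \<Longrightarrow> \<not> (c \<in> A \<and> p \<in> fst c) \<Longrightarrow> v c = 0"
  unfolding tangent_space_def mem_Collect_eq by blast

lemma tangent_space_eqI:
  assumes "v \<in> tangent_space A p" "w \<in> tangent_space A p" "c \<in> A" "p \<in> fst c" "v c = w c"
  shows "v = w"
proof
  fix d
  show "v d = w d"
  proof (cases "d \<in> A \<and> p \<in> fst d")
    case True
    then have "v d = FD (chart_trans c d) (snd c p) (v c)" "w d = FD (chart_trans c d) (snd c p) (w c)"
      using tangent_spaceD[OF assms(1,3)] tangent_spaceD[OF assms(2,3)] assms(4) by blast+
    then show ?thesis using assms(5) by simp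
  next
    case False
    then show ?thesis by (simp add: tangent_space_eq_0[OF assms(1)] tangent_space_eq_0[OF assms(2)])
  qed
qed

lemma tangent_space_linear:
  assumes "\<And>i. i \<in> I \<Longrightarrow> v i \<in> tangent_space A p"
  shows "(\<lambda>c. \<Sum>i\<in>I. r i *\<^sub>R v i c) \<in> tangent_space A p"
proof -
  have "(\<Sum>i\<in>I. r i *\<^sub>R v i d) = FD (chart_trans c d) (snd c p) (\<Sum>i\<in>I. r i *\<^sub>R v i c)"
    if "c \<in> A" "d \<in> A" "p \<in> fst c" "p \<in> fst d" for c d
  proof -
    have "(\<Sum>i\<in>I. r i *\<^sub>R v i d) = (\<Sum>i\<in>I. r i *\<^sub>R FD (chart_trans c d) (snd c p) (v i c))"
      using tangent_spaceD[OF assms that] by (intro sum.cong) auto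
    then show ?thesis
      by (simp add: linear_sum[OF linear_FD_trans[OF that]] linear_scale[OF linear_FD_trans[OF that]])
  qed
  moreover have "(\<Sum>i\<in>I. r i *\<^sub>R v i c) = 0" if "\<not> (c \<in> A \<and> p \<in> fst c)" for c
  proof (rule sum.neutral, rule ballI)
    fix i assume "i \<in> I"
    then have "v i c = 0" using assms that tangent_space_eq_0 by blast
    then show "r i *\<^sub>R v i c = 0" by simp
  qed
  ultimately show ?thesis unfolding tangent_space_def by blast
qed

lemma tv_zero_tangent: "tv_zero \<in> tangent_space A p"
  using tangent_space_linear[of "{}"] by (simp add: tv_zero_def)

lemma tv_scale_tangent: "v \<in> tangent_space A p \<Longrightarrow> tv_scale r v \<in> tangent_space A p"
  using tangent_space_linear[of "{()}" "\<lambda>_. v" p "\<lambda>_. r"] by (simp add: tv_scale_def)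

lemma tv_add_tangent:
  "v \<in> tangent_space A p \<Longrightarrow> w \<in> tangent_space A p \<Longrightarrow> tv_add v w \<in> tangent_space A p"
  using tangent_space_linear[of UNIV "\<lambda>b. if b then v else w" p "\<lambda>_. 1"]
  by (simp add: tv_add_def UNIV_bool add.commute)

lemma coord_field_tangent:
  assumes "c \<in> A" "p \<in> fst c"
  shows "coord_field A c e p \<in> tangent_space A p"
  using assms by (auto simp: tangent_space_def coord_field_def FD_trans_trans)

lemma coord_field_self: "c \<in> A \<Longrightarrow> p \<in> fst c \<Longrightarrow> coord_field A c e p c = e"
  by (simp add: coord_field_def FD_trans_self)

text \<open>The chart hidden in \<open>tv_apply\<close> is an arbitrary choice; the chain rule shows
  that the transformation of components compensates exactly for a change of chart.\<close>

lemma tv_apply_eq_coord_deriv: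
  assumes f: "smooth_fun A f" and v: "v \<in> tangent_space A p" and c: "c \<in> A" "p \<in> fst c"
  shows "tv_apply A p v f = coord_deriv c (v c) f p"
proof -
  define d where "d = (SOME c. c \<in> A \<and> p \<in> fst c)"
  have d: "d \<in> A" "p \<in> fst d"
    using someI[of "\<lambda>c. c \<in> A \<and> p \<in> fst c" c] c by (auto simp: d_def)
  have fd: "(f \<circ> chart_inv d) differentiable (at (chart_trans c d (snd c p)))"
    by (rule smooth_on_differentiable[of "snd d ` fst d"]) (use f d c in \<open>auto simp: smooth_fun_def\<close>)
  have "((\<lambda>z. (f \<circ> chart_inv d) (chart_trans c d z)) has_derivative
      (\<lambda>w. FD (f \<circ> chart_inv d) (snd d p) (FD (chart_trans c d) (snd c p) w))) (at (snd c p))"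
    using has_derivative_compose_FD[OF trans_differentiable[OF c(1) d(1) c(2) d(2)] fd] c by (simp add: comp_def)
  moreover have "FD (\<lambda>z. (f \<circ> chart_inv d) (chart_trans c d z)) (snd c p) = FD (f \<circ> chart_inv c) (snd c p)"
    by (rule FD_cong_open[OF open_overlap[OF c(1) d(1)]]) (use c d in auto)
  ultimately have "FD (f \<circ> chart_inv c) (snd c p) (v c) = FD (f \<circ> chart_inv d) (snd d p) (v d)"
    using tangent_spaceD[OF v c(1) d(1) c(2) d(2)] by (simp add: FD_eqI fun_eq_iff)
  then show ?thesis
    by (simp add: tv_apply_def coord_deriv_def d_def[symmetric])
qed

text \<open>A local field given in one chart has to be smooth in every overlapping chart before it
  can be cut off. Its components there are the derivative of the transition map applied to the old
  components.\<close>

lemma field_smooth_transfer: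
  assumes cd: "c \<in> A" "d \<in> A" and X: "\<And>p. p \<in> fst c \<Longrightarrow> X p \<in> tangent_space A p"
    and s: "smooth_on (snd c ` fst c) (\<lambda>z. X (chart_inv c z) c)"
  shows "smooth_on (chart_overlap d c) (\<lambda>z. X (chart_inv d z) d)"
proof (rule smooth_on_cong[OF open_overlap[OF cd(2,1)]])
  have im: "chart_trans d c ` chart_overlap d c \<subseteq> chart_overlap c d" using cd by auto
  show "smooth_on (chart_overlap d c)
      (\<lambda>z. FD (chart_trans c d) (chart_trans d c z) (X (chart_inv c (chart_trans d c z)) c))"
    by (intro smooth_on_FD_moving[OF _ smooth_trans[OF cd]] smooth_on_compose[OF _ _ s]
        open_overlap smooth_trans cd im) (use im in auto)
  fix z assume "z \<in> chart_overlap d c"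
  then obtain p where "p \<in> fst c" "p \<in> fst d" "z = snd d p" by auto
  then show "FD (chart_trans c d) (chart_trans d c z) (X (chart_inv c (chart_trans d c z)) c) = X (chart_inv d z) d"
    using tangent_spaceD[OF X, of p c d] cd by simp
qed

lemma vfieldsD:
  assumes "X \<in> gsections A E"
  shows "p \<in> carrier_of A \<Longrightarrow> X p \<in> tangent_space A p" "p \<in> carrier_of A \<Longrightarrow> X p \<in> E p"
    "p \<notin> carrier_of A \<Longrightarrow> X p = tv_zero"
    "c \<in> A \<Longrightarrow> smooth_on (snd c ` fst c) (\<lambda>z. X (chart_inv c z) c)"
  using assms by (auto simp: gsections_def)

lemma gsections_subset_vfields: "gsections A E \<subseteq> vfields A"
  by (auto simp: vfields_def gsections_def)

definition linear_distribution :: "('p \<Rightarrow> ('p, 'e) tvec set) \<Rightarrow> bool" where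
  "linear_distribution E \<longleftrightarrow> (\<forall>p\<in>carrier_of A. tv_zero \<in> E p \<and>
     (\<forall>v\<in>E p. \<forall>r. tv_scale r v \<in> E p) \<and> (\<forall>v\<in>E p. \<forall>w\<in>E p. tv_add v w \<in> E p))"

lemma linear_distribution_tangent_space: "linear_distribution (tangent_space A)"
  by (simp add: linear_distribution_def tv_zero_tangent tv_scale_tangent tv_add_tangent)

lemma vf_add_gsections:
  assumes "linear_distribution E" "X \<in> gsections A E" "Y \<in> gsections A E"
  shows "vf_add X Y \<in> gsections A E"
proof -
  note X = vfieldsD[OF assms(2)] and Y = vfieldsD[OF assms(3)]
  have "smooth_on (snd c ` fst c) (\<lambda>z. vf_add X Y (chart_inv c z) c)" if "c \<in> A" for c
    unfolding vf_add_def tv_add_def using that by (intro smooth_on_add open_chart_image X Y)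
  then show ?thesis
    using assms(1) X Y unfolding gsections_def linear_distribution_def
    by (auto simp: vf_add_def tv_add_tangent) (simp add: tv_add_def tv_zero_def)
qed

lemma vf_scale_gsections:
  assumes "linear_distribution E" "X \<in> gsections A E" "smooth_fun A f"
  shows "vf_scale f X \<in> gsections A E"
proof -
  note X = vfieldsD[OF assms(2)]
  have "smooth_on (snd c ` fst c) (\<lambda>z. vf_scale f X (chart_inv c z) c)" if "c \<in> A" for c
    unfolding vf_scale_def tv_scale_def using that assms(3)
    by (intro smooth_on_scaleR open_chart_image X) (auto simp: smooth_fun_def comp_def)
  then show ?thesis
    using assms(1) X unfolding gsections_def linear_distribution_def
    by (auto simp: vf_scale_def tv_scale_tangent) (simp add: tv_scale_def tv_zero_def)
qed

definition vf_lincomb :: "'i set \<Rightarrow> ('i \<Rightarrow> 'p \<Rightarrow> real) \<Rightarrow> ('i \<Rightarrow> ('p, 'e) vfield) \<Rightarrow> ('p, 'e) vfield" where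
  "vf_lincomb I f X = (\<lambda>p c. \<Sum>i\<in>I. f i p *\<^sub>R X i p c)"

text \<open>Writing the zero field as \<open>0\<close> times a section lets function linearity and
  the Leibniz rule determine a connection on it.\<close>

lemma vf_lincomb_empty: "vf_lincomb {} f X = vf_scale (\<lambda>_. 0) Y"
  by (simp add: vf_lincomb_def vf_scale_def tv_scale_def)

lemma vf_lincomb_insert:
  "finite I \<Longrightarrow> i \<notin> I \<Longrightarrow> vf_lincomb (insert i I) f X = vf_add (vf_scale (f i) (X i)) (vf_lincomb I f X)"
  by (simp add: vf_lincomb_def vf_scale_def tv_scale_def vf_add_def tv_add_def)

lemma smooth_fun_const: "smooth_fun A (\<lambda>_. r)"
  by (simp add: smooth_fun_def comp_def smooth_on_const)

lemma zero_gsection: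
  assumes "linear_distribution E"
  shows "(\<lambda>p. tv_zero) \<in> gsections A E"
  using assms by (auto simp: gsections_def linear_distribution_def tv_zero_tangent[unfolded tv_zero_def] tv_zero_def smooth_on_const)

lemma vf_lincomb_gsections:
  assumes "finite I" "linear_distribution E" "\<And>i. i \<in> I \<Longrightarrow> X i \<in> gsections A E"
    "\<And>i. i \<in> I \<Longrightarrow> smooth_fun A (f i)"
  shows "vf_lincomb I f X \<in> gsections A E"
  using assms(1,3,4)
proof (induction I)
  case empty
  show ?case using zero_gsection[OF assms(2)] by (simp add: vf_lincomb_def tv_zero_def)
next
  case (insert i I)
  then show ?case by (simp add: vf_lincomb_insert vf_add_gsections vf_scale_gsections assms(2))
qed

text \<open>Differentiating \<open>X d = D\<phi> (X c)\<close> produces the extra term \<open>D\<^sup>2\<phi> (X c) (Y c)\<close>, which is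
  symmetric and cancels in the bracket.\<close>

lemma lie_bracket_tangent:
  assumes "X \<in> vfields A" "Y \<in> vfields A"
  shows "lie_bracket A X Y p \<in> tangent_space A p"
proof -
  have der: "FD (\<lambda>z. Y (chart_inv d z) d) (snd d p) (X p d)
     = FD (\<lambda>z. FD (chart_trans c d) z (Y p c)) (snd c p) (X p c)
       + FD (chart_trans c d) (snd c p) (FD (\<lambda>z. Y (chart_inv c z) c) (snd c p) (X p c))"
    if X: "X \<in> vfields A" and Y: "Y \<in> vfields A" and c: "c \<in> A" "p \<in> fst c" and d: "d \<in> A" "p \<in> fst d"
    for X Y c d
  proof -
    have sm: "(\<lambda>z. Y (chart_inv b z) b) differentiable (at (snd b p))" if "b \<in> A" "p \<in> fst b" for b
      using vfieldsD(4)[OF Y[unfolded vfields_def] that(1)] smooth_on_differentiable that(2) by blast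
    have eq: "chart_trans c d (snd c p) = snd d p" using c by simp
    have p: "p \<in> carrier_of A" using c by (auto simp: carrier_of_def)
    have "((\<lambda>z. Y (chart_inv d (chart_trans c d z)) d) has_derivative
      (\<lambda>v. FD (\<lambda>z. Y (chart_inv d z) d) (snd d p) (FD (chart_trans c d) (snd c p) v))) (at (snd c p))"
      using has_derivative_compose[OF trans_has_derivative[OF c(1) d(1) c(2) d(2)]
          has_derivative_FD[OF sm[OF d], folded eq]] eq by simp
    moreover have "((\<lambda>z. FD (chart_trans c d) z (Y (chart_inv c z) c)) has_derivative
      (\<lambda>v. FD (\<lambda>z. FD (chart_trans c d) z (Y p c)) (snd c p) v
         + FD (chart_trans c d) (snd c p) (FD (\<lambda>z. Y (chart_inv c z) c) (snd c p) v))) (at (snd c p))"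
      using has_derivative_FD_moving[OF open_overlap[OF c(1) d(1)] smooth_trans[OF c(1) d(1)] _
          has_derivative_ident has_derivative_FD[OF sm[OF c]]] c d by simp
    moreover have "FD (\<lambda>z. Y (chart_inv d (chart_trans c d z)) d) (snd c p)
        = FD (\<lambda>z. FD (chart_trans c d) z (Y (chart_inv c z) c)) (snd c p)"
    proof (rule FD_cong_open[OF open_overlap[OF c(1) d(1)]])
      fix z assume "z \<in> chart_overlap c d"
      then obtain q where q: "q \<in> fst c" "q \<in> fst d" "z = snd c q" by auto
      have "Y q \<in> tangent_space A q"
        using Y q c by (auto simp: vfields_def gsections_def carrier_of_def)
      from tangent_spaceD[OF this c(1) d(1) q(1,2)]
      show "Y (chart_inv d (chart_trans c d z)) d = FD (chart_trans c d) z (Y (chart_inv c z) c)"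
        using q c d by simp
    qed (use c d in auto)
    moreover have "X p d = FD (chart_trans c d) (snd c p) (X p c)"
      using tangent_spaceD[OF _ c(1) d(1) c(2) d(2)] X p by (auto simp: vfields_def gsections_def)
    ultimately show ?thesis by (simp add: FD_eqI fun_eq_iff)
  qed
  show ?thesis
    unfolding tangent_space_def
  proof (intro CollectI conjI ballI impI allI)
    fix c d assume c: "c \<in> A" and d: "d \<in> A" and p: "p \<in> fst c \<inter> fst d"
    note l = linear_diff[OF linear_FD_trans[of c d p]]
    have "FD (\<lambda>z. FD (chart_trans c d) z (Y p c)) (snd c p) (X p c)
        = FD (\<lambda>z. FD (chart_trans c d) z (X p c)) (snd c p) (Y p c)"
      by (rule FD_FD_commute[OF open_overlap[OF c d] _ smooth_trans[OF c d]]) (use p in auto)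
    then show "lie_bracket A X Y p d = FD (chart_trans c d) (snd c p) (lie_bracket A X Y p c)"
      using der[OF assms c _ d] der[OF assms(2,1) c _ d] c d p l by (simp add: lie_bracket_def)
  next
    show "lie_bracket A X Y p c = 0" if "\<not> (c \<in> A \<and> p \<in> fst c)" for c
      using that by (auto simp: lie_bracket_def)
  qed
qed

end

section \<open>Bump functions and extension of local fields\<close>

locale hausdorff_atlas = smooth_atlas A for A :: "('p, 'e::euclidean_space) chart set" +
  assumes hausdorff: "Hausdorff_space (atlas_topology A)"
begin

text \<open>Compact sets are closed in a Hausdorff space. This makes a function supported in a
  coordinate ball extend smoothly by zero to the whole manifold.\<close>

lemma openin_carrier_minus_compact:
  assumes "c \<in> A" "compact K" "K \<subseteq> snd c ` fst c"
  shows "openin (atlas_topology A) (carrier_of A - chart_inv c ` K)"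
proof -
  have "compactin (top_of_set (snd c ` fst c)) K"
    using assms by (simp add: compactin_subtopology)
  then have "compactin (atlas_topology A) (chart_inv c ` K)"
    using image_compactin continuous_map_chart_inv[OF assms(1)] by blast
  then have "closedin (atlas_topology A) (chart_inv c ` K)"
    using hausdorff compactin_imp_closedin by blast
  then show ?thesis by (simp add: closedin_def topspace_atlas_topology)
qed

text \<open>A coordinate ball inside \<open>W\<close> yields all the sets: \<open>N\<close> is the
  concentric open ball of half the radius, \<open>C\<close> the compact closed ball.
  \<open>C\<close> is exported because later cutoffs need a closed set outside which \<beta>
  vanishes, to extend by zero again.\<close>

lemma bump_function:
  assumes c: "c \<in> A" and W: "openin (atlas_topology A) W" and p: "p \<in> W" "p \<in> fst c"
  obtains \<beta> N C where "smooth_fun A \<beta>" "openin (atlas_topology A) N" "p \<in> N" "N \<subseteq> W \<inter> fst c"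
    "\<And>q. q \<in> N \<Longrightarrow> \<beta> q = 1" "C \<subseteq> W \<inter> fst c" "openin (atlas_topology A) (carrier_of A - C)"
    "\<And>q. q \<notin> C \<Longrightarrow> \<beta> q = 0"
proof -
  define z0 where "z0 = snd c p"
  define U where "U = snd c ` (fst c \<inter> W)"
  have "open U" "z0 \<in> U" using W c p by (auto simp: U_def z0_def openin_atlas_topology)
  then obtain e where e: "e > 0" "cball z0 e \<subseteq> U" using open_contains_cball by blast
  obtain \<phi> :: "'e \<Rightarrow> real" where \<phi>: "smooth_on UNIV \<phi>" "\<And>z. dist z z0 \<ge> e \<Longrightarrow> \<phi> z = 0"
    "\<And>z. dist z z0 < e / 2 \<Longrightarrow> \<phi> z = 1"
    using smooth_bump[OF e(1), of z0] by blast
  define \<beta> where "\<beta> q = (if q \<in> fst c then \<phi> (snd c q) else 0)" for q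
  define C where "C = chart_inv c ` cball z0 e"
  define N where "N = chart_inv c ` ball z0 (e / 2)"
  have Uc: "U \<subseteq> snd c ` fst c" by (auto simp: U_def)
  have Ninv: "chart_inv c z \<in> W \<inter> fst c" "snd c (chart_inv c z) = z" if "z \<in> cball z0 e" for z
    using that e(2) c by (auto simp: U_def)
  have sub: "ball z0 (e / 2) \<subseteq> cball z0 e" using e(1) by (auto simp: dist_commute)
  have C1: "openin (atlas_topology A) (carrier_of A - C)"
    unfolding C_def by (rule openin_carrier_minus_compact) (use c e Uc in auto)
  have C2: "C \<subseteq> W \<inter> fst c" using Ninv by (auto simp: C_def)
  have C3: "\<beta> q = 0" if "q \<notin> C" for q
  proof (cases "q \<in> fst c \<and> dist (snd c q) z0 < e")
    case True
    then have "q = chart_inv c (snd c q)" "snd c q \<in> cball z0 e" using c by (auto simp: dist_commute)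
    then have "q \<in> C" unfolding C_def by blast
    with that show ?thesis by simp
  qed (use \<phi>(2) in \<open>auto simp: \<beta>_def\<close>)
  have N1: "openin (atlas_topology A) N"
    unfolding N_def by (rule openin_chart_inv_image) (use c e Uc sub in auto)
  have N2: "p \<in> N" using p c e(1) by (auto simp: N_def z0_def image_iff intro!: bexI[of _ "snd c p"])
  have N3: "N \<subseteq> W \<inter> fst c" using Ninv sub by (auto simp: N_def)
  have N4: "\<beta> q = 1" if "q \<in> N" for q
    using that Ninv sub \<phi>(3) by (auto simp: N_def \<beta>_def dist_commute subset_iff)
  have "smooth_fun A \<beta>"
    unfolding smooth_fun_def
  proof
    fix d assume d: "d \<in> A"
    show "smooth_on (snd d ` fst d) (\<beta> \<circ> chart_inv d)"
    proof (rule smooth_on_by_cover[OF c d C1])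
      show "C \<subseteq> fst c" using C2 by blast
      show "smooth_on (chart_overlap d c) (\<beta> \<circ> chart_inv d)"
      proof (rule smooth_on_cong[OF open_overlap[OF d c]])
        show "smooth_on (chart_overlap d c) (\<lambda>z. \<phi> (chart_trans d c z))"
          by (rule smooth_on_compose[OF open_overlap[OF d c] smooth_trans[OF d c] \<phi>(1)]) simp
      qed (use d in \<open>auto simp: \<beta>_def\<close>)
      show "(\<beta> \<circ> chart_inv d) (snd d p) = 0" if "p \<in> fst d" "p \<notin> C" for p
        using that d C3 by simp
    qed
  qed
  then show ?thesis using that C1 C2 C3 N1 N2 N3 N4 by blast
qed

definition cutoff_field :: "('p, 'e) chart \<Rightarrow> ('p \<Rightarrow> real) \<Rightarrow> ('p, 'e) vfield \<Rightarrow> ('p, 'e) vfield" where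
  "cutoff_field c \<beta> X = (\<lambda>p. if p \<in> fst c then tv_scale (\<beta> p) (X p) else tv_zero)"

lemma cutoff_field_gsections:
  assumes c: "c \<in> A" and \<beta>: "smooth_fun A \<beta>" and C: "C \<subseteq> fst c"
    "openin (atlas_topology A) (carrier_of A - C)" "\<And>q. q \<notin> C \<Longrightarrow> \<beta> q = 0"
    and E: "linear_distribution E" and X: "\<And>q. q \<in> fst c \<Longrightarrow> X q \<in> tangent_space A q"
    "\<And>q. q \<in> fst c \<Longrightarrow> X q \<in> E q" and s: "smooth_on (snd c ` fst c) (\<lambda>z. X (chart_inv c z) c)"
  shows "cutoff_field c \<beta> X \<in> gsections A E"
proof -
  have "smooth_on (snd d ` fst d) (\<lambda>z. cutoff_field c \<beta> X (chart_inv d z) d)" if d: "d \<in> A" for d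
  proof (rule smooth_on_by_cover[OF c d C(2,1)])
    show "smooth_on (chart_overlap d c) (\<lambda>z. cutoff_field c \<beta> X (chart_inv d z) d)"
    proof (rule smooth_on_cong[OF open_overlap[OF d c]])
      show "smooth_on (chart_overlap d c) (\<lambda>z. \<beta> (chart_inv d z) *\<^sub>R X (chart_inv d z) d)"
        by (intro smooth_on_scaleR open_overlap d c smooth_fun_overlap \<beta> field_smooth_transfer[OF c d X(1) s])
    qed (use d in \<open>auto simp: cutoff_field_def tv_scale_def\<close>)
    show "cutoff_field c \<beta> X (chart_inv d (snd d p)) d = 0" if "p \<in> fst d" "p \<notin> C" for p
      using that d C(3) by (simp add: cutoff_field_def tv_scale_def tv_zero_def)
  qed
  moreover have "p \<in> carrier_of A" if "p \<in> fst c" for p using that c by (auto simp: carrier_of_def)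
  ultimately show ?thesis
    using E X unfolding gsections_def linear_distribution_def
    by (auto simp: cutoff_field_def tv_scale_tangent tv_zero_tangent)
qed

lemma cutoff_fun_smooth:
  assumes c: "c \<in> A" and \<beta>: "smooth_fun A \<beta>" and C: "C \<subseteq> fst c"
    "openin (atlas_topology A) (carrier_of A - C)" "\<And>q. q \<notin> C \<Longrightarrow> \<beta> q = 0"
    and g: "smooth_on (snd c ` fst c) (\<lambda>z. g (chart_inv c z))"
  shows "smooth_fun A (\<lambda>q. if q \<in> fst c then \<beta> q * g q else 0)"
  unfolding smooth_fun_def
proof
  fix d assume d: "d \<in> A"
  show "smooth_on (snd d ` fst d) ((\<lambda>q. if q \<in> fst c then \<beta> q * g q else 0) \<circ> chart_inv d)"
  proof (rule smooth_on_by_cover[OF c d C(2,1)])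
    show "smooth_on (chart_overlap d c) ((\<lambda>q. if q \<in> fst c then \<beta> q * g q else 0) \<circ> chart_inv d)"
    proof (rule smooth_on_cong[OF open_overlap[OF d c]])
      have "smooth_on (chart_overlap d c) (\<lambda>z. g (chart_inv c (chart_trans d c z)))"
        by (rule smooth_on_compose[OF open_overlap[OF d c] smooth_trans[OF d c] g]) (use d in auto)
      then have "smooth_on (chart_overlap d c) (\<lambda>z. g (chart_inv d z))"
        by (rule smooth_on_cong[OF open_overlap[OF d c]]) (use c d in auto)
      then show "smooth_on (chart_overlap d c) (\<lambda>z. \<beta> (chart_inv d z) * g (chart_inv d z))"
        by (rule smooth_on_mult[OF open_overlap[OF d c] smooth_fun_overlap[OF \<beta> d]])
    qed (use d in auto)
    show "((\<lambda>q. if q \<in> fst c then \<beta> q * g q else 0) \<circ> chart_inv d) (snd d p) = 0"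
      if "p \<in> fst d" "p \<notin> C" for p
      using that d C(3) by simp
  qed
qed

section \<open>Locality and linear combinations for a connection\<close>

context
  fixes E D
  assumes conn: "connection_on A E D"
begin

text \<open>With a bump function supported where the fields agree, \<beta> \<open>X\<close> and
  \<beta> \<open>X'\<close> are equal globally. Function linearity pulls \<beta> out, and \<beta> is
  \<open>1\<close> at \<open>p\<close>.\<close>

lemma connection_local_left:
  assumes X: "X \<in> vfields A" "X' \<in> vfields A" and Y: "Y \<in> gsections A E"
    and p: "p \<in> carrier_of A" and ag: "agree_near A p X X'"
  shows "D X Y p = D X' Y p"
proof -
  obtain W where W: "openin (atlas_topology A) W" "p \<in> W" "\<And>q. q \<in> W \<Longrightarrow> X q = X' q"
    using ag by (auto simp: agree_near_def)
  obtain c where c: "c \<in> A" "p \<in> fst c" using p by (auto simp: carrier_of_def)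
  obtain \<beta> N C where \<beta>: "smooth_fun A \<beta>" "p \<in> N" "\<And>q. q \<in> N \<Longrightarrow> \<beta> q = 1" "C \<subseteq> W \<inter> fst c"
    "\<And>q. q \<notin> C \<Longrightarrow> \<beta> q = 0" using bump_function[OF c(1) W(1,2) c(2)] by metis
  have eq: "vf_scale \<beta> X = vf_scale \<beta> X'"
  proof
    fix q show "vf_scale \<beta> X q = vf_scale \<beta> X' q"
      using W(3)[of q] \<beta>(4) \<beta>(5)[of q] by (cases "q \<in> C") (auto simp: vf_scale_def tv_scale_def)
  qed
  have "vf_scale \<beta> (D X Y) = vf_scale \<beta> (D X' Y)"
    using conn X Y \<beta>(1) eq unfolding connection_on_def by metis
  then have "tv_scale (\<beta> p) (D X Y p) = tv_scale (\<beta> p) (D X' Y p)"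
    by (simp add: vf_scale_def fun_eq_iff)
  then show ?thesis using \<beta>(2,3) by (simp add: tv_scale_def)
qed

text \<open>As for the first argument, but the Leibniz rule adds the derivative of \<beta> times the
  section. These extra terms coincide at \<open>p\<close>, since \<open>Y\<close> and
  \<open>Y'\<close> have the same value there.\<close>

lemma connection_local_right:
  assumes X: "X \<in> vfields A" and Y: "Y \<in> gsections A E" "Y' \<in> gsections A E"
    and p: "p \<in> carrier_of A" and ag: "agree_near A p Y Y'"
  shows "D X Y p = D X Y' p"
proof -
  obtain W where W: "openin (atlas_topology A) W" "p \<in> W" "\<And>q. q \<in> W \<Longrightarrow> Y q = Y' q"
    using ag by (auto simp: agree_near_def)
  obtain c where c: "c \<in> A" "p \<in> fst c" using p by (auto simp: carrier_of_def)
  obtain \<beta> N C where \<beta>: "smooth_fun A \<beta>" "p \<in> N" "\<And>q. q \<in> N \<Longrightarrow> \<beta> q = 1" "C \<subseteq> W \<inter> fst c"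
    "\<And>q. q \<notin> C \<Longrightarrow> \<beta> q = 0" using bump_function[OF c(1) W(1,2) c(2)] by metis
  have eq: "vf_scale \<beta> Y = vf_scale \<beta> Y'"
  proof
    fix q show "vf_scale \<beta> Y q = vf_scale \<beta> Y' q"
      using W(3)[of q] \<beta>(4) \<beta>(5)[of q] by (cases "q \<in> C") (auto simp: vf_scale_def tv_scale_def)
  qed
  have "vf_add (vf_scale \<beta> (D X Y)) (vf_scale (\<lambda>p. tv_apply A p (X p) \<beta>) Y)
      = vf_add (vf_scale \<beta> (D X Y')) (vf_scale (\<lambda>p. tv_apply A p (X p) \<beta>) Y')"
    using conn X Y \<beta>(1) eq unfolding connection_on_def by metis
  from fun_cong[OF this, of p] show ?thesis
    using \<beta>(2,3) W(2,3) by (simp add: vf_add_def tv_add_def vf_scale_def tv_scale_def fun_eq_iff)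
qed

text \<open>Existence of the described value is locality in both arguments. Uniqueness comes from
  the extensions supplied as premises: if there were none, the description would hold vacuously of
  every value.\<close>

lemma local_value_eq:
  assumes p: "p \<in> carrier_of A" and X: "X' \<in> vfields A" "agree_near A p X' X"
    and Y: "Y' \<in> gsections A E" "agree_near A p Y' Y"
  shows "local_value A E D X Y p = D X' Y' p"
  unfolding local_value_def
proof (rule the_equality)
  have tr: "agree_near A p Z Z''" if Z: "agree_near A p Z Z'" "agree_near A p Z'' Z'" for Z Z' Z'' :: "('p, 'e) vfield"
  proof -
    obtain W where W: "openin (atlas_topology A) W" "p \<in> W" "\<forall>q\<in>W. Z q = Z' q"
      using Z(1) unfolding agree_near_def by blast
    obtain W' where W': "openin (atlas_topology A) W'" "p \<in> W'" "\<forall>q\<in>W'. Z'' q = Z' q"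
      using Z(2) unfolding agree_near_def by blast
    have "\<forall>q\<in>W \<inter> W'. Z q = Z'' q" using W(3) W'(3) by simp
    then show ?thesis
      unfolding agree_near_def using openin_Int[OF W(1) W'(1)] W(2) W'(2) by blast
  qed
  show "\<forall>X''\<in>vfields A. \<forall>Y''\<in>gsections A E. agree_near A p X'' X \<and> agree_near A p Y'' Y \<longrightarrow> D X'' Y'' p = D X' Y' p"
  proof (intro ballI impI)
    fix X'' Y'' assume *: "X'' \<in> vfields A" "Y'' \<in> gsections A E" "agree_near A p X'' X \<and> agree_near A p Y'' Y"
    have "D X'' Y'' p = D X' Y'' p"
      by (rule connection_local_left[OF *(1) X(1) *(2) p tr[OF conjunct1[OF *(3)] X(2)]])
    also have "\<dots> = D X' Y' p"
      by (rule connection_local_right[OF X(1) *(2) Y(1) p tr[OF conjunct2[OF *(3)] Y(2)]])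
    finally show "D X'' Y'' p = D X' Y' p" .
  qed
  then show "w = D X' Y' p"
    if "\<forall>X''\<in>vfields A. \<forall>Y''\<in>gsections A E. agree_near A p X'' X \<and> agree_near A p Y'' Y \<longrightarrow> D X'' Y'' p = w" for w
    using that X Y by blast
qed

lemma connection_lincomb_left:
  assumes "finite I" "\<And>i. i \<in> I \<Longrightarrow> X i \<in> vfields A" "\<And>i. i \<in> I \<Longrightarrow> smooth_fun A (f i)"
    and Y: "Y \<in> gsections A E"
  shows "D (vf_lincomb I f X) Y p = (\<lambda>c. \<Sum>i\<in>I. f i p *\<^sub>R D (X i) Y p c)"
  using assms(1-3)
proof (induction I)
  case empty
  have z: "(\<lambda>p. tv_zero) \<in> vfields A"
    unfolding vfields_def by (rule zero_gsection[OF linear_distribution_tangent_space])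
  have "D (vf_scale (\<lambda>_. 0) (\<lambda>p. tv_zero)) Y = vf_scale (\<lambda>_. 0) (D (\<lambda>p. tv_zero) Y)"
    using conn z Y smooth_fun_const unfolding connection_on_def by blast
  then show ?case
    using vf_lincomb_empty[of f X "\<lambda>p. tv_zero"] by (simp add: vf_scale_def tv_scale_def)
next
  case (insert i I)
  have m: "vf_scale (f i) (X i) \<in> vfields A" "vf_lincomb I f X \<in> vfields A"
    using insert.prems insert.hyps unfolding vfields_def
    by (auto intro!: vf_scale_gsections vf_lincomb_gsections linear_distribution_tangent_space)
  have "D (vf_lincomb (insert i I) f X) Y = vf_add (D (vf_scale (f i) (X i)) Y) (D (vf_lincomb I f X) Y)"
    using conn m Y insert.hyps unfolding connection_on_def by (simp add: vf_lincomb_insert)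
  moreover have "D (vf_scale (f i) (X i)) Y = vf_scale (f i) (D (X i) Y)"
    using conn insert.prems Y unfolding connection_on_def by blast
  ultimately show ?case
    using insert by (simp add: vf_add_def tv_add_def vf_scale_def tv_scale_def)
qed

lemma connection_lincomb_right:
  assumes "finite I" "\<And>i. i \<in> I \<Longrightarrow> Y i \<in> gsections A E" "\<And>i. i \<in> I \<Longrightarrow> smooth_fun A (f i)"
    and X: "X \<in> vfields A" and E: "linear_distribution E"
  shows "D X (vf_lincomb I f Y) p
    = (\<lambda>c. \<Sum>i\<in>I. f i p *\<^sub>R D X (Y i) p c + tv_apply A p (X p) (f i) *\<^sub>R Y i p c)"
  using assms(1-3)
proof (induction I)
  case empty
  have z: "(\<lambda>p. tv_zero) \<in> gsections A E" by (rule zero_gsection[OF E])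
  have "D X (vf_scale (\<lambda>_. 0) (\<lambda>p. tv_zero)) = vf_add (vf_scale (\<lambda>_. 0) (D X (\<lambda>p. tv_zero)))
      (vf_scale (\<lambda>p. tv_apply A p (X p) (\<lambda>_. 0)) (\<lambda>p. tv_zero))"
    using conn z X smooth_fun_const unfolding connection_on_def by blast
  then show ?case
    using vf_lincomb_empty[of f Y "\<lambda>p. tv_zero"]
    by (simp add: vf_add_def tv_add_def vf_scale_def tv_scale_def tv_zero_def)
next
  case (insert i I)
  have m: "vf_scale (f i) (Y i) \<in> gsections A E" "vf_lincomb I f Y \<in> gsections A E"
    using insert.prems insert.hyps
    by (auto intro!: vf_scale_gsections vf_lincomb_gsections E)
  have "D X (vf_lincomb (insert i I) f Y) = vf_add (D X (vf_scale (f i) (Y i))) (D X (vf_lincomb I f Y))"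
    using conn m X insert.hyps unfolding connection_on_def by (simp add: vf_lincomb_insert)
  moreover have "D X (vf_scale (f i) (Y i))
      = vf_add (vf_scale (f i) (D X (Y i))) (vf_scale (\<lambda>p. tv_apply A p (X p) (f i)) (Y i))"
    using conn insert.prems X unfolding connection_on_def by blast
  ultimately show ?case
    using insert by (simp add: vf_add_def tv_add_def vf_scale_def tv_scale_def)
qed

end

end

section \<open>The slit tangent bundle as a manifold\<close>

text \<open>The tangent map of \<psi>; for a transition map of the base it is the corresponding
  transition map of the slit tangent bundle.\<close>

definition slit_trans :: "('e::real_normed_vector \<Rightarrow> 'e) \<Rightarrow> 'e \<times> 'e \<Rightarrow> 'e \<times> 'e" where
  "slit_trans \<psi> z = (\<psi> (fst z), FD \<psi> (fst z) (snd z))"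

lemma smooth_slit_trans:
  fixes \<psi> :: "'e::euclidean_space \<Rightarrow> 'e"
  assumes "open S" "smooth_on S \<psi>"
  shows "smooth_on (S \<times> T) (slit_trans \<psi>)"
proof (rule smooth_on_subset)
  have o: "open (S \<times> (UNIV :: 'e set))" using assms by (simp add: open_Times)
  have f: "smooth_on (S \<times> (UNIV :: 'e set)) fst" "smooth_on (S \<times> (UNIV :: 'e set)) snd"
    by (auto intro: smooth_on_bounded_linear bounded_linear_fst bounded_linear_snd)
  show "smooth_on (S \<times> UNIV) (slit_trans \<psi>)"
    unfolding slit_trans_def
    by (rule smooth_on_Pair[OF o smooth_on_compose[OF o f(1) assms(2)]
          smooth_on_FD_moving[OF o assms(2) f]]) auto
qed auto

text \<open>The Jacobian is block triangular: the fibre part is linear in \<open>y\<close>, but its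
  coefficients depend on \<open>x\<close>, and this puts the second derivative of \<psi> into the
  off-diagonal block.\<close>

lemma slit_trans_has_derivative:
  fixes \<psi> :: "'e::euclidean_space \<Rightarrow> 'e"
  assumes "open S" "smooth_on S \<psi>" "x \<in> S"
  shows "(slit_trans \<psi> has_derivative (\<lambda>q. (FD \<psi> x (fst q), FD (\<lambda>x. FD \<psi> x y) x (fst q) + FD \<psi> x (snd q)))) (at (x, y))"
proof -
  have f: "(fst has_derivative fst) (at (x, y))" "(snd has_derivative snd) (at (x, y))"
    by (auto intro: bounded_linear_imp_has_derivative bounded_linear_fst bounded_linear_snd)
  have "((\<lambda>z. \<psi> (fst z)) has_derivative (\<lambda>q. FD \<psi> x (fst q))) (at (x, y))"
    using has_derivative_compose[OF f(1), of \<psi> "FD \<psi> x"]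
      has_derivative_FD[OF smooth_on_differentiable[OF assms(2,3)]] by simp
  moreover have "((\<lambda>z. FD \<psi> (fst z) (snd z)) has_derivative
      (\<lambda>q. FD (\<lambda>x. FD \<psi> x y) x (fst q) + FD \<psi> x (snd q))) (at (x, y))"
    using has_derivative_FD_moving[OF assms(1,2) _ f] assms(3) by simp
  ultimately show ?thesis unfolding slit_trans_def by (rule has_derivative_Pair)
qed

context smooth_atlas
begin

lemma mem_slit_chart:
  "(p, v) \<in> fst (slit_chart A c) \<longleftrightarrow> p \<in> fst c \<and> v \<in> tangent_space A p \<and> v \<noteq> tv_zero"
  by (simp add: slit_chart_def)

lemma slit_chart_apply: "snd (slit_chart A c) (p, v) = (snd c p, v c)"
  by (simp add: slit_chart_def)

lemma tangent_component_eq_0_iff: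
  assumes "c \<in> A" "p \<in> fst c" "v \<in> tangent_space A p"
  shows "v c = 0 \<longleftrightarrow> v = tv_zero"
  using tangent_space_eqI[OF assms(3) tv_zero_tangent assms(1,2)] by (auto simp: tv_zero_def)

text \<open>A nonzero tangent vector has a nonzero component in every chart around its base point,
  so exactly the zero of the fibre is missing. A prescribed component \<open>y\<close> is attained
  by the value at \<open>p\<close> of the coordinate field in direction \<open>y\<close>.\<close>

lemma slit_chart_image_Int:
  assumes c: "c \<in> A"
  shows "snd (slit_chart A c) ` {(p, v) \<in> fst (slit_chart A c). p \<in> U} = snd c ` (fst c \<inter> U) \<times> (- {0})"
proof (intro set_eqI iffI)
  fix x assume "x \<in> snd (slit_chart A c) ` {(p, v) \<in> fst (slit_chart A c). p \<in> U}"
  then obtain p v where pv: "(p, v) \<in> fst (slit_chart A c)" "p \<in> U" "x = snd (slit_chart A c) (p, v)"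
    by blast
  then show "x \<in> snd c ` (fst c \<inter> U) \<times> (- {0})"
    using tangent_component_eq_0_iff[OF c] by (auto simp: mem_slit_chart slit_chart_apply)
next
  fix x :: "'e \<times> 'e" assume "x \<in> snd c ` (fst c \<inter> U) \<times> (- {0})"
  then obtain p y where p: "p \<in> fst c" "p \<in> U" "y \<noteq> 0" "x = (snd c p, y)" by auto
  let ?v = "coord_field A c y p"
  have v: "?v \<in> tangent_space A p" "?v c = y"
    using coord_field_tangent coord_field_self c p by auto
  then have "(p, ?v) \<in> fst (slit_chart A c)"
    using p tangent_component_eq_0_iff[OF c p(1) v(1)] by (simp add: mem_slit_chart)
  moreover have "x = snd (slit_chart A c) (p, ?v)" using v p by (simp add: slit_chart_apply)
  ultimately show "x \<in> snd (slit_chart A c) ` {(p, v) \<in> fst (slit_chart A c). p \<in> U}"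
    using p(2) by blast
qed

lemma slit_chart_image: "c \<in> A \<Longrightarrow> snd (slit_chart A c) ` fst (slit_chart A c) = snd c ` fst c \<times> (- {0})"
  using slit_chart_image_Int[of c UNIV] by simp

lemma slit_chart_overlap:
  assumes "c \<in> A"
  shows "chart_overlap (slit_chart A c) (slit_chart A d) = chart_overlap c d \<times> (- {0})"
proof -
  have "fst (slit_chart A c) \<inter> fst (slit_chart A d) = {(p, v) \<in> fst (slit_chart A c). p \<in> fst d}"
    by (auto simp: mem_slit_chart)
  then show ?thesis using slit_chart_image_Int[OF assms, of "fst d"] by simp
qed

lemma slit_chart_inj:
  assumes "c \<in> A"
  shows "inj_on (snd (slit_chart A c)) (fst (slit_chart A c))"
proof (rule inj_onI)
  fix u u' assume "u \<in> fst (slit_chart A c)" "u' \<in> fst (slit_chart A c)"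
    and eq: "snd (slit_chart A c) u = snd (slit_chart A c) u'"
  moreover obtain p v p' v' where [simp]: "u = (p, v)" "u' = (p', v')" by fastforce
  ultimately have m: "p \<in> fst c" "v \<in> tangent_space A p" "p' \<in> fst c" "v' \<in> tangent_space A p'"
    by (auto simp: mem_slit_chart)
  have e: "snd c p = snd c p'" "v c = v' c" using eq by (auto simp: slit_chart_apply)
  then have "p = p'" using chart_inj[OF assms] m by (auto simp: inj_on_def)
  then show "u = u'" using tangent_space_eqI[of v p v' c] assms m e(2) by simp
qed

lemma slit_chart_inv:
  assumes "c \<in> A" "u \<in> fst (slit_chart A c)"
  shows "chart_inv (slit_chart A c) (snd (slit_chart A c) u) = u"
  using slit_chart_inj[OF assms(1)] assms(2) by (simp add: chart_inv_def)

lemma slit_chart_trans: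
  assumes cd: "c \<in> A" "d \<in> A" and z: "z \<in> chart_overlap (slit_chart A c) (slit_chart A d)"
  shows "chart_trans (slit_chart A c) (slit_chart A d) z = slit_trans (chart_trans c d) z"
proof -
  obtain u where u: "u \<in> fst (slit_chart A c)" "u \<in> fst (slit_chart A d)" "z = snd (slit_chart A c) u"
    using z by blast
  obtain p v where pv: "u = (p, v)" by fastforce
  have "v \<in> tangent_space A p" "p \<in> fst c" "p \<in> fst d" using u pv by (auto simp: mem_slit_chart)
  note * = tangent_spaceD[OF this(1) cd this(2,3)]
  show ?thesis
    using slit_chart_inv[OF cd(1) u(1)] u pv * \<open>p \<in> fst c\<close> cd
    by (simp add: slit_chart_apply slit_trans_def)
qed

lemma slit_smooth_atlas: "smooth_atlas (slit_atlas A)"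
proof
  fix c' assume "c' \<in> slit_atlas A"
  then obtain c where c: "c' = slit_chart A c" "c \<in> A" by (auto simp: slit_atlas_def)
  show "inj_on (snd c') (fst c')" using c slit_chart_inj by simp
  show "open (snd c' ` fst c')"
    using c by (simp add: slit_chart_image open_Times open_chart_image open_Compl)
  fix d' assume "d' \<in> slit_atlas A"
  then obtain d where d: "d' = slit_chart A d" "d \<in> A" by (auto simp: slit_atlas_def)
  show o: "open (chart_overlap c' d')"
    using c d by (simp add: slit_chart_overlap open_Times open_overlap open_Compl)
  have "smooth_on (chart_overlap c' d') (slit_trans (chart_trans c d))"
    unfolding c(1) d(1) slit_chart_overlap[OF c(2)]
    by (rule smooth_slit_trans[OF open_overlap smooth_trans]) (use c d in auto)
  then show "smooth_on (chart_overlap c' d') (chart_trans c' d')"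
    by (rule smooth_on_cong[OF o]) (use slit_chart_trans[OF c(2) d(2)] c d in metis)
qed

interpretation slit: smooth_atlas "slit_atlas A"
  by (rule slit_smooth_atlas)

lemma slit_chart_mem [simp]: "c \<in> A \<Longrightarrow> slit_chart A c \<in> slit_atlas A"
  by (simp add: slit_atlas_def)

lemma mem_carrier_slit_atlas: "u \<in> carrier_of (slit_atlas A) \<longleftrightarrow> (\<exists>c\<in>A. u \<in> fst (slit_chart A c))"
  by (auto simp: carrier_of_def slit_atlas_def)

lemma openin_slit_preimage:
  assumes "openin (atlas_topology A) U"
  shows "openin (atlas_topology (slit_atlas A)) {u \<in> carrier_of (slit_atlas A). fst u \<in> U}"
  unfolding slit.openin_atlas_topology
proof (intro conjI ballI)
  fix c' assume "c' \<in> slit_atlas A"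
  then obtain c where c: "c' = slit_chart A c" "c \<in> A" by (auto simp: slit_atlas_def)
  have "fst c' \<inter> {u \<in> carrier_of (slit_atlas A). fst u \<in> U} = {(p, v) \<in> fst (slit_chart A c). p \<in> U}"
    using c by (auto simp: mem_carrier_slit_atlas)
  moreover have "open (snd c ` (fst c \<inter> U))" using assms c by (simp add: openin_atlas_topology)
  ultimately show "open (snd c' ` (fst c' \<inter> {u \<in> carrier_of (slit_atlas A). fst u \<in> U}))"
    using c slit_chart_image_Int[OF c(2)] by (simp add: open_Times open_Compl)
qed auto

lemma slit_tangentD:
  assumes w: "w \<in> tangent_space (slit_atlas A) u" and cd: "c \<in> A" "d \<in> A"
    and u: "u \<in> fst (slit_chart A c)" "u \<in> fst (slit_chart A d)"
    and xy: "snd (slit_chart A c) u = (x, y)" and ab: "w (slit_chart A c) = (a, b)"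
  shows "w (slit_chart A d) = (FD (chart_trans c d) x a,
      FD (\<lambda>x. FD (chart_trans c d) x y) x a + FD (chart_trans c d) x b)"
proof -
  let ?O = "chart_overlap (slit_chart A c) (slit_chart A d)"
  have m: "(x, y) \<in> ?O" using u xy by (metis IntI imageI)
  then have x: "x \<in> chart_overlap c d" by (simp add: slit_chart_overlap[OF cd(1)])
  have "FD (chart_trans (slit_chart A c) (slit_chart A d)) (x, y) = FD (slit_trans (chart_trans c d)) (x, y)"
    by (rule FD_cong_open[OF slit.open_overlap m slit_chart_trans]) (use cd in auto)
  then show ?thesis
    using slit.tangent_spaceD[OF w _ _ u] cd xy ab
      FD_eqI[OF slit_trans_has_derivative[OF open_overlap smooth_trans x]] by simp
qed

end

text \<open>Points over different base points are separated by preimages of open sets of the base.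
  Points over the same base point lie in a common slit chart and differ in their fibre coordinates,
  which are separated there.\<close>

lemma (in hausdorff_atlas) slit_hausdorff_atlas: "hausdorff_atlas (slit_atlas A)"
proof -
  interpret slit: smooth_atlas "slit_atlas A" by (rule slit_smooth_atlas)
  show ?thesis
  proof
    show "Hausdorff_space (atlas_topology (slit_atlas A))"
      unfolding Hausdorff_space_def slit.topspace_atlas_topology
    proof (intro allI impI)
      fix u u' assume *: "u \<in> carrier_of (slit_atlas A) \<and> u' \<in> carrier_of (slit_atlas A) \<and> u \<noteq> u'"
      obtain p v p' v' where [simp]: "u = (p, v)" "u' = (p', v')" by fastforce
      obtain c where c: "c \<in> A" "u \<in> fst (slit_chart A c)" using * mem_carrier_slit_atlas by blast
      obtain c' where c': "c' \<in> A" "u' \<in> fst (slit_chart A c')" using * mem_carrier_slit_atlas by blast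
      show "\<exists>U V. openin (atlas_topology (slit_atlas A)) U \<and> openin (atlas_topology (slit_atlas A)) V
          \<and> u \<in> U \<and> u' \<in> V \<and> disjnt U V"
      proof (cases "p = p'")
        case False
        have "p \<in> topspace (atlas_topology A)" "p' \<in> topspace (atlas_topology A)"
          using c c' by (auto simp: topspace_atlas_topology carrier_of_def mem_slit_chart)
        then obtain U V where UV: "openin (atlas_topology A) U" "openin (atlas_topology A) V" "p \<in> U" "p' \<in> V"
          "disjnt U V" using False hausdorff unfolding Hausdorff_space_def by blast
        show ?thesis
          by (intro exI[of _ "{u \<in> carrier_of (slit_atlas A). fst u \<in> U}"]
              exI[of _ "{u \<in> carrier_of (slit_atlas A). fst u \<in> V}"] conjI openin_slit_preimage UV)
            (use * UV in \<open>auto simp: disjnt_def\<close>)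
      next
        case True
        have u': "u' \<in> fst (slit_chart A c)" using c c' True by (simp add: mem_slit_chart)
        have "v c \<noteq> v' c"
          using tangent_space_eqI[of v p v' c] c u' True * by (auto simp: mem_slit_chart)
        then obtain U V where UV: "open U" "open V" "v c \<in> U" "v' c \<in> V" "U \<inter> V = {}"
          by (metis separation_t2)
        \<comment> \<open>All points over the domain of \<open>c\<close> whose fibre coordinate lies
          in \<open>W\<close>; the zero is removed to stay inside the image of the slit
          chart.\<close>
        define P where "P W = chart_inv (slit_chart A c) ` (snd c ` fst c \<times> (W \<inter> - {0}))" for W
        have P: "openin (atlas_topology (slit_atlas A)) (P W)" if "open W" for W
          unfolding P_def using that c
          by (intro slit.openin_chart_inv_image open_Times open_chart_image)
            (auto simp: slit_chart_image open_Int open_Compl)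
        have mP: "w \<in> P W" if w: "w \<in> fst (slit_chart A c)" "snd w c \<in> W" for w W
        proof -
          have "w = chart_inv (slit_chart A c) (snd (slit_chart A c) w)"
            using slit_chart_inv c w by simp
          moreover have "snd (slit_chart A c) w \<in> snd c ` fst c \<times> (W \<inter> - {0})"
            using w tangent_component_eq_0_iff[OF c(1)]
          by (cases w) (auto simp: mem_slit_chart slit_chart_apply)
        ultimately show ?thesis unfolding P_def by (rule image_eqI)
        qed
        have "disjnt (P U) (P V)"
        proof -
          have "x = y" if "chart_inv (slit_chart A c) x = chart_inv (slit_chart A c) y"
            "x \<in> snd c ` fst c \<times> (U \<inter> - {0})" "y \<in> snd c ` fst c \<times> (V \<inter> - {0})" for x y
          proof -
            have "x \<in> snd (slit_chart A c) ` fst (slit_chart A c)" "y \<in> snd (slit_chart A c) ` fst (slit_chart A c)"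
              unfolding slit_chart_image[OF c(1)] using that by auto
            then show ?thesis using that(1) slit.chart_chart_inv[OF slit_chart_mem[OF c(1)]] by metis
          qed
          then show ?thesis using UV(5) unfolding disjnt_def P_def by blast
        qed
        moreover have "u \<in> P U" "u' \<in> P V" using mP[OF c(2)] mP[OF u'] UV by simp_all
        ultimately show ?thesis using P UV(1,2) by blast
      qed
    qed
  qed
qed

section \<open>Change of coordinates for sprays\<close>

abbreviation D2 :: "('a::real_normed_vector \<Rightarrow> 'b::real_normed_vector) \<Rightarrow> 'a \<Rightarrow> 'a \<Rightarrow> 'a \<Rightarrow> 'b" where
  "D2 f x v w \<equiv> FD (\<lambda>z. FD f z w) x v"

lemma linear_D2_left:
  assumes "smooth_on S f" "x \<in> S"
  shows "linear (\<lambda>v. D2 f x v w)"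
  using linear_frechet_derivative[OF smooth_on_differentiable[OF smooth_on_FD[OF assms(1)] assms(2)]]
  by simp

text \<open>The inner direction \<open>w\<close> sits under a further derivative, so linearity in it
  is obtained by exchanging the two derivatives.\<close>

lemma linear_D2_right:
  fixes f :: "'a::real_normed_vector \<Rightarrow> 'b::euclidean_space"
  assumes "open S" "smooth_on S f" "x \<in> S"
  shows "linear (D2 f x v)"
proof -
  have "D2 f x v = (\<lambda>w. D2 f x w v)" using FD_FD_commute[OF assms(1,3,2)] by auto
  then show ?thesis using linear_D2_left[OF assms(2,3), of v] by simp
qed

lemma D2_compose:
  fixes f :: "'b::euclidean_space \<Rightarrow> 'c::real_normed_vector" and g :: "'a::euclidean_space \<Rightarrow> 'b"
  assumes "open S" "open T" "smooth_on T f" "smooth_on S g" "g ` S \<subseteq> T" "x \<in> S"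
  shows "D2 (\<lambda>x. f (g x)) x v w = D2 f (g x) (FD g x v) (FD g x w) + FD f (g x) (D2 g x v w)"
proof -
  have gd: "(g has_derivative FD g y) (at y)" if "y \<in> S" for y
    using has_derivative_FD[OF smooth_on_differentiable[OF assms(4) that]] .
  have "FD (\<lambda>y. FD (\<lambda>x. f (g x)) y w) x = FD (\<lambda>y. FD f (g y) (FD g y w)) x"
  proof (rule FD_cong_open[OF assms(1,6)])
    fix y assume y: "y \<in> S"
    then have "f differentiable (at (g y))" using smooth_on_differentiable[OF assms(3)] assms(5) by blast
    from FD_eqI[OF has_derivative_compose[OF gd[OF y] has_derivative_FD[OF this]]]
    show "FD (\<lambda>x. f (g x)) y w = FD f (g y) (FD g y w)" by simp
  qed
  moreover have "((\<lambda>y. FD f (g y) (FD g y w)) has_derivative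
      (\<lambda>v. D2 f (g x) (FD g x v) (FD g x w) + FD f (g x) (D2 g x v w))) (at x)"
    by (rule has_derivative_FD_moving[OF assms(2,3) _ gd[OF assms(6)]
          has_derivative_FD[OF smooth_on_differentiable[OF smooth_on_FD[OF assms(4)] assms(6)]]])
      (use assms(5,6) in blast)
  ultimately show ?thesis by (simp add: FD_eqI)
qed

text \<open>Exchanging the order lets the vertical derivative be taken first. Since the tangent map
  is linear along fibres, that derivative no longer depends on \<open>y\<close>, and only the base
  derivative of \<open>FD\<close> \<psi> remains.\<close>

lemma D2_slit_trans:
  fixes \<psi> :: "'e::euclidean_space \<Rightarrow> 'e"
  assumes S: "open S" "smooth_on S \<psi>" "x \<in> S"
  shows "D2 (slit_trans \<psi>) (x, y) (0, b) q = (0, D2 \<psi> x (fst q) b)"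
proof -
  have o: "open (S \<times> (UNIV :: 'e set))" using S by (simp add: open_Times)
  have "D2 (slit_trans \<psi>) (x, y) (0, b) q = D2 (slit_trans \<psi>) (x, y) q (0, b)"
    by (rule FD_FD_commute[OF o _ smooth_slit_trans[OF S(1,2)]]) (use S in auto)
  also have "FD (\<lambda>z. FD (slit_trans \<psi>) z (0, b)) (x, y) = FD (\<lambda>z. (0, FD \<psi> (fst z) b)) (x, y)"
  proof (rule FD_cong_open[OF o])
    fix z assume "z \<in> S \<times> (UNIV :: 'e set)"
    then obtain x' y' where z: "z = (x', y')" "x' \<in> S" by auto
    have "linear (\<lambda>v. D2 \<psi> x' v y')" "linear (FD \<psi> x')"
      using linear_D2_left[OF S(2) z(2)] linear_frechet_derivative[OF smooth_on_differentiable[OF S(2) z(2)]] by auto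
    then show "FD (slit_trans \<psi>) z (0, b) = (0, FD \<psi> (fst z) b)"
      using FD_eqI[OF slit_trans_has_derivative[OF S(1,2) z(2)], of y'] z by (simp add: linear_0)
  qed (use S in auto)
  also have "\<dots> = (\<lambda>q. (0, D2 \<psi> x (fst q) b))"
  proof (rule FD_eqI)
    have "(fst has_derivative fst) (at (x, y))"
      by (auto intro: bounded_linear_imp_has_derivative bounded_linear_fst)
    from has_derivative_compose[OF this, of "\<lambda>x. FD \<psi> x b" "\<lambda>v. D2 \<psi> x v b"]
    show "((\<lambda>z. (0, FD \<psi> (fst z) b)) has_derivative (\<lambda>q. (0, D2 \<psi> x (fst q) b))) (at (x, y))"
      using has_derivative_FD[OF smooth_on_differentiable[OF smooth_on_FD[OF S(2)] S(3)]]
      by (auto intro!: has_derivative_Pair)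
  qed
  finally show ?thesis .
qed

text \<open>With \<open>z = (x, y)\<close> and \<open>L = F\<^sup>2\<close> this says that the Euler--Lagrange expression
  \<open>L\<^sub>y\<^sub>y x'' + L\<^sub>x\<^sub>y y - L\<^sub>x\<close> vanishes for \<open>x'' = -2 G\<close>.\<close>

definition spray_equation :: "('e::euclidean_space \<times> 'e \<Rightarrow> real) \<Rightarrow> 'e \<times> 'e \<Rightarrow> 'e \<Rightarrow> bool" where
  "spray_equation L z G \<longleftrightarrow>
     (\<forall>b. 2 * D2 L z (0, b) (0, G) = D2 L z (0, b) (snd z, 0) - FD L z (b, 0))"

text \<open>The equation is linear in \<open>G\<close>, with the fibre Hessian as coefficient.
  Testing the difference of two solutions against \<open>b = G - G'\<close> contradicts
  positivity.\<close>

lemma spray_equation_unique: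
  fixes L :: "'e::euclidean_space \<times> 'e \<Rightarrow> real"
  assumes "open T" "smooth_on T L" "z \<in> T" and pos: "\<And>\<xi>. \<xi> \<noteq> 0 \<Longrightarrow> D2 L z (0, \<xi>) (0, \<xi>) > 0"
    and G: "spray_equation L z G" "spray_equation L z G'"
  shows "G = G'"
proof (rule ccontr)
  assume "G \<noteq> G'"
  have "D2 L z (0, G - G') (0, G) = D2 L z (0, G - G') (0, G')"
    using G by (auto simp: spray_equation_def) (metis mult_cancel_left zero_neq_numeral)
  then have "D2 L z (0, G - G') ((0, G) - (0, G')) = 0"
    by (simp only: linear_diff[OF linear_D2_right[OF assms(1-3)]])
  then show False using pos[of "G - G'"] \<open>G \<noteq> G'\<close> by simp
qed

text \<open>Write \<open>B\<close> for the second derivative of \<psi> at \<open>x\<close> and test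
  with \<open>b' = FD\<close> \<psi> \<open>x b\<close>, which by \<open>surj\<close> covers all
  directions. The first-order terms with \<open>B y b\<close> from the mixed derivative and from the
  base derivative cancel. What is left over is the Hessian applied to \<open>B y y\<close>; as the
  equation contains twice \<open>G\<close>, a shift of \<open>G\<close> by one half of
  \<open>B y y\<close> absorbs it.\<close>

lemma spray_equation_transform:
  fixes \<psi> :: "'e::euclidean_space \<Rightarrow> 'e" and L L' :: "'e \<times> 'e \<Rightarrow> real"
  assumes S: "open S" "smooth_on S \<psi>" "x \<in> S" and y: "y \<noteq> 0"
    and T: "open T" "smooth_on T L" "slit_trans \<psi> ` (S \<times> - {0}) \<subseteq> T"
    and L': "\<And>z. z \<in> S \<times> - {0} \<Longrightarrow> L' z = L (slit_trans \<psi> z)"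
    and surj: "\<And>b. \<exists>a. FD \<psi> x a = b"
    and G: "spray_equation L' (x, y) G"
  shows "spray_equation L (slit_trans \<psi> (x, y)) (FD \<psi> x G - (1/2) *\<^sub>R D2 \<psi> x y y)"
  unfolding spray_equation_def
proof
  fix b'
  obtain b where b: "b' = FD \<psi> x b" using surj by metis
  let ?A = "FD \<psi> x" and ?B = "D2 \<psi> x" and ?z = "(x, y)" and ?w = "slit_trans \<psi> (x, y)"
  have o: "open (S \<times> - {0::'e})" using S by (simp add: open_Times open_Compl)
  have z: "?z \<in> S \<times> - {0}" using S y by simp
  have w: "?w \<in> T" using T z by blast
  have s: "smooth_on (S \<times> - {0}) (slit_trans \<psi>)" by (rule smooth_slit_trans[OF S(1,2)])
  have A: "linear ?A" using linear_frechet_derivative[OF smooth_on_differentiable[OF S(2,3)]] .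
  have B0: "?B 0 v = 0" for v using linear_0[OF linear_D2_left[OF S(2,3)]] .
  have Bc: "?B u v = ?B v u" for u v by (rule FD_FD_commute[OF S(1,3,2)])
  have F1: "FD (slit_trans \<psi>) ?z q = (?A (fst q), ?B (fst q) y + ?A (snd q))" for q
    using FD_eqI[OF slit_trans_has_derivative[OF S]] by simp
  have "FD L' ?z = FD (\<lambda>z. L (slit_trans \<psi> z)) ?z"
    by (rule FD_cong_open[OF o z L'])
  also have "\<dots> = (\<lambda>q. FD L ?w (FD (slit_trans \<psi>) ?z q))"
    by (rule FD_eqI[OF has_derivative_compose_FD[OF smooth_on_differentiable[OF s z]
          smooth_on_differentiable[OF T(2) w]]])
  finally have d1: "FD L' ?z q = FD L ?w (FD (slit_trans \<psi>) ?z q)" for q by simp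
  have "D2 L' ?z v q = D2 (\<lambda>z. L (slit_trans \<psi> z)) ?z v q" for v q
  proof -
    have "FD (\<lambda>z. FD L' z q) ?z = FD (\<lambda>z. FD (\<lambda>z. L (slit_trans \<psi> z)) z q) ?z"
    proof (rule FD_cong_open[OF o z])
      fix z :: "'e \<times> 'e" assume "z \<in> S \<times> - {0}"
      from FD_cong_open[OF o this L'] show "FD L' z q = FD (\<lambda>z. L (slit_trans \<psi> z)) z q"
        by (rule fun_cong)
    qed
    then show ?thesis by simp
  qed
  then have d2: "D2 L' ?z (0, b) q = D2 L ?w (FD (slit_trans \<psi>) ?z (0, b)) (FD (slit_trans \<psi>) ?z q)
      + FD L ?w (0, ?B (fst q) b)" for q
    using D2_compose[OF o T(1,2) s T(3) z] D2_slit_trans[OF S] by simp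
  have lw: "linear (FD L ?w)" using linear_frechet_derivative[OF smooth_on_differentiable[OF T(2) w]] .
  have lr: "linear (D2 L ?w v)" for v by (rule linear_D2_right[OF T(1,2) w])
  have e: "2 * D2 L' ?z (0, b) (0, G) = D2 L' ?z (0, b) (y, 0) - FD L' ?z (b, 0)"
    using G by (simp add: spray_equation_def)
  have m: "FD (slit_trans \<psi>) ?z (0, b) = (0, b')" by (simp add: F1 B0 linear_0[OF A] b)
  have l: "D2 L' ?z (0, b) (0, G) = D2 L ?w (0, b') (0, ?A G)"
    using d2[of "(0, G)"] m linear_0[OF lw] by (simp add: F1 B0 linear_0[OF A] zero_prod_def)
  have r1: "D2 L' ?z (0, b) (y, 0) = D2 L ?w (0, b') (?A y, 0) + D2 L ?w (0, b') (0, ?B y y) + FD L ?w (0, ?B y b)"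
    using d2[of "(y, 0)"] m linear_add[OF lr[of "(0, b')"], of "(?A y, 0)" "(0, ?B y y)"]
    by (simp add: F1 linear_0[OF A])
  have r2: "FD L' ?z (b, 0) = FD L ?w (b', 0) + FD L ?w (0, ?B y b)"
    using d1[of "(b, 0)"] linear_add[OF lw, of "(b', 0)" "(0, ?B y b)"] Bc[of b y]
    by (simp add: F1 linear_0[OF A] b)
  have "D2 L ?w (0, b') (0, ?A G - (1/2) *\<^sub>R ?B y y) = D2 L ?w (0, b') (0, ?A G) - 1/2 * D2 L ?w (0, b') (0, ?B y y)"
    using linear_diff[OF lr[of "(0, b')"], of "(0, ?A G)" "(1/2) *\<^sub>R (0, ?B y y)"]
      linear_scale[OF lr[of "(0, b')"], of "1/2" "(0, ?B y y)"] by simp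
  then show "2 * D2 L ?w (0, b') (0, ?A G - (1/2) *\<^sub>R ?B y y)
      = D2 L ?w (0, b') (snd ?w, 0) - FD L ?w (b', 0)"
    using e l r1 r2 by (simp add: slit_trans_def)
qed

lemma has_derivative_Pair_right:
  assumes "f differentiable (at (x, h y))" "(h has_derivative h') (at y)"
  shows "((\<lambda>y. f (x, h y)) has_derivative (\<lambda>a. FD f (x, h y) (0, h' a))) (at y)"
  using has_derivative_compose[OF has_derivative_Pair[OF has_derivative_const assms(2)] has_derivative_FD[OF assms(1)]]
  by simp

text \<open>Differentiation of the law for \<open>G\<close> along the fibre, with \<open>x\<close>
  fixed. The quadratic term has derivative \<open>D2\<close> \<psi> \<open>x y a\<close>: the
  product rule gives two terms, equal by symmetry, which cancel the factor one half.\<close>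

lemma fibre_derivative_transform:
  fixes \<psi> :: "'e::euclidean_space \<Rightarrow> 'e"
  assumes S: "open S" "smooth_on S \<psi>" "x \<in> S" and y: "y \<noteq> 0"
    and G: "G differentiable (at (x, y))" and G': "G' differentiable (at (slit_trans \<psi> (x, y)))"
    and eq: "\<And>y. y \<noteq> 0 \<Longrightarrow> G' (slit_trans \<psi> (x, y)) = FD \<psi> x (G (x, y)) - (1/2) *\<^sub>R D2 \<psi> x y y"
  shows "FD G' (slit_trans \<psi> (x, y)) (0, FD \<psi> x a) = FD \<psi> x (FD G (x, y) (0, a)) - D2 \<psi> x y a"
proof -
  have A: "bounded_linear (FD \<psi> x)"
    using has_derivative_bounded_linear[OF has_derivative_FD[OF smooth_on_differentiable[OF S(2,3)]]] .
  have "bilinear (D2 \<psi> x)"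
    unfolding bilinear_def using linear_D2_left[OF S(2,3)] linear_D2_right[OF S] by auto
  then have B: "bounded_bilinear (D2 \<psi> x)" by (simp add: bilinear_conv_bounded_bilinear)
  have "((\<lambda>y. G' (\<psi> x, FD \<psi> x y)) has_derivative (\<lambda>a. FD G' (\<psi> x, FD \<psi> x y) (0, FD \<psi> x a))) (at y)"
    by (rule has_derivative_Pair_right[OF _ bounded_linear_imp_has_derivative[OF A]])
      (use G' in \<open>simp add: slit_trans_def\<close>)
  moreover have "((\<lambda>y. FD \<psi> x (G (x, y)) - (1/2) *\<^sub>R D2 \<psi> x y y) has_derivative
      (\<lambda>a. FD \<psi> x (FD G (x, y) (0, a)) - (1/2) *\<^sub>R (D2 \<psi> x y a + D2 \<psi> x a y))) (at y)"
    by (intro has_derivative_diff bounded_linear.has_derivative[OF A]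
        has_derivative_Pair_right[where h = "\<lambda>y. y", OF G has_derivative_ident]
        bounded_linear.has_derivative[OF bounded_linear_scaleR_right]
        bounded_bilinear.FDERIV[OF B] has_derivative_ident)
  moreover have "FD (\<lambda>y. G' (\<psi> x, FD \<psi> x y)) y = FD (\<lambda>y. FD \<psi> x (G (x, y)) - (1/2) *\<^sub>R D2 \<psi> x y y) y"
    by (rule FD_cong_open[of "- {0}"]) (use y eq in \<open>auto simp: open_Compl slit_trans_def\<close>)
  ultimately have "FD G' (\<psi> x, FD \<psi> x y) (0, FD \<psi> x a)
      = FD \<psi> x (FD G (x, y) (0, a)) - (1/2) *\<^sub>R (D2 \<psi> x y a + D2 \<psi> x a y)"
    by (simp add: FD_eqI fun_eq_iff)
  moreover have "D2 \<psi> x a y = D2 \<psi> x y a" by (rule FD_FD_commute[OF S(1,3,2)])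
  ultimately show ?thesis by (simp add: slit_trans_def scaleR_2[symmetric])
qed

section \<open>The spray of a Finsler manifold\<close>

lemma basis_expansion_scaleR: "(\<Sum>i\<in>UNIV. x $ i *\<^sub>R axis i 1) = (x :: real ^ 'n)"
  using basis_expansion[of x] by (simp add: scalar_mult_eq_scaleR)

lemma linear_coord_sum_fst:
  fixes f :: "(real ^ 'n) \<times> 'a::real_vector \<Rightarrow> 'b::real_vector"
  assumes "linear f"
  shows "f (b, 0) = (\<Sum>i\<in>UNIV. b $ i *\<^sub>R f (axis i 1, 0))"
proof -
  have "(b, 0 :: 'a) = (\<Sum>i\<in>UNIV. b $ i *\<^sub>R (axis i 1, 0))"
    by (simp add: prod_eq_iff fst_sum snd_sum basis_expansion_scaleR)
  then show ?thesis by (simp add: linear_sum[OF assms] linear_scale[OF assms] del: scaleR_Pair)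
qed

lemma linear_coord_sum_snd:
  fixes f :: "'a::real_vector \<times> (real ^ 'n) \<Rightarrow> 'b::real_vector"
  assumes "linear f"
  shows "f (0, b) = (\<Sum>i\<in>UNIV. b $ i *\<^sub>R f (0, axis i 1))"
proof -
  have "(0 :: 'a, b) = (\<Sum>i\<in>UNIV. b $ i *\<^sub>R (0, axis i 1))"
    by (simp add: prod_eq_iff fst_sum snd_sum basis_expansion_scaleR)
  then show ?thesis by (simp add: linear_sum[OF assms] linear_scale[OF assms] del: scaleR_Pair)
qed

lemma matrix_inv_right:
  fixes H :: "real ^ 'n ^ 'n"
  assumes "invertible H"
  shows "H ** matrix_inv H = mat 1"
proof -
  have "\<exists>B. H ** B = mat 1 \<and> B ** H = mat 1" using assms by (simp add: invertible_def)
  then show ?thesis unfolding matrix_inv_def by (rule someI2_ex) simp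
qed

lemma smooth_on_vec:
  fixes f :: "'a::real_normed_vector \<Rightarrow> real ^ 'n"
  assumes "open S" "\<And>i. smooth_on S (\<lambda>x. f x $ i)"
  shows "smooth_on S f"
proof -
  have "smooth_on S (\<lambda>x. \<Sum>i\<in>UNIV. f x $ i *\<^sub>R (axis i 1 :: real ^ 'n))"
    by (intro smooth_on_sum smooth_on_scaleR smooth_on_const assms)
  moreover have "(\<lambda>x. \<Sum>i\<in>UNIV. f x $ i *\<^sub>R axis i 1) = f"
    by (simp add: fun_eq_iff basis_expansion_scaleR)
  ultimately show ?thesis by simp
qed

lemma smooth_on_vec_nth:
  fixes f :: "'a::real_normed_vector \<Rightarrow> real ^ 'n"
  shows "open S \<Longrightarrow> smooth_on S f \<Longrightarrow> smooth_on S (\<lambda>x. f x $ i)"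
  by (rule smooth_on_linear_compose[OF bounded_linear_vec_nth])

lemma smooth_on_det:
  fixes M :: "'a::real_normed_vector \<Rightarrow> real ^ 'n ^ 'n"
  assumes "open S" "\<And>i j. smooth_on S (\<lambda>x. M x $ i $ j)"
  shows "smooth_on S (\<lambda>x. det (M x))"
  unfolding det_def by (intro smooth_on_sum smooth_on_mult smooth_on_prod smooth_on_const assms)

text \<open>Cramer's rule writes each component of the solution as a quotient of determinants, hence
  of polynomials in the entries, with nonvanishing denominator. This spares any differentiation of
  \<open>matrix_inv\<close>.\<close>

lemma smooth_on_linear_system:
  fixes H :: "'a::real_normed_vector \<Rightarrow> real ^ 'n ^ 'n" and G r :: "'a \<Rightarrow> real ^ 'n"
  assumes S: "open S" and H: "\<And>i j. smooth_on S (\<lambda>x. H x $ i $ j)" and r: "smooth_on S r"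
    and inv: "\<And>x. x \<in> S \<Longrightarrow> invertible (H x)" and eq: "\<And>x. x \<in> S \<Longrightarrow> H x *v G x = r x"
  shows "smooth_on S G"
proof (rule smooth_on_vec[OF S])
  fix k
  have d: "det (H x) \<noteq> 0" if "x \<in> S" for x using inv[OF that] by (simp add: invertible_det_nz)
  have "smooth_on S (\<lambda>x. (\<chi> i j. if j = k then r x $ i else H x $ i $ j) $ i $ j)" for i j
    by (cases "j = k") (simp_all add: H smooth_on_vec_nth[OF S r])
  then have "smooth_on S (\<lambda>x. det (\<chi> i j. if j = k then r x $ i else H x $ i $ j) / det (H x))"
    by (intro smooth_on_divide smooth_on_det S H d)
  then show "smooth_on S (\<lambda>x. G x $ k)"
    by (rule smooth_on_cong[OF S]) (use eq cramer[OF d] in simp)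
qed

lemma (in smooth_atlas) coord_deriv_chart_inv:
  "c \<in> A \<Longrightarrow> z \<in> snd c ` fst c \<Longrightarrow> coord_deriv c e f (chart_inv c z) = FD (\<lambda>z. f (chart_inv c z)) z e"
  by (simp add: coord_deriv_def comp_def)

lemma (in smooth_atlas) coord_deriv2_chart_inv:
  assumes "c \<in> A" "z \<in> snd c ` fst c"
  shows "coord_deriv c e (coord_deriv c e' f) (chart_inv c z) = D2 (\<lambda>z. f (chart_inv c z)) z e e'"
proof -
  have "FD (\<lambda>z. coord_deriv c e' f (chart_inv c z)) z = FD (\<lambda>z'. FD (\<lambda>z. f (chart_inv c z)) z' e') z"
    by (rule FD_cong_open[OF open_chart_image[OF assms(1)] assms(2) coord_deriv_chart_inv[OF assms(1)]])
  then show ?thesis by (simp add: coord_deriv_chart_inv assms)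
qed

locale finsler =
  fixes A :: "('m, real ^ 'n::finite) chart set" and F :: "('m, 'n) tmpoint \<Rightarrow> real"
  assumes finsler: "finsler_manifold A F"
begin

sublocale hausdorff_atlas A
  using finsler unfolding finsler_manifold_def smooth_manifold_def
  by unfold_locales auto

interpretation slit: hausdorff_atlas "slit_atlas A"
  by (rule slit_hausdorff_atlas)

definition slit_image :: "('m, 'n) rchart \<Rightarrow> ((real ^ 'n) \<times> (real ^ 'n)) set" where
  "slit_image c = snd c ` fst c \<times> - {0}"

definition energy :: "('m, 'n) rchart \<Rightarrow> (real ^ 'n) \<times> (real ^ 'n) \<Rightarrow> real" where
  "energy c z = (F (chart_inv (slit_chart A c) z))\<^sup>2"

definition spray :: "('m, 'n) rchart \<Rightarrow> (real ^ 'n) \<times> (real ^ 'n) \<Rightarrow> real ^ 'n" where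
  "spray c z = (\<chi> k. spray_coeff A F c k (chart_inv (slit_chart A c) z))"

lemma open_slit_image: "c \<in> A \<Longrightarrow> open (slit_image c)"
  by (simp add: slit_image_def open_Times open_chart_image open_Compl)

lemma slit_image_eq: "c \<in> A \<Longrightarrow> snd (slit_chart A c) ` fst (slit_chart A c) = slit_image c"
  by (simp add: slit_image_def slit_chart_image)

lemma slit_image_mem: "c \<in> A \<Longrightarrow> u \<in> fst (slit_chart A c) \<Longrightarrow> snd (slit_chart A c) u \<in> slit_image c"
  using slit_image_eq by blast

lemma smooth_energy: "c \<in> A \<Longrightarrow> smooth_on (slit_image c) (energy c)"
proof -
  assume c: "c \<in> A"
  have "smooth_on (slit_image c) (\<lambda>z. F (chart_inv (slit_chart A c) z))"
    using finsler c unfolding finsler_manifold_def smooth_fun_def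
    by (auto simp: slit_image_eq[symmetric] comp_def)
  then show ?thesis
    unfolding energy_def power2_eq_square by (intro smooth_on_mult open_slit_image c)
qed

lemma pd_chart_inv:
  assumes "c \<in> A" "z \<in> slit_image c"
  shows "pd_x A c i (\<lambda>q. (F q)\<^sup>2) (chart_inv (slit_chart A c) z) = FD (energy c) z (axis i 1, 0)"
    and "pd_y A c i (pd_x A c j (\<lambda>q. (F q)\<^sup>2)) (chart_inv (slit_chart A c) z)
      = D2 (energy c) z (0, axis i 1) (axis j 1, 0)"
    and "pd_y A c i (pd_y A c j (\<lambda>q. (F q)\<^sup>2)) (chart_inv (slit_chart A c) z)
      = D2 (energy c) z (0, axis i 1) (0, axis j 1)"
  unfolding pd_x_def pd_y_def energy_def[abs_def]
  using slit.coord_deriv_chart_inv[of "slit_chart A c" z] slit.coord_deriv2_chart_inv[of "slit_chart A c" z]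
    assms by (simp_all add: slit_image_eq)

lemma fund_tensor_chart_inv:
  assumes "c \<in> A" "z \<in> slit_image c"
  shows "fund_tensor A F c (chart_inv (slit_chart A c) z) $ i $ j
    = 1/2 * D2 (energy c) z (0, axis i 1) (0, axis j 1)"
  using pd_chart_inv(3)[OF assms] by (simp add: fund_tensor_def)

lemma D2_energy_vertical:
  assumes "c \<in> A" "z \<in> slit_image c"
  shows "D2 (energy c) z (0, a) (0, b)
    = 2 * (\<Sum>i\<in>UNIV. \<Sum>j\<in>UNIV. fund_tensor A F c (chart_inv (slit_chart A c) z) $ i $ j * a $ i * b $ j)"
proof -
  note L = open_slit_image[OF assms(1)] smooth_energy[OF assms(1)] assms(2)
  have "D2 (energy c) z (0, a) (0, b) = (\<Sum>i\<in>UNIV. a $ i * D2 (energy c) z (0, axis i 1) (0, b))"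
    using linear_coord_sum_snd[OF linear_D2_left[OF L(2,3), where w = "(0, b)"], where b = a] by simp
  also have "\<dots> = (\<Sum>i\<in>UNIV. a $ i * (\<Sum>j\<in>UNIV. b $ j * D2 (energy c) z (0, axis i 1) (0, axis j 1)))"
    using linear_coord_sum_snd[OF linear_D2_right[OF L], where b = b] by simp
  finally show ?thesis
    by (simp add: fund_tensor_chart_inv[OF assms] sum_distrib_left sum_distrib_right mult_ac)
qed

lemma D2_energy_pos:
  assumes "c \<in> A" "z \<in> slit_image c" "\<xi> \<noteq> 0"
  shows "D2 (energy c) z (0, \<xi>) (0, \<xi>) > 0"
proof -
  have "chart_inv (slit_chart A c) z \<in> fst (slit_chart A c)"
    using slit.chart_inv_mem assms by (simp add: slit_image_eq)
  then show ?thesis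
    using finsler assms unfolding finsler_manifold_def D2_energy_vertical[OF assms(1,2)] by simp
qed

text \<open>Positive definiteness leaves no nonzero kernel vector, and a square matrix with trivial
  kernel is invertible.\<close>

lemma fund_tensor_invertible:
  assumes "c \<in> A" "z \<in> slit_image c"
  shows "invertible (fund_tensor A F c (chart_inv (slit_chart A c) z))"
proof -
  let ?H = "fund_tensor A F c (chart_inv (slit_chart A c) z)"
  have "\<xi> = 0" if "?H *v \<xi> = 0" for \<xi>
  proof (rule ccontr)
    assume "\<xi> \<noteq> 0"
    have "(\<Sum>i\<in>UNIV. \<Sum>j\<in>UNIV. ?H $ i $ j * \<xi> $ i * \<xi> $ j) = (\<Sum>i\<in>UNIV. \<xi> $ i * (?H *v \<xi>) $ i)"
      by (simp add: matrix_vector_mult_def sum_distrib_left mult_ac)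
    then show False
      using D2_energy_pos[OF assms \<open>\<xi> \<noteq> 0\<close>] that D2_energy_vertical[OF assms] by simp
  qed
  then show ?thesis by (simp add: invertible_left_inverse matrix_left_invertible_ker)
qed

text \<open>What \<open>spray_coeff\<close> multiplies by the inverse of the fundamental tensor,
  including its factor \<open>1/4\<close>, with the sum over \<open>h\<close> collected into the
  single direction \<open>(snd z, 0)\<close>.\<close>

definition spray_rhs :: "('m, 'n) rchart \<Rightarrow> (real ^ 'n) \<times> (real ^ 'n) \<Rightarrow> real ^ 'n" where
  "spray_rhs c z = (\<chi> k. 1/4 * (D2 (energy c) z (0, axis k 1) (snd z, 0) - FD (energy c) z (axis k 1, 0)))"

lemma fund_tensor_spray:
  assumes c: "c \<in> A" "z \<in> slit_image c"
  shows "fund_tensor A F c (chart_inv (slit_chart A c) z) *v spray c z = spray_rhs c z"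
proof -
  let ?u = "chart_inv (slit_chart A c) z"
  note L = open_slit_image[OF c(1)] smooth_energy[OF c(1)] c(2)
  have "snd (slit_chart A c) ?u = z" using slit.chart_chart_inv c by (simp add: slit_image_eq)
  then have "snd ?u c = snd z" using slit_chart_apply[of c "fst ?u" "snd ?u"] by (metis prod.collapse snd_conv)
  then have rhs: "1/4 * ((\<Sum>h\<in>UNIV. pd_y A c k (pd_x A c h (\<lambda>q. (F q)\<^sup>2)) ?u * snd ?u c $ h)
      - pd_x A c k (\<lambda>q. (F q)\<^sup>2) ?u) = spray_rhs c z $ k" for k
    using linear_coord_sum_fst[OF linear_D2_right[OF L, where v = "(0, axis k 1)"], of "snd z"]
    by (simp add: pd_chart_inv[OF c] spray_rhs_def mult_ac)
  have "spray c z = matrix_inv (fund_tensor A F c ?u) *v spray_rhs c z"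
    by (simp add: vec_eq_iff spray_def spray_coeff_def matrix_vector_mult_def rhs[symmetric]
        sum_distrib_left mult_ac)
  then show ?thesis
    using matrix_inv_right[OF fund_tensor_invertible[OF c]]
    by (simp add: matrix_vector_mul_assoc)
qed

lemma smooth_spray: "c \<in> A \<Longrightarrow> smooth_on (slit_image c) (spray c)"
proof -
  assume c: "c \<in> A"
  note o = open_slit_image[OF c] and E = smooth_energy[OF c]
  have "smooth_on (slit_image c) (\<lambda>z. fund_tensor A F c (chart_inv (slit_chart A c) z) $ i $ j)" for i j
  proof (rule smooth_on_cong[OF o])
    show "smooth_on (slit_image c) (\<lambda>z. 1/2 * D2 (energy c) z (0, axis i 1) (0, axis j 1))"
      by (intro smooth_on_mult o smooth_on_const smooth_on_FD E)
  qed (simp add: fund_tensor_chart_inv[OF c])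
  moreover have "smooth_on (slit_image c) (spray_rhs c)"
  proof (rule smooth_on_vec[OF o])
    fix k
    \<comment> \<open>The direction \<open>(snd z, 0)\<close> moves with \<open>z\<close>, and
      moving directions are handled only as the outer derivative; symmetry then restores the order
      used in \<open>spray_rhs\<close>.\<close>
    have "smooth_on (slit_image c) (\<lambda>z. D2 (energy c) z (snd z, 0) (0, axis k 1))"
      by (rule smooth_on_FD_moving[OF o smooth_on_FD[OF E] smooth_on_id smooth_on_Pair[OF o
            smooth_on_bounded_linear[OF bounded_linear_snd] smooth_on_const]]) auto
    then have "smooth_on (slit_image c) (\<lambda>z. D2 (energy c) z (0, axis k 1) (snd z, 0))"
      by (rule smooth_on_cong[OF o]) (rule FD_FD_commute[OF o _ E])
    then show "smooth_on (slit_image c) (\<lambda>z. spray_rhs c z $ k)"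
      unfolding spray_rhs_def vec_lambda_beta
      by (intro smooth_on_mult o smooth_on_const smooth_on_diff smooth_on_FD E)
  qed
  ultimately show ?thesis
    by (rule smooth_on_linear_system[OF o _ _ fund_tensor_invertible[OF c] fund_tensor_spray[OF c]])
qed

lemma spray_equation_spray:
  assumes c: "c \<in> A" "z \<in> slit_image c"
  shows "spray_equation (energy c) z (spray c z)"
  unfolding spray_equation_def
proof
  fix b
  let ?H = "fund_tensor A F c (chart_inv (slit_chart A c) z)"
  note L = open_slit_image[OF c(1)] smooth_energy[OF c(1)] c(2)
  \<comment> \<open>The factor \<open>4\<close> joins the \<open>2\<close> of the spray equation
    with the \<open>2\<close> from the fundamental tensor being half the Hessian; it cancels the
    \<open>1/4\<close> in \<open>spray_rhs\<close>.\<close>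
  have "2 * D2 (energy c) z (0, b) (0, spray c z) = 4 * (\<Sum>i\<in>UNIV. b $ i * (?H *v spray c z) $ i)"
    unfolding D2_energy_vertical[OF c]
    by (simp add: matrix_vector_mult_def sum_distrib_left mult_ac)
  also have "\<dots> = (\<Sum>i\<in>UNIV. b $ i * D2 (energy c) z (0, axis i 1) (snd z, 0))
      - (\<Sum>i\<in>UNIV. b $ i * FD (energy c) z (axis i 1, 0))"
    unfolding fund_tensor_spray[OF c]
    by (simp add: spray_rhs_def sum_distrib_left sum_subtractf[symmetric] algebra_simps)
  also have "\<dots> = D2 (energy c) z (0, b) (snd z, 0) - FD (energy c) z (b, 0)"
    using linear_coord_sum_snd[OF linear_D2_left[OF L(2,3)], where b = b]
      linear_coord_sum_fst[OF linear_frechet_derivative[OF smooth_on_differentiable[OF L(2,3)]], where b = b] by simp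
  finally show "2 * D2 (energy c) z (0, b) (0, spray c z)
      = D2 (energy c) z (0, b) (snd z, 0) - FD (energy c) z (b, 0)" .
qed

text \<open>Since \<open>F\<close> is a function on the bundle, its square in the two charts differs
  by composition with the tangent map. Hence both sides solve the spray equation of
  \<open>energy d\<close> at the same point, and this has only one solution.\<close>

lemma spray_transform:
  assumes cd: "c \<in> A" "d \<in> A" and x: "x \<in> chart_overlap c d" and y: "y \<noteq> 0"
  shows "spray d (slit_trans (chart_trans c d) (x, y))
    = FD (chart_trans c d) x (spray c (x, y)) - (1/2) *\<^sub>R D2 (chart_trans c d) x y y"
proof -
  let ?\<psi> = "chart_trans c d" and ?S = "chart_overlap c d"
  note S = open_overlap[OF cd] smooth_trans[OF cd] x
  obtain p where p: "p \<in> fst c" "p \<in> fst d" "x = snd c p" using x by blast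
  have sub: "slit_trans ?\<psi> ` (?S \<times> - {0}) \<subseteq> slit_image d"
  proof
    fix w assume "w \<in> slit_trans ?\<psi> ` (?S \<times> - {0})"
    then obtain z where z: "z \<in> chart_overlap (slit_chart A c) (slit_chart A d)" "w = slit_trans ?\<psi> z"
      unfolding slit_chart_overlap[OF cd(1)] by blast
    then obtain u where u: "u \<in> fst (slit_chart A c)" "u \<in> fst (slit_chart A d)" "z = snd (slit_chart A c) u"
      by blast
    then have "w = snd (slit_chart A d) u"
      using slit_chart_trans[OF cd z(1)] z(2) slit_chart_inv[OF cd(1)] by simp
    then show "w \<in> slit_image d" using slit_image_mem[OF cd(2) u(2)] by simp
  qed
  have e: "energy c z = energy d (slit_trans ?\<psi> z)" if "z \<in> ?S \<times> - {0}" for z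
  proof -
    have z: "z \<in> chart_overlap (slit_chart A c) (slit_chart A d)"
      using that unfolding slit_chart_overlap[OF cd(1)] .
    then obtain u where u: "u \<in> fst (slit_chart A c)" "u \<in> fst (slit_chart A d)" "z = snd (slit_chart A c) u"
      by blast
    then show ?thesis
      using slit_chart_trans[OF cd z] slit_chart_inv[OF cd(1) u(1)] slit_chart_inv[OF cd(2) u(2)]
      by (simp add: energy_def comp_def)
  qed
  have surj: "\<exists>a. FD ?\<psi> x a = b" for b
    using FD_trans_inverse[OF cd(2,1) p(2,1)] p(3) by blast
  have "(x, y) \<in> slit_image c" using x y by (auto simp: slit_image_def)
  from spray_equation_transform[OF S y open_slit_image[OF cd(2)] smooth_energy[OF cd(2)] sub e surj
      spray_equation_spray[OF cd(1) this]]
  have "spray_equation (energy d) (slit_trans ?\<psi> (x, y))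
      (FD ?\<psi> x (spray c (x, y)) - (1/2) *\<^sub>R D2 ?\<psi> x y y)" .
  moreover have w: "slit_trans ?\<psi> (x, y) \<in> slit_image d" using sub x y by blast
  ultimately show ?thesis
    using spray_equation_unique[OF open_slit_image[OF cd(2)] smooth_energy[OF cd(2)] w
        D2_energy_pos[OF cd(2) w] spray_equation_spray[OF cd(2) w]] by blast
qed

text \<open>The nonlinear connection as a linear map in \<open>a\<close>, so that its change of
  coordinates can be stated without indices; \<open>nonlin_coeff\<close> gives its matrix
  entries.\<close>

definition nonlin :: "('m, 'n) rchart \<Rightarrow> (real ^ 'n) \<times> (real ^ 'n) \<Rightarrow> real ^ 'n \<Rightarrow> real ^ 'n" where
  "nonlin c z a = FD (spray c) z (0, a)"

lemma spray_differentiable: "c \<in> A \<Longrightarrow> z \<in> slit_image c \<Longrightarrow> spray c differentiable (at z)"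
  using smooth_on_differentiable[OF smooth_spray] .

lemma linear_nonlin: "c \<in> A \<Longrightarrow> z \<in> slit_image c \<Longrightarrow> linear (nonlin c z)"
proof -
  assume "c \<in> A" "z \<in> slit_image c"
  then have l: "linear (FD (spray c) z)" using linear_frechet_derivative[OF spray_differentiable] by blast
  show ?thesis
    unfolding nonlin_def
    using linear_compose[OF _ l, of "\<lambda>a. (0, a)"] by (simp add: comp_def linear_iff)
qed

lemma nonlin_transform:
  assumes cd: "c \<in> A" "d \<in> A" and x: "x \<in> chart_overlap c d" and y: "y \<noteq> 0"
  shows "nonlin d (slit_trans (chart_trans c d) (x, y)) (FD (chart_trans c d) x a)
    = FD (chart_trans c d) x (nonlin c (x, y) a) - D2 (chart_trans c d) x y a"
  unfolding nonlin_def
proof (rule fibre_derivative_transform[OF open_overlap[OF cd] smooth_trans[OF cd] x y])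
  have z: "(x, y) \<in> chart_overlap (slit_chart A c) (slit_chart A d)"
    unfolding slit_chart_overlap[OF cd(1)] using x y by simp
  then obtain u where u: "u \<in> fst (slit_chart A c)" "u \<in> fst (slit_chart A d)" "(x, y) = snd (slit_chart A c) u"
    by blast
  show "spray c differentiable (at (x, y))"
    using spray_differentiable slit_image_mem[OF cd(1) u(1)] u(3) cd by simp
  have "slit_trans (chart_trans c d) (x, y) = snd (slit_chart A d) u"
    using slit_chart_trans[OF cd z] u slit_chart_inv[OF cd(1)] by simp
  then show "spray d differentiable (at (slit_trans (chart_trans c d) (x, y)))"
    using spray_differentiable slit_image_mem[OF cd(2) u(2)] cd by simp
qed (rule spray_transform[OF cd x])

lemma nonlin_coeff_eq:
  assumes "c \<in> A" "u \<in> fst (slit_chart A c)"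
  shows "nonlin_coeff A F c i j u = nonlin c (snd (slit_chart A c) u) (axis i 1) $ j"
proof -
  let ?z = "snd (slit_chart A c) u"
  have "nonlin_coeff A F c i j u = FD (\<lambda>z. spray c z $ j) ?z (0, axis i 1)"
    by (simp add: nonlin_coeff_def pd_y_def coord_deriv_def comp_def spray_def)
  also have "\<dots> = FD (spray c) ?z (0, axis i 1) $ j"
    using FD_eqI[OF bounded_linear.has_derivative[OF bounded_linear_vec_nth
        has_derivative_FD[OF spray_differentiable[OF assms(1) slit_image_mem[OF assms]]]], of j] by simp
  finally show ?thesis by (simp add: nonlin_def)
qed

end

section \<open>The adapted frame and basic connections\<close>

context finsler
begin

interpretation slit: hausdorff_atlas "slit_atlas A"
  by (rule slit_hausdorff_atlas)

lemma vframe_tangent: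
  "c \<in> A \<Longrightarrow> u \<in> fst (slit_chart A c) \<Longrightarrow> vframe A c j u \<in> tangent_space (slit_atlas A) u"
  unfolding vframe_def by (rule slit.coord_field_tangent) auto

lemma vframe_component:
  "c \<in> A \<Longrightarrow> u \<in> fst (slit_chart A c) \<Longrightarrow> vframe A c j u (slit_chart A c) = (0, axis j 1)"
  unfolding vframe_def by (rule slit.coord_field_self) auto

lemma hframe_tangent:
  assumes "c \<in> A" "u \<in> fst (slit_chart A c)"
  shows "hframe A F c i u \<in> tangent_space (slit_atlas A) u"
proof -
  have "hframe A F c i u = tv_add (coord_field (slit_atlas A) (slit_chart A c) (axis i 1, 0) u)
      (tv_scale (-1) (\<lambda>d. \<Sum>j\<in>UNIV. nonlin_coeff A F c i j u *\<^sub>R vframe A c j u d))"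
    by (simp add: hframe_def tv_add_def tv_scale_def)
  also have "\<dots> \<in> tangent_space (slit_atlas A) u"
    by (intro slit.tv_add_tangent slit.tv_scale_tangent slit.tangent_space_linear vframe_tangent
        slit.coord_field_tangent slit_chart_mem assms)
  finally show ?thesis .
qed

lemma hframe_component:
  assumes "c \<in> A" "u \<in> fst (slit_chart A c)"
  shows "hframe A F c i u (slit_chart A c) = (axis i 1, - nonlin c (snd (slit_chart A c) u) (axis i 1))"
  using slit.coord_field_self[of "slit_chart A c" u "(axis i 1, 0)"] assms
  by (simp add: hframe_def vframe_component nonlin_coeff_eq prod_eq_iff fst_sum snd_sum basis_expansion_scaleR)

lemma hframe_combination_component:
  assumes "c \<in> A" "u \<in> fst (slit_chart A c)"
  shows "(\<Sum>i\<in>UNIV. a i *\<^sub>R hframe A F c i u (slit_chart A c))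
    = ((\<chi> i. a i), - nonlin c (snd (slit_chart A c) u) (\<chi> i. a i))"
proof -
  let ?a = "\<chi> i. a i"
  have l: "linear (nonlin c (snd (slit_chart A c) u))" by (rule linear_nonlin[OF assms(1) slit_image_mem[OF assms]])
  have a: "(\<Sum>i\<in>UNIV. a i *\<^sub>R axis i 1) = ?a" using basis_expansion_scaleR[of ?a] by simp
  have "nonlin c (snd (slit_chart A c) u) ?a = (\<Sum>i\<in>UNIV. a i *\<^sub>R nonlin c (snd (slit_chart A c) u) (axis i 1))"
    unfolding a[symmetric] by (simp add: linear_sum[OF l] linear_scale[OF l])
  then show ?thesis
    by (simp add: hframe_component[OF assms] prod_eq_iff fst_sum snd_sum a sum_negf)
qed

text \<open>The off-diagonal block of the Jacobian adds a second derivative of the coordinate change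
  to the fibre component. The inhomogeneous term in the law for \<open>nonlin\<close> is exactly its
  negative, up to the order of the arguments, which symmetry settles.\<close>

lemma horizontal_component_transfer:
  assumes w: "w \<in> tangent_space (slit_atlas A) u" and cd: "c \<in> A" "d \<in> A"
    and u: "u \<in> fst (slit_chart A c)" "u \<in> fst (slit_chart A d)"
    and h: "snd (w (slit_chart A c)) = - nonlin c (snd (slit_chart A c) u) (fst (w (slit_chart A c)))"
  shows "snd (w (slit_chart A d)) = - nonlin d (snd (slit_chart A d) u) (fst (w (slit_chart A d)))"
proof -
  obtain x y where xy: "snd (slit_chart A c) u = (x, y)" by fastforce
  obtain a b where ab: "w (slit_chart A c) = (a, b)" by fastforce
  let ?\<psi> = "chart_trans c d"
  have z: "(x, y) \<in> chart_overlap (slit_chart A c) (slit_chart A d)" using u xy by (metis IntI imageI)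
  then have m: "x \<in> chart_overlap c d" "y \<noteq> 0" by (simp_all add: slit_chart_overlap[OF cd(1)])
  then obtain p where p: "p \<in> fst c" "p \<in> fst d" "x = snd c p" by blast
  have l: "linear (FD ?\<psi> x)" using linear_FD_trans[OF cd p(1,2)] p(3) by simp
  have ud: "snd (slit_chart A d) u = slit_trans ?\<psi> (x, y)"
    using slit_chart_trans[OF cd z] xy slit_chart_inv[OF cd(1) u(1)] by simp
  have c: "D2 ?\<psi> x a y = D2 ?\<psi> x y a"
    by (rule FD_FD_commute[OF open_overlap[OF cd] m(1) smooth_trans[OF cd]])
  show ?thesis
    using h slit_tangentD[OF w cd u xy ab] nonlin_transform[OF cd m, of a] c
    by (simp add: ab xy ud linear_neg[OF l])
qed

text \<open>Replaces the representations in all charts by a condition in one. For the converse, the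
  coefficients in any other chart \<open>d\<close> are the base components of \<open>w\<close>
  there, and the condition in \<open>d\<close> is supplied by the transfer lemma.\<close>

lemma horizontal_iff:
  assumes c: "c \<in> A" "u \<in> fst (slit_chart A c)"
  shows "w \<in> horizontal A F u \<longleftrightarrow> w \<in> tangent_space (slit_atlas A) u \<and>
    snd (w (slit_chart A c)) = - nonlin c (snd (slit_chart A c) u) (fst (w (slit_chart A c)))"
    (is "_ \<longleftrightarrow> ?R")
proof
  assume "w \<in> horizontal A F u"
  then obtain a where w: "w = (\<lambda>d. \<Sum>i\<in>UNIV. a i *\<^sub>R hframe A F c i u d)"
    using c unfolding horizontal_def by blast
  have "w \<in> tangent_space (slit_atlas A) u"
    unfolding w by (intro slit.tangent_space_linear hframe_tangent c)
  then show ?R using hframe_combination_component[OF c, of a] by (simp add: w)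
next
  assume R: ?R
  show "w \<in> horizontal A F u"
    unfolding horizontal_def
  proof (intro CollectI ballI impI)
    fix d assume d: "d \<in> A" "u \<in> fst (slit_chart A d)"
    let ?a = "\<lambda>i. fst (w (slit_chart A d)) $ i"
    have "w = (\<lambda>e. \<Sum>i\<in>UNIV. ?a i *\<^sub>R hframe A F d i u e)"
    proof (rule slit.tangent_space_eqI[of _ u _ "slit_chart A d"])
      show "(\<lambda>e. \<Sum>i\<in>UNIV. ?a i *\<^sub>R hframe A F d i u e) \<in> tangent_space (slit_atlas A) u"
        by (intro slit.tangent_space_linear hframe_tangent d)
      show "w (slit_chart A d) = (\<Sum>i\<in>UNIV. ?a i *\<^sub>R hframe A F d i u (slit_chart A d))"
        using horizontal_component_transfer[of w u c d] R c d
        by (simp add: hframe_combination_component prod_eq_iff)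
    qed (use R d in auto)
    then show "\<exists>a. w = (\<lambda>e. \<Sum>i\<in>UNIV. a i *\<^sub>R hframe A F d i u e)"
      by (intro exI[of _ ?a])
  qed
qed

lemma vframe_combination_component:
  assumes "c \<in> A" "u \<in> fst (slit_chart A c)"
  shows "(\<Sum>j\<in>UNIV. a j *\<^sub>R vframe A c j u (slit_chart A c)) = (0, \<chi> j. a j)"
  using basis_expansion_scaleR[of "\<chi> j. a j"]
  by (simp add: vframe_component[OF assms] prod_eq_iff fst_sum snd_sum)

text \<open>Because the Jacobian is block triangular, the base component transforms by the
  derivative of the base coordinate change alone, so its vanishing does not depend on the
  chart.\<close>

lemma vertical_iff:
  assumes c: "c \<in> A" "u \<in> fst (slit_chart A c)"
  shows "w \<in> vertical A u \<longleftrightarrow> w \<in> tangent_space (slit_atlas A) u \<and> fst (w (slit_chart A c)) = 0"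
    (is "_ \<longleftrightarrow> ?R")
proof
  assume "w \<in> vertical A u"
  then obtain a where w: "w = (\<lambda>d. \<Sum>j\<in>UNIV. a j *\<^sub>R vframe A c j u d)"
    using c unfolding vertical_def by blast
  have "w \<in> tangent_space (slit_atlas A) u"
    unfolding w by (intro slit.tangent_space_linear vframe_tangent c)
  then show ?R using vframe_combination_component[OF c, of a] by (simp add: w)
next
  assume R: ?R
  show "w \<in> vertical A u"
    unfolding vertical_def
  proof (intro CollectI ballI impI)
    fix d assume d: "d \<in> A" "u \<in> fst (slit_chart A d)"
    let ?a = "\<lambda>i. snd (w (slit_chart A d)) $ i"
    have f0: "fst (w (slit_chart A d)) = 0"
    proof -
      obtain x y where xy: "snd (slit_chart A c) u = (x, y)" by fastforce
      obtain b where ab: "w (slit_chart A c) = (0, b)" using R by (metis prod.collapse)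
      have "(x, y) \<in> chart_overlap (slit_chart A c) (slit_chart A d)" using c d xy by (metis IntI imageI)
      then obtain p where p: "p \<in> fst c" "p \<in> fst d" "x = snd c p"
        by (auto simp: slit_chart_overlap[OF c(1)])
      show ?thesis
        using slit_tangentD[of w u c d, OF _ c(1) d(1) c(2) d(2) xy ab] R
          linear_0[OF linear_FD_trans[OF c(1) d(1) p(1,2)]] p(3) by simp
    qed
    have "w = (\<lambda>e. \<Sum>i\<in>UNIV. ?a i *\<^sub>R vframe A d i u e)"
    proof (rule slit.tangent_space_eqI[of _ u _ "slit_chart A d"])
      show "(\<lambda>e. \<Sum>i\<in>UNIV. ?a i *\<^sub>R vframe A d i u e) \<in> tangent_space (slit_atlas A) u"
        by (intro slit.tangent_space_linear vframe_tangent d)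
      show "w (slit_chart A d) = (\<Sum>i\<in>UNIV. ?a i *\<^sub>R vframe A d i u (slit_chart A d))"
        using f0 d by (simp add: vframe_combination_component prod_eq_iff)
    qed (use R d in auto)
    then show "\<exists>a. w = (\<lambda>e. \<Sum>i\<in>UNIV. a i *\<^sub>R vframe A d i u e)"
      by (intro exI[of _ ?a])
  qed
qed

lemma horizontal_eqI:
  assumes c: "c \<in> A" "u \<in> fst (slit_chart A c)" and h: "h \<in> horizontal A F u" "h' \<in> horizontal A F u"
    and eq: "fst (h (slit_chart A c)) = fst (h' (slit_chart A c))"
  shows "h = h'"
proof (rule slit.tangent_space_eqI[of _ u _ "slit_chart A c"])
  show "h (slit_chart A c) = h' (slit_chart A c)"
    using h eq unfolding horizontal_iff[OF c] by (simp add: prod_eq_iff)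
qed (use h c in \<open>auto simp: horizontal_iff[OF c]\<close>)

lemma linear_horizontal: "slit.linear_distribution (horizontal A F)"
  unfolding slit.linear_distribution_def
proof
  fix u assume "u \<in> carrier_of (slit_atlas A)"
  then obtain c where c: "c \<in> A" "u \<in> fst (slit_chart A c)" by (auto simp: mem_carrier_slit_atlas)
  note l = linear_nonlin[OF c(1) slit_image_mem[OF c]]
  show "tv_zero \<in> horizontal A F u \<and> (\<forall>v\<in>horizontal A F u. \<forall>r. tv_scale r v \<in> horizontal A F u) \<and>
      (\<forall>v\<in>horizontal A F u. \<forall>w\<in>horizontal A F u. tv_add v w \<in> horizontal A F u)"
    unfolding Ball_def horizontal_iff[OF c]
    using slit.tv_zero_tangent[of u] slit.tv_scale_tangent[of _ u] slit.tv_add_tangent[of _ u]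
    by (simp add: tv_zero_def tv_scale_def tv_add_def linear_0[OF l] linear_scale[OF l] linear_add[OF l])
qed

lemma linear_vertical: "slit.linear_distribution (vertical A)"
  unfolding slit.linear_distribution_def
proof
  fix u assume "u \<in> carrier_of (slit_atlas A)"
  then obtain c where c: "c \<in> A" "u \<in> fst (slit_chart A c)" by (auto simp: mem_carrier_slit_atlas)
  show "tv_zero \<in> vertical A u \<and> (\<forall>v\<in>vertical A u. \<forall>r. tv_scale r v \<in> vertical A u) \<and>
      (\<forall>v\<in>vertical A u. \<forall>w\<in>vertical A u. tv_add v w \<in> vertical A u)"
    unfolding Ball_def vertical_iff[OF c]
    using slit.tv_zero_tangent[of u] slit.tv_scale_tangent[of _ u] slit.tv_add_tangent[of _ u]
    by (simp add: tv_zero_def tv_scale_def tv_add_def)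
qed

text \<open>The difference of \<open>X u\<close> and \<open>h\<close> has no base component and is
  therefore vertical. Any other decomposition has a horizontal part with the same base component,
  and that component determines a horizontal vector.\<close>

lemma hproj_eqI:
  assumes c: "c \<in> A" "u \<in> fst (slit_chart A c)" and X: "X u \<in> tangent_space (slit_atlas A) u"
    and h: "h \<in> horizontal A F u" and eq: "fst (h (slit_chart A c)) = fst (X u (slit_chart A c))"
  shows "hproj A F X u = h"
proof -
  have u: "u \<in> carrier_of (slit_atlas A)" using c mem_carrier_slit_atlas by blast
  have "(THE h. h \<in> horizontal A F u \<and> (\<exists>w\<in>vertical A u. X u = tv_add h w)) = h"
  proof (rule the_equality)
    let ?w = "tv_add (X u) (tv_scale (-1) h)"
    have "?w \<in> vertical A u"
      using slit.tv_add_tangent[OF X slit.tv_scale_tangent[of h u "-1"]] h eq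
      unfolding vertical_iff[OF c] horizontal_iff[OF c] by (simp add: tv_add_def tv_scale_def)
    moreover have "X u = tv_add h ?w" by (simp add: tv_add_def tv_scale_def)
    ultimately show "h \<in> horizontal A F u \<and> (\<exists>w\<in>vertical A u. X u = tv_add h w)" using h by blast
  next
    fix h' assume h': "h' \<in> horizontal A F u \<and> (\<exists>w\<in>vertical A u. X u = tv_add h' w)"
    then obtain w where w: "w \<in> vertical A u" "X u = tv_add h' w" by blast
    have "fst (h' (slit_chart A c)) = fst (h (slit_chart A c))"
      using w eq unfolding vertical_iff[OF c] by (simp add: tv_add_def)
    then show "h' = h" using horizontal_eqI[OF c] h h' by blast
  qed
  then show ?thesis using u by (simp add: hproj_def)
qed

lemma hproj_component:
  assumes c: "c \<in> A" "u \<in> fst (slit_chart A c)" and X: "X u \<in> tangent_space (slit_atlas A) u"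
  shows "fst (hproj A F X u (slit_chart A c)) = fst (X u (slit_chart A c))"
proof -
  let ?a = "\<lambda>i. fst (X u (slit_chart A c)) $ i"
  let ?h = "\<lambda>d. \<Sum>i\<in>UNIV. ?a i *\<^sub>R hframe A F c i u d"
  have "?h \<in> tangent_space (slit_atlas A) u"
    by (intro slit.tangent_space_linear hframe_tangent c)
  then have "?h \<in> horizontal A F u"
    using hframe_combination_component[OF c, of ?a] by (simp add: horizontal_iff[OF c])
  moreover have *: "fst (?h (slit_chart A c)) = fst (X u (slit_chart A c))"
    using hframe_combination_component[OF c, of ?a] by simp
  ultimately have "hproj A F X u = ?h" using hproj_eqI[of c u X, OF c X] by blast
  then show ?thesis using * by simp
qed

text \<open>Allows a horizontal section to serve as its own lift in the definition of a basic
  connection.\<close>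

lemma hproj_section:
  assumes "Y \<in> gsections (slit_atlas A) (horizontal A F)"
  shows "hproj A F Y = Y"
proof
  fix u show "hproj A F Y u = Y u"
  proof (cases "u \<in> carrier_of (slit_atlas A)")
    case True
    then obtain c where c: "c \<in> A" "u \<in> fst (slit_chart A c)" by (auto simp: mem_carrier_slit_atlas)
    then show ?thesis
      using slit.vfieldsD(1,2)[OF assms True] by (intro hproj_eqI[of c u Y, OF c]) auto
  next
    case False
    then show ?thesis using slit.vfieldsD(3)[OF assms] by (simp add: hproj_def)
  qed
qed

lemma field_component_differentiable:
  assumes "Y \<in> vfields (slit_atlas A)" "c \<in> A" "u \<in> fst (slit_chart A c)"
  shows "(\<lambda>z. Y (chart_inv (slit_chart A c) z) (slit_chart A c)) differentiable (at (snd (slit_chart A c) u))"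
  using slit.vfieldsD(4)[OF assms(1)[unfolded vfields_def], of "slit_chart A c"] assms(2,3)
  by (intro smooth_on_differentiable[of "snd (slit_chart A c) ` fst (slit_chart A c)"]) auto

lemma FD_fst:
  assumes "f differentiable (at x)"
  shows "fst (FD f x v) = FD (\<lambda>x. fst (f x)) x v"
  using FD_eqI[OF bounded_linear.has_derivative[OF bounded_linear_fst has_derivative_FD[OF assms]]] by simp

text \<open>The base components of a vertical \<open>X\<close> vanish identically, so those of \<open>[X, Y]\<close> are the
  derivatives of the base components of \<open>Y\<close> along \<open>X\<close>.\<close>

lemma lie_bracket_vertical_component:
  assumes X: "X \<in> gsections (slit_atlas A) (vertical A)" and Y: "Y \<in> vfields (slit_atlas A)"
    and c: "c \<in> A" "u \<in> fst (slit_chart A c)"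
  shows "fst (lie_bracket (slit_atlas A) X Y u (slit_chart A c))
    = FD (\<lambda>z. fst (Y (chart_inv (slit_chart A c) z) (slit_chart A c))) (snd (slit_chart A c) u) (X u (slit_chart A c))"
proof -
  let ?c = "slit_chart A c" and ?z = "snd (slit_chart A c) u"
  have XV: "X \<in> vfields (slit_atlas A)" using X slit.gsections_subset_vfields by blast
  have "FD (\<lambda>z. fst (X (chart_inv ?c z) ?c)) ?z = FD (\<lambda>z. 0) ?z"
  proof (rule FD_cong_open[OF open_slit_image[OF c(1)] slit_image_mem[OF c]])
    fix z assume "z \<in> slit_image c"
    then have m: "chart_inv ?c z \<in> fst ?c" using slit.chart_inv_mem c(1) by (simp add: slit_image_eq)
    then have "chart_inv ?c z \<in> carrier_of (slit_atlas A)" using c(1) mem_carrier_slit_atlas by blast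
    from slit.vfieldsD(2)[OF X this] show "fst (X (chart_inv ?c z) ?c) = 0"
      by (simp add: vertical_iff[OF c(1) m])
  qed
  then show ?thesis
    using FD_fst[OF field_component_differentiable[OF Y c]] FD_fst[OF field_component_differentiable[OF XV c]] c
    by (simp add: lie_bracket_def)
qed

lemma hframe_local_smooth:
  assumes "c \<in> A"
  shows "smooth_on (snd (slit_chart A c) ` fst (slit_chart A c))
    (\<lambda>z. hframe A F c i (chart_inv (slit_chart A c) z) (slit_chart A c))"
  unfolding slit_image_eq[OF assms]
proof (rule smooth_on_cong[OF open_slit_image[OF assms]])
  show "smooth_on (slit_image c) (\<lambda>z. (axis i 1, 0 - FD (spray c) z (0, axis i 1)))"
    by (intro smooth_on_Pair smooth_on_diff smooth_on_const smooth_on_FD smooth_spray open_slit_image assms)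
  fix z assume z: "z \<in> slit_image c"
  then have "chart_inv (slit_chart A c) z \<in> fst (slit_chart A c)" "snd (slit_chart A c) (chart_inv (slit_chart A c) z) = z"
    using slit.chart_inv_mem slit.chart_chart_inv assms by (simp_all add: slit_image_eq)
  then show "(axis i 1, 0 - FD (spray c) z (0, axis i 1)) = hframe A F c i (chart_inv (slit_chart A c) z) (slit_chart A c)"
    by (simp add: hframe_component[OF assms] nonlin_def)
qed

lemma vframe_local_smooth:
  assumes "c \<in> A"
  shows "smooth_on (snd (slit_chart A c) ` fst (slit_chart A c))
    (\<lambda>z. vframe A c j (chart_inv (slit_chart A c) z) (slit_chart A c))"
proof (rule smooth_on_cong[OF slit.open_chart_image smooth_on_const])
  fix z assume "z \<in> snd (slit_chart A c) ` fst (slit_chart A c)"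
  then have "chart_inv (slit_chart A c) z \<in> fst (slit_chart A c)"
    using slit.chart_inv_mem assms by simp
  then show "(0, axis j 1) = vframe A c j (chart_inv (slit_chart A c) z) (slit_chart A c)"
    by (simp add: vframe_component[OF assms])
qed (simp add: assms)

text \<open>One bump function cuts off all frame fields and all functions, so a single neighbourhood
  \<open>N\<close> serves them together. The clause on functions is needed because function
  linearity and the Leibniz rule are available only for globally smooth coefficients.\<close>

lemma adapted_frame_extension:
  assumes c: "c \<in> A" "u \<in> fst (slit_chart A c)"
  shows "\<exists>N X Y. openin (atlas_topology (slit_atlas A)) N \<and> u \<in> N \<and> N \<subseteq> fst (slit_chart A c) \<and>
    (\<forall>j. X j \<in> gsections (slit_atlas A) (vertical A) \<and> (\<forall>q\<in>N. X j q = vframe A c j q)) \<and>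
    (\<forall>i. Y i \<in> gsections (slit_atlas A) (horizontal A F) \<and> (\<forall>q\<in>N. Y i q = hframe A F c i q)) \<and>
    (\<forall>g. smooth_on (slit_image c) (\<lambda>z. g (chart_inv (slit_chart A c) z)) \<longrightarrow>
        (\<exists>g'. smooth_fun (slit_atlas A) g' \<and> (\<forall>q\<in>N. g' q = g q)))"
proof -
  let ?c = "slit_chart A c"
  have cs: "?c \<in> slit_atlas A" using c by simp
  obtain \<beta> N C where b: "smooth_fun (slit_atlas A) \<beta>" "openin (atlas_topology (slit_atlas A)) N" "u \<in> N"
    "N \<subseteq> fst ?c \<inter> fst ?c" "\<And>q. q \<in> N \<Longrightarrow> \<beta> q = 1" "C \<subseteq> fst ?c \<inter> fst ?c"
    "openin (atlas_topology (slit_atlas A)) (carrier_of (slit_atlas A) - C)" "\<And>q. q \<notin> C \<Longrightarrow> \<beta> q = 0"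
    using slit.bump_function[OF cs slit.openin_chart_domain[OF cs] c(2) c(2)] by metis
  have C: "C \<subseteq> fst ?c" using b(6) by simp
  have one: "slit.cutoff_field ?c \<beta> X q = X q" if "q \<in> N" for X q
    using that b(4,5) by (auto simp: slit.cutoff_field_def tv_scale_def)
  have V: "slit.cutoff_field ?c \<beta> (vframe A c j) \<in> gsections (slit_atlas A) (vertical A)" for j
    by (rule slit.cutoff_field_gsections[OF cs b(1) C b(7,8) linear_vertical])
      (use c(1) vframe_tangent vframe_local_smooth vertical_iff vframe_component in auto)
  have H: "slit.cutoff_field ?c \<beta> (hframe A F c i) \<in> gsections (slit_atlas A) (horizontal A F)" for i
    by (rule slit.cutoff_field_gsections[OF cs b(1) C b(7,8) linear_horizontal])
      (use c(1) hframe_tangent hframe_local_smooth horizontal_iff hframe_component in auto)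
  have G: "\<exists>g'. smooth_fun (slit_atlas A) g' \<and> (\<forall>q\<in>N. g' q = g q)"
    if "smooth_on (slit_image c) (\<lambda>z. g (chart_inv ?c z))" for g
    using slit.cutoff_fun_smooth[OF cs b(1) C b(7,8), of g] that b(4,5)
    by (intro exI[of _ "\<lambda>q. if q \<in> fst ?c then \<beta> q * g q else 0"]) (auto simp: slit_image_eq[OF c(1)])
  show ?thesis
    by (rule exI[of _ N], rule exI[of _ "\<lambda>j. slit.cutoff_field ?c \<beta> (vframe A c j)"],
        rule exI[of _ "\<lambda>i. slit.cutoff_field ?c \<beta> (hframe A F c i)"])
      (use b(2-4) one V H G in simp)
qed

theorem basic_connection_iff:
  assumes conn: "connection_on (slit_atlas A) (horizontal A F) nabla"
  shows "basic_connection A F nabla \<longleftrightarrow>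
    (\<forall>c\<in>A. \<forall>i j. \<forall>u\<in>fst (slit_chart A c).
       local_value (slit_atlas A) (horizontal A F) nabla (vframe A c j) (hframe A F c i) u = tv_zero)"
    (is "_ \<longleftrightarrow> ?R")
proof
  assume basic: "basic_connection A F nabla"
  show ?R
  proof (intro ballI allI)
    fix c i j u assume c: "c \<in> A" "u \<in> fst (slit_chart A c)"
    let ?c = "slit_chart A c"
    have u: "u \<in> carrier_of (slit_atlas A)" using c mem_carrier_slit_atlas by blast
    obtain N X Y where N: "openin (atlas_topology (slit_atlas A)) N" "u \<in> N" "N \<subseteq> fst ?c"
      and X': "\<forall>j. X j \<in> gsections (slit_atlas A) (vertical A) \<and> (\<forall>q\<in>N. X j q = vframe A c j q)"
      and Y': "\<forall>i. Y i \<in> gsections (slit_atlas A) (horizontal A F) \<and> (\<forall>q\<in>N. Y i q = hframe A F c i q)"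
      using adapted_frame_extension[OF c] by (elim exE conjE) blast
    have X: "X j \<in> gsections (slit_atlas A) (vertical A)" "\<And>q. q \<in> N \<Longrightarrow> X j q = vframe A c j q"
      and Y: "Y i \<in> gsections (slit_atlas A) (horizontal A F)" "\<And>q. q \<in> N \<Longrightarrow> Y i q = hframe A F c i q"
      using X' Y' by simp_all
    have XV: "X j \<in> vfields (slit_atlas A)" and YV: "Y i \<in> vfields (slit_atlas A)"
      using X(1) Y(1) slit.gsections_subset_vfields by blast+
    have "local_value (slit_atlas A) (horizontal A F) nabla (vframe A c j) (hframe A F c i) u = nabla (X j) (Y i) u"
      by (rule slit.local_value_eq[OF conn u XV _ Y(1)]) (use N X Y in \<open>auto simp: agree_near_def\<close>)
    \<comment> \<open>The lift of \<open>Y i\<close> is taken to be \<open>Y i\<close>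
      itself.\<close>
    also have "nabla (X j) (Y i) = hproj A F (lie_bracket (slit_atlas A) (X j) (Y i))"
      using basic X(1) Y(1) YV hproj_section[OF Y(1)] unfolding basic_connection_def by blast
    also have "\<dots> u = tv_zero"
    proof (rule hproj_eqI[of c u "lie_bracket (slit_atlas A) (X j) (Y i)", OF c slit.lie_bracket_tangent[OF XV YV]])
      show "tv_zero \<in> horizontal A F u"
        using linear_horizontal u unfolding slit.linear_distribution_def by blast
      \<comment> \<open>On \<open>N\<close> the base component of \<open>Y i\<close> is that of the
        frame field, hence constant, so the bracket has base component zero at \<open>u\<close> and
        projects to \<open>tv_zero\<close>.\<close>
      have "FD (\<lambda>z. fst (Y i (chart_inv ?c z) ?c)) (snd ?c u) = FD (\<lambda>z. axis i 1) (snd ?c u)"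
      proof (rule FD_cong_open)
        show "open (snd ?c ` (fst ?c \<inter> N))" using N(1) c by (simp add: slit.openin_atlas_topology)
        show "snd ?c u \<in> snd ?c ` (fst ?c \<inter> N)" using c N(2) by blast
        show "fst (Y i (chart_inv ?c z) ?c) = axis i 1" if "z \<in> snd ?c ` (fst ?c \<inter> N)" for z
          using that Y(2) hframe_component[OF c(1)] slit_chart_inv[OF c(1)] by auto
      qed
      then show "fst (tv_zero ?c) = fst (lie_bracket (slit_atlas A) (X j) (Y i) u ?c)"
        using lie_bracket_vertical_component[OF X(1) YV c] by (simp add: tv_zero_def)
    qed
    finally show "local_value (slit_atlas A) (horizontal A F) nabla (vframe A c j) (hframe A F c i) u = tv_zero" .
  qed
next
  assume R: ?R
  show "basic_connection A F nabla"
    unfolding basic_connection_def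
  proof ((rule ballI)+, rule impI, rule ext)
    fix X Y Y' u
    assume X: "X \<in> gsections (slit_atlas A) (vertical A)" and Y: "Y \<in> gsections (slit_atlas A) (horizontal A F)"
      and Y': "Y' \<in> vfields (slit_atlas A)" "hproj A F Y' = Y"
    have XV: "X \<in> vfields (slit_atlas A)" using X slit.gsections_subset_vfields by blast
    have DXY: "nabla X Y \<in> gsections (slit_atlas A) (horizontal A F)"
      using conn XV Y unfolding connection_on_def by blast
    show "nabla X Y u = hproj A F (lie_bracket (slit_atlas A) X Y') u"
    proof (cases "u \<in> carrier_of (slit_atlas A)")
      case False
      then show ?thesis using slit.vfieldsD(3)[OF DXY] by (simp add: hproj_def)
    next
      case u: True
      then obtain c where c: "c \<in> A" "u \<in> fst (slit_chart A c)" by (auto simp: mem_carrier_slit_atlas)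
      let ?c = "slit_chart A c" and ?z = "snd (slit_chart A c) u"
      have car: "q \<in> carrier_of (slit_atlas A)" if "q \<in> fst ?c" for q using that c mem_carrier_slit_atlas by blast
      obtain N V H where N: "openin (atlas_topology (slit_atlas A)) N" "u \<in> N" "N \<subseteq> fst ?c"
        and V': "\<forall>j. V j \<in> gsections (slit_atlas A) (vertical A) \<and> (\<forall>q\<in>N. V j q = vframe A c j q)"
        and H': "\<forall>i. H i \<in> gsections (slit_atlas A) (horizontal A F) \<and> (\<forall>q\<in>N. H i q = hframe A F c i q)"
        and ext: "\<forall>g. smooth_on (slit_image c) (\<lambda>z. g (chart_inv ?c z)) \<longrightarrow>
          (\<exists>g'. smooth_fun (slit_atlas A) g' \<and> (\<forall>q\<in>N. g' q = g q))"
        using adapted_frame_extension[OF c] by (elim exE conjE) blast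
      have V: "V j \<in> gsections (slit_atlas A) (vertical A)" "q \<in> N \<Longrightarrow> V j q = vframe A c j q"
        and H: "H i \<in> gsections (slit_atlas A) (horizontal A F)" "q \<in> N \<Longrightarrow> H i q = hframe A F c i q" for i j q
        using V' H' by simp_all
      have VV: "V j \<in> vfields (slit_atlas A)" for j using V(1) slit.gsections_subset_vfields by blast
      have sX: "smooth_on (slit_image c) (\<lambda>z. snd (X (chart_inv ?c z) ?c) $ j)" for j
        using slit.vfieldsD(4)[OF X, of ?c] c(1)
        by (intro smooth_on_vec_nth smooth_on_snd open_slit_image) (simp_all add: slit_image_eq)
      have sY: "smooth_on (slit_image c) (\<lambda>z. fst (Y (chart_inv ?c z) ?c) $ i)" for i
        using slit.vfieldsD(4)[OF Y, of ?c] c(1)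
        by (intro smooth_on_vec_nth smooth_on_fst open_slit_image) (simp_all add: slit_image_eq)
      \<comment> \<open>The coefficients of \<open>X\<close> in the vertical frame are its fibre
        components, those of \<open>Y\<close> in the horizontal frame its base components. They are
        replaced by global smooth functions, so the expansions of \<open>X\<close> and
        \<open>Y\<close> below hold only on \<open>N\<close>, which locality makes
        sufficient.\<close>
      obtain a where a: "\<And>j. smooth_fun (slit_atlas A) (a j)" "\<And>j q. q \<in> N \<Longrightarrow> a j q = snd (X q ?c) $ j"
        using choice[of "\<lambda>j g. smooth_fun (slit_atlas A) g \<and> (\<forall>q\<in>N. g q = snd (X q ?c) $ j)"]
          ext[rule_format, OF sX] by blast
      obtain b where b: "\<And>i. smooth_fun (slit_atlas A) (b i)" "\<And>i q. q \<in> N \<Longrightarrow> b i q = fst (Y q ?c) $ i"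
        using choice[of "\<lambda>i g. smooth_fun (slit_atlas A) g \<and> (\<forall>q\<in>N. g q = fst (Y q ?c) $ i)"]
          ext[rule_format, OF sY] by blast
      have Xq: "X q = slit.vf_lincomb UNIV a V q" if q: "q \<in> N" for q
      proof (rule slit.tangent_space_eqI[of _ q _ ?c])
        have qc: "q \<in> fst ?c" using q N by blast
        show "X q \<in> tangent_space (slit_atlas A) q" using slit.vfieldsD(1)[OF X car[OF qc]] .
        show "slit.vf_lincomb UNIV a V q \<in> tangent_space (slit_atlas A) q"
          unfolding slit.vf_lincomb_def
          by (intro slit.tangent_space_linear slit.vfieldsD(1)[OF V(1)] car qc)
        have "X q \<in> vertical A q" using slit.vfieldsD(2)[OF X car[OF qc]] .
        then show "X q ?c = slit.vf_lincomb UNIV a V q ?c"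
          using vframe_combination_component[OF c(1) qc] q
          by (simp add: slit.vf_lincomb_def V(2) a(2) vertical_iff[OF c(1) qc] prod_eq_iff)
      qed (use c N q in auto)
      have Yq: "Y q = slit.vf_lincomb UNIV b H q" if q: "q \<in> N" for q
      proof (rule horizontal_eqI[of c])
        have qc: "q \<in> fst ?c" using q N by blast
        show "Y q \<in> horizontal A F q" using slit.vfieldsD(2)[OF Y car[OF qc]] .
        have "slit.vf_lincomb UNIV b H \<in> gsections (slit_atlas A) (horizontal A F)"
          by (rule slit.vf_lincomb_gsections) (auto simp: linear_horizontal H b)
        then show "slit.vf_lincomb UNIV b H q \<in> horizontal A F q"
          using slit.vfieldsD(2) car[OF qc] by blast
        show "fst (Y q ?c) = fst (slit.vf_lincomb UNIV b H q ?c)"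
          using hframe_combination_component[OF c(1) qc] q
          by (simp add: slit.vf_lincomb_def H(2) b(2))
      qed (use c N q in auto)
      \<comment> \<open>The assumption speaks of local values; the extensions turn it into a
        statement about global sections, to which linearity and locality in the first argument
        apply.\<close>
      have "nabla (V j) (H i) u = tv_zero" for i j
      proof -
        have "local_value (slit_atlas A) (horizontal A F) nabla (vframe A c j) (hframe A F c i) u = nabla (V j) (H i) u"
          by (rule slit.local_value_eq[OF conn u VV _ H(1)]) (use N V H in \<open>auto simp: agree_near_def\<close>)
        then show ?thesis using R c by simp
      qed
      then have lin: "nabla (slit.vf_lincomb UNIV a V) (H i) u = tv_zero" for i
        using slit.connection_lincomb_left[OF conn, of UNIV V a "H i" u] VV a(1) H(1) by (simp add: tv_zero_def)
      have lX: "slit.vf_lincomb UNIV a V \<in> vfields (slit_atlas A)"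
        unfolding vfields_def
        by (rule slit.vf_lincomb_gsections) (use slit.linear_distribution_tangent_space VV a(1) in \<open>auto simp: vfields_def\<close>)
      have lY: "slit.vf_lincomb UNIV b H \<in> gsections (slit_atlas A) (horizontal A F)"
        by (rule slit.vf_lincomb_gsections) (auto simp: linear_horizontal H b)
      have "agree_near (slit_atlas A) u X (slit.vf_lincomb UNIV a V)"
        unfolding agree_near_def using N Xq by blast
      then have XH: "nabla X (H i) u = tv_zero" for i
        using slit.connection_local_left[OF conn XV lX H(1) u, of i] lin by simp
      have "nabla X Y u = nabla X (slit.vf_lincomb UNIV b H) u"
      proof (rule slit.connection_local_right[OF conn XV Y lY u])
        show "agree_near (slit_atlas A) u Y (slit.vf_lincomb UNIV b H)"
          unfolding agree_near_def using N Yq by blast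
      qed
      \<comment> \<open>In the Leibniz expansion the terms with \<open>nabla X (H i)\<close> vanish
        at \<open>u\<close>, so only the derivatives of the coefficients of \<open>Y\<close> along
        \<open>X\<close> survive.\<close>
      also have "\<dots> = (\<lambda>d. \<Sum>i\<in>UNIV. tv_apply (slit_atlas A) u (X u) (b i) *\<^sub>R hframe A F c i u d)"
        using slit.connection_lincomb_right[OF conn, of UNIV H b X u] H(1) b(1) XV linear_horizontal XH H(2)[OF N(2)]
        by (simp add: tv_zero_def)
      finally have D: "fst (nabla X Y u ?c) = (\<chi> i. tv_apply (slit_atlas A) u (X u) (b i))"
        using hframe_combination_component[OF c] by simp
      have "tv_apply (slit_atlas A) u (X u) (b i)
          = fst (lie_bracket (slit_atlas A) X Y' u ?c) $ i" for i
      proof -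
        have dY': "(\<lambda>z. fst (Y' (chart_inv ?c z) ?c)) differentiable (at ?z)"
          using bounded_linear.has_derivative[OF bounded_linear_fst
              has_derivative_FD[OF field_component_differentiable[OF Y'(1) c]]]
          unfolding differentiable_def by blast
        have "tv_apply (slit_atlas A) u (X u) (b i) = FD (b i \<circ> chart_inv ?c) ?z (X u ?c)"
          using slit.tv_apply_eq_coord_deriv[OF b(1) slit.vfieldsD(1)[OF X u], of ?c] c by (simp add: coord_deriv_def)
        \<comment> \<open>Near \<open>u\<close> the coefficient \<open>b i\<close> is a base
          component of \<open>Y\<close>, and the projection preserves base components. So it can be
          read off from an arbitrary lift \<open>Y'\<close>, which is why the choice of the lift
          does not matter.\<close>
        also have "FD (b i \<circ> chart_inv ?c) ?z = FD (\<lambda>z. fst (Y' (chart_inv ?c z) ?c) $ i) ?z"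
        proof (rule FD_cong_open)
          show "open (snd ?c ` (fst ?c \<inter> N))" using N(1) c by (simp add: slit.openin_atlas_topology)
          show "?z \<in> snd ?c ` (fst ?c \<inter> N)" using c N(2) by blast
          fix z assume "z \<in> snd ?c ` (fst ?c \<inter> N)"
          then obtain q where q: "q \<in> fst ?c" "q \<in> N" "z = snd ?c q" by blast
          have "Y' q \<in> tangent_space (slit_atlas A) q"
            using slit.vfieldsD(1)[OF Y'(1)[unfolded vfields_def] car[OF q(1)]] .
          from hproj_component[of c q Y', OF c(1) q(1) this] show "(b i \<circ> chart_inv ?c) z = fst (Y' (chart_inv ?c z) ?c) $ i"
            using q b(2) slit_chart_inv[OF c(1) q(1)] Y'(2) by simp
        qed
        also have "\<dots> (X u ?c) = FD (\<lambda>z. fst (Y' (chart_inv ?c z) ?c)) ?z (X u ?c) $ i"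
          using FD_eqI[OF bounded_linear.has_derivative[OF bounded_linear_vec_nth has_derivative_FD[OF dY']]] by simp
        finally show ?thesis by (simp add: lie_bracket_vertical_component[OF X Y'(1) c])
      qed
      then have "fst (nabla X Y u ?c) = fst (lie_bracket (slit_atlas A) X Y' u ?c)"
        by (simp add: D vec_eq_iff)
      then show ?thesis
        using hproj_eqI[of c u "lie_bracket (slit_atlas A) X Y'", OF c slit.lie_bracket_tangent[OF XV Y'(1)] slit.vfieldsD(2)[OF DXY u]] by simp
    qed
  qed
qed

end

theorem proposition3p3:
  fixes A :: "('m, real ^ 'n::finite) chart set"
    and F :: "('m, 'n) tmpoint \<Rightarrow> real"
    and nabla :: "('m, 'n) slitfield \<Rightarrow> ('m, 'n) slitfield \<Rightarrow> ('m, 'n) slitfield"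
  assumes "finsler_manifold A F"
    and "connection_on (slit_atlas A) (horizontal A F) nabla"
  shows "basic_connection A F nabla \<longleftrightarrow>
    (\<forall>c\<in>A. \<forall>i j. \<forall>u\<in>fst (slit_chart A c).
       local_value (slit_atlas A) (horizontal A F) nabla (vframe A c j) (hframe A F c i) u = tv_zero)"
  using finsler.basic_connection_iff[OF finsler.intro] assms by blast

end
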